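(* For every $m>0$ and for every $\beta_0>0$ there exists a unique $\beta_\infty>0$ with $\beta_\infty>\beta_0$, such that there exists a unique higher cscK metric $\omega$ having Calabi symmetry on the minimal ruled surface $X=\mathbb{P}(L\oplus\mathcal{O})$, which belongs to the Kähler class $2\pi(\mathsf{C}+mS_\infty)$, which is smooth on $X\smallsetminus(S_0\cup S_\infty)$ and which has conical singularities with cone angles $2\pi\beta_0$ and $2\pi\beta_\infty$ along the divisors $S_0$ and $S_\infty$ respectively.
   Context: Surface. $\Sigma$ is a compact Riemann surface of genus $2$ with a Kähler metric $\omega_\Sigma$ of constant scalar curvature $-2$, normalized so that $\mathrm{Ric}(\omega_\Sigma)=-2\omega_\Sigma$ and $\int_\Sigma\omega_\Sigma=2\pi$. $L\to\Sigma$ is a holomorphic line bundle of degree $-1$ with a Hermitian metric $h$ of curvature form $-\omega_\Sigma$ (so $\sqrt{-1}\partial\bar\partial\ln h=\omega_\Sigma$ locally). $X=\mathbb{P}(L\oplus\mathcal{O})$, where $\mathcal{O}$ is the trivial line bundle, has projection $\mathtt{p}:X\to\Sigma$; $\mathsf{C}$ is the typical fibre, $S_0=\mathbb{P}(\{0\}\oplus\mathcal{O})$ is the zero divisor and $S_\infty=\mathbb{P}(L\oplus\{0\})$ is the infinity divisor; $\mathsf{C},S_0,S_\infty$ also denote the Poincaré dual classes in $H^2(X,\mathbb{R})$. On $X\smallsetminus(S_0\cup S_\infty)$ (which is $L$ minus its zero section), $s$ is the logarithm of the fibrewise squared norm: $s=\ln|w|^2+\ln h(z)$, with $z$ a local holomorphic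 coordinate on $\Sigma$ and $w$ a fibre coordinate of $L$. Calabi symmetry. $\omega$ has Calabi symmetry if on $X\smallsetminus(S_0\cup S_\infty)$ it is a Kähler metric of the form $\omega=\mathtt{p}^*\omega_\Sigma+\sqrt{-1}\partial\bar\partial f(s)$ with $f:\mathbb{R}\to\mathbb{R}$ smooth and strictly convex and $s+f(s)$ strictly increasing. For $\omega$ to be in the class $2\pi(\mathsf{C}+mS_\infty)$ one requires $0\le f'\le m$, $\lim_{s\to-\infty}f'(s)=0$ and $\lim_{s\to\infty}f'(s)=m$. With the momentum variable $\gamma=1+f'(s)\in[1,m+1]$, the momentum profile is $\phi(\gamma)=f''(s)$; in this construction $\omega$ is regarded as completely and uniquely determined by $\phi$. Conical singularity. Let $D$ be a smooth closed complex hypersurface without self-intersections in a complex $n$-manifold, and let $\beta>0$. The model edge metric on $\mathbb{C}^n$ is $\omega_\beta=\sqrt{-1}\sum_{i=1}^{n-1}dz_i\wedge d\bar z_i+\sqrt{-1}|z|^{2\beta-2}dz\wedge d\bar z$, which is regarded as a Kähler current (closed strictly positive $(1,1)$-current) on $\mathbb{C}^n$ for every $\beta>0$. A Kähler current $\omega$ has a conical singularity of cone angle $2\pi\beta$ along $D$ if it is a smooth Kähler metric off $D$ and around every point of $D$ there are holomorphic coordinates $(z_1,\dots,z_{n-1},z)$ with $D=\{z=0\}$ and constants $C_1,C_2>0$ such that $C_1\omega_\beta\le\omega\le C_2\omega_\beta$. For metrics with Calabi symmetry in the class $2\pi(\mathsf{C}+mS_\infty)$, cone angles $2\pi\beta_0$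 along $S_0$ and $2\pi\beta_\infty$ along $S_\infty$ are imposed through the boundary conditions $\phi(1)=\phi(m+1)=0$, $\phi'(1)=\beta_0$, $\phi'(m+1)=-\beta_\infty$ on the smooth profile $\phi:[1,m+1]\to\mathbb{R}$, together with $\phi>0$ on $(1,m+1)$. Higher cscK. For a Kähler metric $\omega$ on a complex $n$-manifold with Hermitian matrix $H$ in local holomorphic coordinates, put $\Theta(\omega)=\bar\partial(H^{-1}\partial H)$. The top Chern form is $c_n(\omega)=\det\left(\frac{\sqrt{-1}}{2\pi}\Theta(\omega)\right)$, and the higher scalar curvature is the function $\lambda(\omega)$ with $c_n(\omega)=\frac{\lambda(\omega)}{n!(2\pi)^n}\omega^n$. The conical metric $\omega$ on $X$ is higher cscK if $\lambda(\omega)$ is constant on $X\smallsetminus(S_0\cup S_\infty)$. *)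

theory Defs
  imports "HOL-Analysis.Analysis" "HOL-Homology.Homology"
begin

section \<open>Smooth maps and Wirtinger derivatives\<close>

primrec Ck_on :: "nat \<Rightarrow> 'v::euclidean_space set \<Rightarrow> ('v \<Rightarrow> 'w::real_normed_vector) \<Rightarrow> bool" where
  "Ck_on 0 S f \<longleftrightarrow> continuous_on S f"
| "Ck_on (Suc k) S f \<longleftrightarrow>
     (\<forall>x\<in>S. f differentiable (at x)) \<and> (\<forall>v. Ck_on k S (\<lambda>x. frechet_derivative f (at x) v))"

text \<open>This is the notion for open \<open>S\<close>; for closed sets see \<open>smooth_up_to_boundary\<close>.\<close>

definition smooth_on :: "'v::euclidean_space set \<Rightarrow> ('v \<Rightarrow> 'w::real_normed_vector) \<Rightarrow> bool" where
  "smooth_on S f \<longleftrightarrow> (\<forall>k. Ck_on k S f)"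

definition smooth_up_to_boundary ::
    "'v::euclidean_space set \<Rightarrow> ('v \<Rightarrow> 'w::real_normed_vector) \<Rightarrow> bool" where
  "smooth_up_to_boundary A f \<longleftrightarrow>
     (\<exists>S g. open S \<and> A \<subseteq> S \<and> smooth_on S g \<and> (\<forall>x\<in>A. g x = f x))"

definition strictly_convex :: "(real \<Rightarrow> real) \<Rightarrow> bool" where
  "strictly_convex f \<longleftrightarrow>
     (\<forall>x y t. x \<noteq> y \<and> 0 < t \<and> t < 1 \<longrightarrow> f ((1 - t) * x + t * y) < (1 - t) * f x + t * f y)"

text \<open>The derivatives \<open>\<partial>/\<partial>z\<close> and \<open>\<partial>/\<partial>z\<close>-bar on the complex plane.\<close>

definition dz :: "(complex \<Rightarrow> complex) \<Rightarrow> complex \<Rightarrow> complex" where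
  "dz u x = (frechet_derivative u (at x) 1 - \<i> * frechet_derivative u (at x) \<i>) / 2"

definition dzbar :: "(complex \<Rightarrow> complex) \<Rightarrow> complex \<Rightarrow> complex" where
  "dzbar u x = (frechet_derivative u (at x) 1 + \<i> * frechet_derivative u (at x) \<i>) / 2"

text \<open>The same in the \<open>l\<close>-th coordinate of a higher-dimensional coordinate space.\<close>

definition wirt :: "'n::finite \<Rightarrow> (complex^'n \<Rightarrow> complex) \<Rightarrow> complex^'n \<Rightarrow> complex" where
  "wirt l u x = (frechet_derivative u (at x) (axis l 1)
                  - \<i> * frechet_derivative u (at x) (axis l \<i>)) / 2"

definition wirtbar :: "'n::finite \<Rightarrow> (complex^'n \<Rightarrow> complex) \<Rightarrow> complex^'n \<Rightarrow> complex" where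
  "wirtbar l u x = (frechet_derivative u (at x) (axis l 1)
                  + \<i> * frechet_derivative u (at x) (axis l \<i>)) / 2"

section \<open>Hermitian metrics and the top Chern form in local coordinates\<close>

text \<open>
  A (1,1)-form is recorded by the matrix \<open>A\<close> for which it equals
  \<open>\<i> * (\<Sum>k l. A $ k $ l * (dz_l \<and> conj dz_k))\<close>: the conjugate differential carries the row
  index. For a Hermitian metric this makes the squared length of \<open>v\<close> equal to the
  conjugate transpose of \<open>v\<close> times \<open>A v\<close>, and this is the convention in which the curvature of
  the Chern connection is \<open>\<partial>\<close>-bar of \<open>H\<^sup>-\<^sup>1 \<partial>H\<close>.
\<close>

definition hform :: "complex^'n^'n \<Rightarrow> complex^'n \<Rightarrow> real" where
  "hform A v = Re (\<Sum>k\<in>UNIV. \<Sum>l\<in>UNIV. cnj (v $ k) * A $ k $ l * v $ l)"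

definition kahler_on :: "(complex^'n) set \<Rightarrow> (complex^'n \<Rightarrow> complex^'n^'n) \<Rightarrow> bool" where
  "kahler_on S H \<longleftrightarrow>
     (\<forall>k l. smooth_on S (\<lambda>x. H x $ k $ l)) \<and>
     (\<forall>x\<in>S. \<forall>k l. H x $ k $ l = cnj (H x $ l $ k)) \<and>
     (\<forall>x\<in>S. \<forall>v. v \<noteq> 0 \<longrightarrow> hform (H x) v > 0) \<and>
     (\<forall>x\<in>S. \<forall>k l j. wirt j (\<lambda>y. H y $ k $ l) x = wirt l (\<lambda>y. H y $ k $ j) x)"

text \<open>
  \<open>wedge_coeff a\<close> is the coefficient of the product over all \<open>k\<close> of \<open>\<i> * (dz_k \<and> conj dz_k)\<close>
  in the wedge product over all \<open>i\<close> of the (1,1)-forms with matrices \<open>a i\<close>.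
\<close>

definition wedge_coeff :: "('n::finite \<Rightarrow> complex^'n^'n) \<Rightarrow> complex" where
  "wedge_coeff a =
     (\<Sum>\<tau> | \<tau> permutes UNIV. \<Sum>\<rho> | \<rho> permutes UNIV.
        of_int (sign \<tau>) * of_int (sign \<rho>) * (\<Prod>i\<in>UNIV. a i $ \<rho> i $ \<tau> i))"

text \<open>
  The (1,1)-form at entry \<open>i j\<close> of the matrix \<open>(\<i>/2\<pi>) \<Theta>\<close>; the minus sign comes from reordering
  \<open>conj dz_k \<and> dz_l\<close>.
\<close>

definition curvature_entry ::
    "(complex^'n \<Rightarrow> complex^'n^'n) \<Rightarrow> 'n::finite \<Rightarrow> 'n \<Rightarrow> complex^'n \<Rightarrow> complex^'n^'n" where
  "curvature_entry H i j x =
     (\<chi> k l. - wirtbar k (\<lambda>y. (matrix_inv (H y) ** (\<chi> p q. wirt l (\<lambda>u. H u $ p $ q) y)) $ i $ j) x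
             / of_real (2 * pi))"

text \<open>The determinant is expanded over permutations, entries being multiplied by the wedge product.\<close>

definition top_chern_coeff :: "(complex^'n \<Rightarrow> complex^'n^'n) \<Rightarrow> complex^'n::finite \<Rightarrow> complex" where
  "top_chern_coeff H x =
     (\<Sum>\<sigma> | \<sigma> permutes UNIV. of_int (sign \<sigma>) * wedge_coeff (\<lambda>i. curvature_entry H i (\<sigma> i) x))"

definition top_power_coeff :: "(complex^'n \<Rightarrow> complex^'n^'n) \<Rightarrow> complex^'n::finite \<Rightarrow> complex" where
  "top_power_coeff H x = wedge_coeff (\<lambda>i. H x)"

definition is_higher_scalar_curvature ::
    "(complex^'n \<Rightarrow> complex^'n^'n) \<Rightarrow> complex^'n::finite \<Rightarrow> real \<Rightarrow> bool" where
  "is_higher_scalar_curvature H x c \<longleftrightarrow>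
     top_chern_coeff H x
       = of_real (c / (fact CARD('n) * (2 * pi) ^ CARD('n))) * top_power_coeff H x"

section \<open>Metrics on complex manifolds given by an atlas\<close>

text \<open>The topology of the manifold is the one induced by the charts.\<close>

record ('p, 'k, 'n) atlas =
  charts :: "'k set"
  dom :: "'k \<Rightarrow> 'p set"
  crd :: "'k \<Rightarrow> 'p \<Rightarrow> complex^'n"

definition points :: "('p, 'k, 'n::finite) atlas \<Rightarrow> 'p set" where
  "points M = (\<Union>k\<in>charts M. dom M k)"

definition atlas_open :: "('p, 'k, 'n::finite) atlas \<Rightarrow> 'p set \<Rightarrow> bool" where
  "atlas_open M V \<longleftrightarrow> V \<subseteq> points M \<and> (\<forall>k\<in>charts M. open (crd M k ` (V \<inter> dom M k)))"

definition holomorphic_map_on ::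
    "(complex^'n) set \<Rightarrow> (complex^'n::finite \<Rightarrow> complex^'n) \<Rightarrow> bool" where
  "holomorphic_map_on S F \<longleftrightarrow>
     (\<forall>x\<in>S. \<exists>D. (F has_derivative D) (at x) \<and> (\<forall>c v. D (c *s v) = c *s D v))"

definition holomorphic_coordinates ::
    "('p, 'k, 'n::finite) atlas \<Rightarrow> 'p set \<Rightarrow> ('p \<Rightarrow> complex^'n) \<Rightarrow> bool" where
  "holomorphic_coordinates M V \<Psi> \<longleftrightarrow>
     atlas_open M V \<and> inj_on \<Psi> V \<and> open (\<Psi> ` V) \<and>
     (\<forall>k\<in>charts M.
        holomorphic_map_on (crd M k ` (V \<inter> dom M k)) (\<Psi> \<circ> inv_into (dom M k) (crd M k)) \<and>
        holomorphic_map_on (\<Psi> ` (V \<inter> dom M k)) (crd M k \<circ> inv_into V \<Psi>))"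

text \<open>
  A metric on (part of) \<open>M\<close> is a family \<open>H\<close> of matrix functions, \<open>H k\<close> being its matrix in the
  chart \<open>k\<close>.
\<close>

definition kahler_off ::
    "('p, 'k, 'n::finite) atlas \<Rightarrow> 'p set \<Rightarrow> ('k \<Rightarrow> complex^'n \<Rightarrow> complex^'n^'n) \<Rightarrow> bool" where
  "kahler_off M Z H \<longleftrightarrow> (\<forall>k\<in>charts M. kahler_on (crd M k ` (dom M k - Z)) (H k))"

definition higher_cscK_off ::
    "('p, 'k, 'n::finite) atlas \<Rightarrow> 'p set \<Rightarrow> ('k \<Rightarrow> complex^'n \<Rightarrow> complex^'n^'n) \<Rightarrow> bool" where
  "higher_cscK_off M Z H \<longleftrightarrow>
     (\<exists>c. \<forall>k\<in>charts M. \<forall>x \<in> crd M k ` (dom M k - Z). is_higher_scalar_curvature (H k) x c)"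

text \<open>The distinguished coordinate \<open>j\<close> is the one vanishing on the hypersurface.\<close>

definition model_edge_metric :: "'n::finite \<Rightarrow> real \<Rightarrow> complex^'n \<Rightarrow> complex^'n^'n" where
  "model_edge_metric j \<beta> x =
     (\<chi> k l. if k \<noteq> l then 0
             else if k = j then of_real (cmod (x $ j) powr (2 * \<beta> - 2)) else 1)"

text \<open>
  \<open>H\<close> is a metric off \<open>Z\<close>, and \<open>D\<close> is a hypersurface contained in \<open>Z\<close> and disjoint from the
  rest of \<open>Z\<close>. The model is pulled back to the chart \<open>k\<close> along the differential of the
  coordinate change.
\<close>

definition conical_along ::
    "('p, 'k, 'n::finite) atlas \<Rightarrow> 'p set \<Rightarrow> ('k \<Rightarrow> complex^'n \<Rightarrow> complex^'n^'n)
      \<Rightarrow> 'n \<Rightarrow> 'p set \<Rightarrow> real \<Rightarrow> bool" where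
  "conical_along M Z H j D \<beta> \<longleftrightarrow>
     kahler_off M Z H \<and>
     (\<forall>p\<in>D. \<exists>V \<Psi> C\<^sub>1 C\<^sub>2.
        p \<in> V \<and> holomorphic_coordinates M V \<Psi> \<and> V \<inter> Z \<subseteq> D \<and>
        V \<inter> D = {q\<in>V. \<Psi> q $ j = 0} \<and> C\<^sub>1 > 0 \<and> C\<^sub>2 > 0 \<and>
        (\<forall>k\<in>charts M. \<forall>q \<in> (V \<inter> dom M k) - D. \<forall>v.
           (let d = frechet_derivative (\<Psi> \<circ> inv_into (dom M k) (crd M k)) (at (crd M k q));
                e = hform (model_edge_metric j \<beta> (\<Psi> q)) (d v)
            in C\<^sub>1 * e \<le> hform (H k (crd M k q)) v \<and> hform (H k (crd M k q)) v \<le> C\<^sub>2 * e)))"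

section \<open>Compact Riemann surfaces and Hermitian line bundles\<close>

record ('a, 'i) surface =
  spc :: "'a topology"
  idx :: "'i set"
  nbh :: "'i \<Rightarrow> 'a set"
  zc :: "'i \<Rightarrow> 'a \<Rightarrow> complex"

definition transition :: "('a, 'i) surface \<Rightarrow> 'i \<Rightarrow> 'i \<Rightarrow> complex \<Rightarrow> complex" where
  "transition S i j = zc S j \<circ> inv_into (nbh S i) (zc S i)"

definition compact_riemann_surface :: "('a, 'i) surface \<Rightarrow> bool" where
  "compact_riemann_surface S \<longleftrightarrow>
     compact_space (spc S) \<and> Hausdorff_space (spc S) \<and> connected_space (spc S) \<and>
     (\<Union>i\<in>idx S. nbh S i) = topspace (spc S) \<and>
     (\<forall>i\<in>idx S. openin (spc S) (nbh S i) \<and> open (zc S i ` nbh S i) \<and>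
        homeomorphic_map (subtopology (spc S) (nbh S i)) (top_of_set (zc S i ` nbh S i)) (zc S i)) \<and>
     (\<forall>i\<in>idx S. \<forall>j\<in>idx S. transition S i j holomorphic_on zc S i ` (nbh S i \<inter> nbh S j))"

text \<open>For a closed oriented surface the first homology is free abelian of rank twice the genus.\<close>

definition has_genus :: "('a, 'i) surface \<Rightarrow> nat \<Rightarrow> bool" where
  "has_genus S g \<longleftrightarrow> homology_group 1 (spc S) \<cong> free_Abelian_group {..<2 * g}"

text \<open>
  A real (1,1)-form on a surface is a family \<open>\<rho>\<close> of real functions: in the coordinate \<open>zc S i\<close> it is
  \<open>\<i> * \<rho> i * (dz \<and> conj dz)\<close>, that is \<open>2 * \<rho> i\<close> times the area form. It is integrated over a
  finite Borel partition subordinate to the charts.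
\<close>

definition kahler_form :: "('a, 'i) surface \<Rightarrow> ('i \<Rightarrow> complex \<Rightarrow> real) \<Rightarrow> bool" where
  "kahler_form S \<rho> \<longleftrightarrow>
     (\<forall>i\<in>idx S. smooth_on (zc S i ` nbh S i) (\<rho> i) \<and> (\<forall>x \<in> zc S i ` nbh S i. \<rho> i x > 0)) \<and>
     (\<forall>i\<in>idx S. \<forall>j\<in>idx S. \<forall>q \<in> nbh S i \<inter> nbh S j.
        \<rho> i (zc S i q) = (cmod (deriv (transition S i j) (zc S i q)))\<^sup>2 * \<rho> j (zc S j q))"

definition has_surface_integral :: "('a, 'i) surface \<Rightarrow> ('i \<Rightarrow> complex \<Rightarrow> real) \<Rightarrow> real \<Rightarrow> bool" where
  "has_surface_integral S \<rho> c \<longleftrightarrow>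
     (\<exists>J P. finite J \<and> J \<subseteq> idx S \<and> disjoint_family_on P J \<and> (\<Union>i\<in>J. P i) = topspace (spc S) \<and>
        (\<forall>i\<in>J. P i \<subseteq> nbh S i \<and> zc S i ` P i \<in> sets borel \<and>
           set_integrable lborel (zc S i ` P i) (\<lambda>x. 2 * \<rho> i x)) \<and>
        c = (\<Sum>i\<in>J. set_lebesgue_integral lborel (zc S i ` P i) (\<lambda>x. 2 * \<rho> i x)))"

text \<open>
  The (1,1)-form \<open>- \<i> \<partial>\<partial>\<close>-bar of \<open>ln \<rho>\<close>: for the density of a Kaehler form it is the Ricci form, for
  the local weights of a Hermitian metric on a line bundle it is the curvature form.
\<close>

definition curvature_density :: "(complex \<Rightarrow> real) \<Rightarrow> complex \<Rightarrow> real" where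
  "curvature_density \<rho> x = - Re (dz (dzbar (\<lambda>y. of_real (ln (\<rho> y)))) x)"

text \<open>
  A line bundle is presented by a total space, a projection and fibre coordinates over the chart
  domains, i.e. the charts are chosen fine enough to trivialise it.
\<close>

record ('a, 'i, 'e) line_bundle =
  tot :: "'e set"
  prj :: "'e \<Rightarrow> 'a"
  triv :: "'i \<Rightarrow> 'e \<Rightarrow> complex"

definition holomorphic_line_bundle :: "('a, 'i) surface \<Rightarrow> ('a, 'i, 'e) line_bundle \<Rightarrow> bool" where
  "holomorphic_line_bundle S L \<longleftrightarrow>
     prj L ` tot L \<subseteq> topspace (spc S) \<and>
     (\<forall>i\<in>idx S. \<forall>q\<in>nbh S i. bij_betw (triv L i) {v\<in>tot L. prj L v = q} UNIV) \<and>
     (\<forall>i\<in>idx S. \<forall>j\<in>idx S. \<exists>g.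
        g holomorphic_on zc S i ` (nbh S i \<inter> nbh S j) \<and>
        (\<forall>v\<in>tot L. prj L v \<in> nbh S i \<inter> nbh S j \<longrightarrow>
           triv L j v = g (zc S i (prj L v)) * triv L i v))"

text \<open>The squared norm of \<open>v\<close> is \<open>(cmod w)\<^sup>2 * h i z\<close> in the local coordinates \<open>z\<close> and \<open>w\<close> of \<open>v\<close>.\<close>

definition hermitian_metric ::
    "('a, 'i) surface \<Rightarrow> ('a, 'i, 'e) line_bundle \<Rightarrow> ('i \<Rightarrow> complex \<Rightarrow> real) \<Rightarrow> bool" where
  "hermitian_metric S L h \<longleftrightarrow>
     (\<forall>i\<in>idx S. smooth_on (zc S i ` nbh S i) (h i) \<and> (\<forall>x \<in> zc S i ` nbh S i. h i x > 0)) \<and>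
     (\<forall>i\<in>idx S. \<forall>j\<in>idx S. \<forall>v\<in>tot L. prj L v \<in> nbh S i \<inter> nbh S j \<longrightarrow>
        (cmod (triv L i v))\<^sup>2 * h i (zc S i (prj L v))
          = (cmod (triv L j v))\<^sup>2 * h j (zc S j (prj L v)))"

text \<open>The degree, computed from the curvature form of a Hermitian metric on the bundle.\<close>

definition has_degree :: "('a, 'i) surface \<Rightarrow> ('i \<Rightarrow> complex \<Rightarrow> real) \<Rightarrow> int \<Rightarrow> bool" where
  "has_degree S h d \<longleftrightarrow>
     has_surface_integral S (\<lambda>i. curvature_density (h i)) (2 * pi * of_int d)"

definition calabi_base ::
    "('a, 'i) surface \<Rightarrow> ('i \<Rightarrow> complex \<Rightarrow> real) \<Rightarrow> ('a, 'i, 'e) line_bundle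
      \<Rightarrow> ('i \<Rightarrow> complex \<Rightarrow> real) \<Rightarrow> bool" where
  "calabi_base S \<rho> L h \<longleftrightarrow>
     compact_riemann_surface S \<and> has_genus S 2 \<and>
     kahler_form S \<rho> \<and> has_surface_integral S \<rho> (2 * pi) \<and>
     (\<forall>i\<in>idx S. \<forall>x \<in> zc S i ` nbh S i. curvature_density (\<rho> i) x = - 2 * \<rho> i x) \<and>
     holomorphic_line_bundle S L \<and> hermitian_metric S L h \<and> has_degree S h (- 1) \<and>
     (\<forall>i\<in>idx S. \<forall>x \<in> zc S i ` nbh S i. curvature_density (h i) x = - \<rho> i x)"

section \<open>The ruled surface \<open>P(L \<oplus> O)\<close>\<close>

definition is_zero :: "('a, 'i) surface \<Rightarrow> ('a, 'i, 'e) line_bundle \<Rightarrow> 'e \<Rightarrow> bool" where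
  "is_zero S L v \<longleftrightarrow> (\<forall>i\<in>idx S. prj L v \<in> nbh S i \<longrightarrow> triv L i v = 0)"

text \<open>The line spanned by \<open>(v, t)\<close> in the fibre of \<open>L \<oplus> O\<close>, with the origin removed.\<close>

definition line_of :: "('a, 'i) surface \<Rightarrow> ('a, 'i, 'e) line_bundle \<Rightarrow> 'e \<Rightarrow> complex \<Rightarrow> ('e \<times> complex) set"
  where
  "line_of S L v t =
     {(v', t'). v' \<in> tot L \<and> prj L v' = prj L v \<and>
        (\<exists>c. c \<noteq> 0 \<and> t' = c * t \<and>
           (\<forall>i\<in>idx S. prj L v \<in> nbh S i \<longrightarrow> triv L i v' = c * triv L i v))}"

definition lines :: "('a, 'i) surface \<Rightarrow> ('a, 'i, 'e) line_bundle \<Rightarrow> ('e \<times> complex) set set" where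
  "lines S L = {line_of S L v t | v t. v \<in> tot L \<and> (\<not> is_zero S L v \<or> t \<noteq> 0)}"

definition lvec :: "('e \<times> complex) set \<Rightarrow> 'e" where
  "lvec q = fst (SOME r. r \<in> q)"

definition lscal :: "('e \<times> complex) set \<Rightarrow> complex" where
  "lscal q = snd (SOME r. r \<in> q)"

definition zero_divisor where
  "zero_divisor S L = {q \<in> lines S L. is_zero S L (lvec q)}"

definition infinity_divisor where
  "infinity_divisor S L = {q \<in> lines S L. lscal q = 0}"

text \<open>
  Over each chart of the surface there are two charts: \<open>(i, False)\<close> with coordinates \<open>(z, w)\<close> off the
  infinity divisor, and \<open>(i, True)\<close> with coordinates \<open>(z, 1/w)\<close> off the zero divisor.
\<close>

definition ruled_surface ::
    "('a, 'i) surface \<Rightarrow> ('a, 'i, 'e) line_bundle \<Rightarrow> (('e \<times> complex) set, 'i \<times> bool, 2) atlas" where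
  "ruled_surface S L =
     \<lparr> charts = idx S \<times> UNIV,
       dom = (\<lambda>(i, b). {q \<in> lines S L. prj L (lvec q) \<in> nbh S i}
                        - (if b then zero_divisor S L else infinity_divisor S L)),
       crd = (\<lambda>(i, b) q.
                let z = zc S i (prj L (lvec q)); a = triv L i (lvec q); t = lscal q
                in vector [z, if b then t / a else a / t]) \<rparr>"

section \<open>Metrics with Calabi symmetry\<close>

text \<open>
  The function \<open>s\<close> in the charts of the ruled surface. In the chart \<open>(i, True)\<close> the second coordinate
  is \<open>1/w\<close>, hence the sign.
\<close>

definition log_norm :: "('i \<Rightarrow> complex \<Rightarrow> real) \<Rightarrow> 'i \<times> bool \<Rightarrow> complex^2 \<Rightarrow> real" where
  "log_norm h = (\<lambda>(i, b) x. (if b then - 1 else 1) * ln ((cmod (x $ 2))\<^sup>2) + ln (h i (x $ 1)))"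

text \<open>The form \<open>p\<^sup>*\<omega> + \<i> \<partial>\<partial>\<close>-bar of \<open>f(s)\<close>, where \<open>\<omega>\<close> has densities \<open>\<rho>\<close>.\<close>

definition calabi_metric ::
    "('i \<Rightarrow> complex \<Rightarrow> real) \<Rightarrow> ('i \<Rightarrow> complex \<Rightarrow> real) \<Rightarrow> (real \<Rightarrow> real)
      \<Rightarrow> 'i \<times> bool \<Rightarrow> complex^2 \<Rightarrow> complex^2^2" where
  "calabi_metric \<rho> h f = (\<lambda>(i, b) x. \<chi> k l.
     (if k = 1 \<and> l = 1 then of_real (\<rho> i (x $ 1)) else 0)
     + wirt l (wirtbar k (\<lambda>y. of_real (f (log_norm h (i, b) y)))) x)"

definition calabi_symmetry ::
    "('a, 'i) surface \<Rightarrow> ('i \<Rightarrow> complex \<Rightarrow> real) \<Rightarrow> ('a, 'i, 'e) line_bundle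
      \<Rightarrow> ('i \<Rightarrow> complex \<Rightarrow> real) \<Rightarrow> (real \<Rightarrow> real) \<Rightarrow> bool" where
  "calabi_symmetry S \<rho> L h f \<longleftrightarrow>
     smooth_on UNIV f \<and> strictly_convex f \<and> strict_mono (\<lambda>s. s + f s) \<and>
     kahler_off (ruled_surface S L) (zero_divisor S L \<union> infinity_divisor S L) (calabi_metric \<rho> h f)"

text \<open>
  The condition on \<open>f\<close> for the metric to lie in \<open>2\<pi>(C + m S\<^sub>\<infinity>)\<close>: the areas of the fibre, of the zero
  divisor and of the infinity divisor are then \<open>2\<pi>m\<close>, \<open>2\<pi>\<close> and \<open>2\<pi>(1 + m)\<close>.
\<close>

definition in_kahler_class :: "real \<Rightarrow> (real \<Rightarrow> real) \<Rightarrow> bool" where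
  "in_kahler_class m f \<longleftrightarrow>
     (\<forall>s. 0 \<le> deriv f s \<and> deriv f s \<le> m) \<and>
     (deriv f \<longlongrightarrow> 0) at_bot \<and> (deriv f \<longlongrightarrow> m) at_top"

text \<open>The profile lives on \<open>[1, m + 1]\<close>; \<open>extensional\<close> fixes its irrelevant values elsewhere.\<close>

definition momentum_profile :: "real \<Rightarrow> (real \<Rightarrow> real) \<Rightarrow> (real \<Rightarrow> real) \<Rightarrow> bool" where
  "momentum_profile m f \<phi> \<longleftrightarrow>
     \<phi> \<in> extensional {1..m + 1} \<and> (\<forall>s. \<phi> (1 + deriv f s) = deriv (deriv f) s)"

definition cone_boundary_conditions :: "real \<Rightarrow> real \<Rightarrow> real \<Rightarrow> (real \<Rightarrow> real) \<Rightarrow> bool" where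
  "cone_boundary_conditions m \<beta>\<^sub>0 \<beta>inf \<phi> \<longleftrightarrow>
     smooth_up_to_boundary {1..m + 1} \<phi> \<and>
     \<phi> 1 = 0 \<and> \<phi> (m + 1) = 0 \<and>
     (\<phi> has_real_derivative \<beta>\<^sub>0) (at 1 within {1..m + 1}) \<and>
     (\<phi> has_real_derivative - \<beta>inf) (at (m + 1) within {1..m + 1}) \<and>
     (\<forall>\<gamma>\<in>{1<..<m + 1}. \<phi> \<gamma> > 0)"

text \<open>
  The metric is determined by its profile only up to the fibre dilations of \<open>L\<close>, which translate
  \<open>s\<close>; a metric is therefore represented by its profile \<open>\<phi>\<close>.
\<close>

definition conical_higher_cscK_profile ::
    "('a, 'i) surface \<Rightarrow> ('i \<Rightarrow> complex \<Rightarrow> real) \<Rightarrow> ('a, 'i, 'e) line_bundle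
      \<Rightarrow> ('i \<Rightarrow> complex \<Rightarrow> real) \<Rightarrow> real \<Rightarrow> real \<Rightarrow> real \<Rightarrow> (real \<Rightarrow> real) \<Rightarrow> bool" where
  "conical_higher_cscK_profile S \<rho> L h m \<beta>\<^sub>0 \<beta>inf \<phi> \<longleftrightarrow>
     (\<exists>f. let X = ruled_surface S L; S\<^sub>0 = zero_divisor S L; Sinf = infinity_divisor S L;
              \<omega> = calabi_metric \<rho> h f
          in calabi_symmetry S \<rho> L h f \<and> in_kahler_class m f \<and> momentum_profile m f \<phi> \<and>
             cone_boundary_conditions m \<beta>\<^sub>0 \<beta>inf \<phi> \<and>
             conical_along X (S\<^sub>0 \<union> Sinf) \<omega> 2 S\<^sub>0 \<beta>\<^sub>0 \<and>
             conical_along X (S\<^sub>0 \<union> Sinf) \<omega> 2 Sinf \<beta>inf \<and>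
             higher_cscK_off X (S\<^sub>0 \<union> Sinf) \<omega>)"

end

theory Submission
  imports Defs "HOL-Real_Asymp.Real_Asymp"
begin

text \<open>
  In the frame \<open>dz\<close>, \<open>\<partial>s\<close> the metric is diagonal with entries \<open>\<gamma>\<rho>\<close> and \<open>\<phi>\<close>, and its curvature gives
  \<open>\<lambda> \<gamma>\<^sup>2 / 2 = (\<gamma> + \<phi>) \<phi>'' + (\<phi>' - \<phi> / \<gamma>)\<^sup>2\<close>. For \<open>V = (1 + \<phi> / \<gamma>)\<^sup>2\<close> this is the linear equation
  \<open>(\<gamma>\<^sup>2 V')' = \<lambda> \<gamma>\<^sup>2\<close>, so \<open>V\<close> is a combination of \<open>\<gamma>\<^sup>2\<close>, \<open>1\<close> and \<open>1 / \<gamma>\<close>. The conditions at both ends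
  \<open>1\<close> and \<open>M = m + 1\<close> determine the three constants together with
  \<open>\<beta>\<^sub>\<infinity> = \<beta>\<^sub>0 (2M + 1) / (M + 2) > \<beta>\<^sub>0\<close>. Conversely, the resulting profile is positive inside the interval and
  vanishes to first order at its ends, so that the flow \<open>\<gamma>' = \<phi>(\<gamma>)\<close> exists for all times and
  \<open>\<phi>(\<gamma>(s))\<close> is comparable to \<open>exp (\<beta>\<^sub>0 s)\<close> at \<open>-\<infinity>\<close> and to \<open>exp (- \<beta>\<^sub>\<infinity> s)\<close> at \<open>\<infinity>\<close>, which is the
  required cone behaviour.
\<close>

section \<open>Calculus of smooth maps\<close>

text \<open>Where the constants come from: x (V - 1) is a combination of x^3, x and 1. It vanishes
  at 1 and M, and having no quadratic term its roots add up to zero, so the third root is - (M + 1).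
  Hence x (V - 1) = 2 k (x - 1) (M - x) (x + M + 1) with a single free scale k. Since x (V - 1) = 2
  \<phi> + \<phi>^2 / x, the slope of \<phi> at each end is, up to sign, k times the product of the
  distances to the other two roots: k (M - 1) (M + 2) at 1 and k (M - 1) (2 M + 1) at M. Prescribing
  the first fixes k and with it the second, which is larger because M lies farther than 1 from the
  third root. On the geometric side the metric is used as the quadratic form \<gamma> \<rho> |dz|^2
  + \<phi> |\<partial>s|^2. Positivity, cone bounds and independence of the chart then follow from
  the behaviour of dz and s alone, without second derivatives of coordinate changes. Only the
  curvature is computed entry by entry, in one chart whose sign parameter \<epsilon> covers both
  fibre coordinates w and 1 / w.\<close>

lemma Ck_on_cong:
  assumes "open S" "\<And>x. x \<in> S \<Longrightarrow> f x = g x" "Ck_on k S f"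
  shows "Ck_on k S g"
  using assms(2,3)
proof (induction k arbitrary: f g)
  case 0
  then show ?case using continuous_on_cong[of S S f g] by simp
next
  case (Suc k)
  have d: "(g has_derivative frechet_derivative f (at x)) (at x)" if "x \<in> S" for x
    by (rule has_derivative_transform_within_open[OF _ assms(1) that Suc.prems(1)])
      (use Suc.prems(2) that in \<open>auto simp: frechet_derivative_works\<close>)
  have e: "frechet_derivative f (at x) = frechet_derivative g (at x)" if "x \<in> S" for x
    using frechet_derivative_at[OF d[OF that]] .
  have "Ck_on k S (\<lambda>x. frechet_derivative g (at x) v)" for v
    by (rule Suc.IH[of "\<lambda>x. frechet_derivative f (at x) v"]) (use e Suc.prems(2) in auto)
  then show ?case using d by (auto simp: differentiable_def)
qed

lemma Ck_on_subset: "Ck_on k S f \<Longrightarrow> T \<subseteq> S \<Longrightarrow> Ck_on k T f"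
  by (induction k arbitrary: f) (auto intro: continuous_on_subset)

lemma Ck_on_Suc_imp: "Ck_on (Suc k) S f \<Longrightarrow> Ck_on k S f"
proof (induction k arbitrary: f)
  case 0
  then show ?case
    using differentiable_imp_continuous_on[of f S] by (auto simp: differentiable_on_def
        intro: differentiable_at_withinI)
next
  case (Suc k)
  then show ?case by (auto intro: Suc.IH)
qed

text \<open>Lets any derivative found by the differentiation rules stand in for the chosen
  \<open>frechet_derivative\<close>.\<close>

lemma Ck_on_SucI:
  assumes "open S" "\<And>x. x \<in> S \<Longrightarrow> (f has_derivative D x) (at x)"
    "\<And>v. Ck_on k S (\<lambda>x. D x v)"
  shows "Ck_on (Suc k) S f"
proof -
  have "Ck_on k S (\<lambda>x. frechet_derivative f (at x) v)" for v
    by (rule Ck_on_cong[OF assms(1) _ assms(3)[of v]]) (simp add: frechet_derivative_at[OF assms(2)])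
  then show ?thesis using assms(2) by (auto simp: differentiable_def)
qed

lemma Ck_on_has_derivative:
  "Ck_on (Suc k) S f \<Longrightarrow> x \<in> S \<Longrightarrow> (f has_derivative frechet_derivative f (at x)) (at x)"
  by (simp add: frechet_derivative_works[symmetric])

lemma Ck_on_const: "Ck_on k S (\<lambda>x. c)"
proof (induction k arbitrary: c)
  case (Suc k)
  then show ?case by simp
qed simp

lemma Ck_on_linear:
  assumes "open S" "bounded_linear L" "Ck_on k S f"
  shows "Ck_on k S (\<lambda>x. L (f x))"
  using assms(3)
proof (induction k arbitrary: f)
  case 0
  then show ?case by (simp add: bounded_linear.continuous_on[OF assms(2)])
next
  case (Suc k)
  show ?case
  proof (rule Ck_on_SucI[OF assms(1)])
    show "((\<lambda>x. L (f x)) has_derivative (\<lambda>v. L (frechet_derivative f (at x) v))) (at x)"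
      if "x \<in> S" for x
      using bounded_linear.has_derivative[OF assms(2) Ck_on_has_derivative[OF Suc.prems that]] .
    show "Ck_on k S (\<lambda>x. L (frechet_derivative f (at x) v))" for v
      using Suc by simp
  qed
qed

lemma Ck_on_bounded_linear:
  assumes "open S" "bounded_linear L"
  shows "Ck_on k S L"
proof (cases k)
  case 0
  then show ?thesis using assms(2) by (simp add: linear_continuous_on)
next
  case (Suc n)
  show ?thesis unfolding Suc
    by (rule Ck_on_SucI[OF assms(1), where D="\<lambda>_. L"])
      (auto intro: bounded_linear_imp_has_derivative assms(2) Ck_on_const)
qed

lemma Ck_on_add:
  assumes "open S" "Ck_on k S f" "Ck_on k S g"
  shows "Ck_on k S (\<lambda>x. f x + g x)"
  using assms(2,3)
proof (induction k arbitrary: f g)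
  case 0
  then show ?case by (simp add: continuous_on_add)
next
  case (Suc k)
  show ?case
  proof (rule Ck_on_SucI[OF assms(1)])
    show "((\<lambda>x. f x + g x) has_derivative
        (\<lambda>v. frechet_derivative f (at x) v + frechet_derivative g (at x) v)) (at x)" if "x \<in> S" for x
      using that Suc.prems by (intro has_derivative_add) (auto intro: Ck_on_has_derivative)
  qed (use Suc in auto)
qed

lemma Ck_on_bilinear:
  assumes "open S" "bounded_bilinear B" "Ck_on k S f" "Ck_on k S g"
  shows "Ck_on k S (\<lambda>x. B (f x) (g x))"
  using assms(3,4)
  proof (induction k arbitrary: f g)
    case 0
    then show ?case by (simp add: bounded_bilinear.continuous_on[OF assms(2)])
  next
    case (Suc k)
    show ?case
    proof (rule Ck_on_SucI[OF assms(1)])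
      show "((\<lambda>x. B (f x) (g x)) has_derivative
          (\<lambda>v. B (f x) (frechet_derivative g (at x) v) + B (frechet_derivative f (at x) v) (g x))) (at x)"
        if "x \<in> S" for x
        using that Suc.prems
        by (intro bounded_bilinear.FDERIV[OF assms(2)]) (auto intro: Ck_on_has_derivative)
      show "Ck_on k S (\<lambda>x. B (f x) (frechet_derivative g (at x) v)
                          + B (frechet_derivative f (at x) v) (g x))" for v
        using Suc.prems Suc.prems[THEN Ck_on_Suc_imp]
        by (intro Ck_on_add[OF assms(1)] Suc.IH) auto
    qed
  qed

lemma Ck_on_mult:
  fixes f g :: "'v::euclidean_space \<Rightarrow> 'w::real_normed_algebra"
  shows "open S \<Longrightarrow> Ck_on k S f \<Longrightarrow> Ck_on k S g \<Longrightarrow> Ck_on k S (\<lambda>x. f x * g x)"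
  by (rule Ck_on_bilinear[OF _ bounded_bilinear_mult])

lemma Ck_on_sum:
  assumes "open S" "\<And>i. i \<in> I \<Longrightarrow> Ck_on k S (f i)"
  shows "Ck_on k S (\<lambda>x. \<Sum>i\<in>I. f i x)"
  using assms(2)
  by (induction I rule: infinite_finite_induct) (auto intro: Ck_on_add assms(1) Ck_on_const)

text \<open>The chain rule differentiates \<open>g\<close> in a direction that varies with the
  point, while \<open>Ck_on\<close> speaks of fixed directions. Expanding the direction in the basis
  leaves scalar coefficients times fixed-direction derivatives of \<open>g\<close>; to these the
  induction hypothesis applies, which is why it is stated for all \<open>g\<close>.\<close>

lemma Ck_on_compose:
  fixes s :: "'u::euclidean_space \<Rightarrow> 'v::euclidean_space"
  assumes "open S" "open T" "s ` S \<subseteq> T" "Ck_on k T g" "Ck_on k S s"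
  shows "Ck_on k S (\<lambda>x. g (s x))"
  using assms(4,5)
proof (induction k arbitrary: g)
  case 0
  then show ?case using assms(3) by (auto intro: continuous_on_compose2)
next
  case (Suc k)
  have sx: "s x \<in> T" if "x \<in> S" for x using that assms(3) by auto
  show ?case
  proof (rule Ck_on_SucI[OF assms(1)])
    fix x assume x: "x \<in> S"
    let ?G = "frechet_derivative g (at (s x))" and ?s = "frechet_derivative s (at x)"
    have g: "(g has_derivative ?G) (at (s x))"
      using Ck_on_has_derivative[OF Suc.prems(1) sx[OF x]] .
    have "?G w = (\<Sum>b\<in>Basis. (w \<bullet> b) *\<^sub>R ?G b)" for w
      using linear_sum[OF has_derivative_linear[OF g], of "\<lambda>b. (w \<bullet> b) *\<^sub>R b" Basis]
        linear_scale[OF has_derivative_linear[OF g]] by (simp add: euclidean_representation)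
    then have "(\<lambda>v. ?G (?s v)) = (\<lambda>v. \<Sum>b\<in>Basis. (?s v \<bullet> b) *\<^sub>R ?G b)"
      by (rule ext)
    then show "((\<lambda>x. g (s x)) has_derivative (\<lambda>v. \<Sum>b\<in>Basis. (?s v \<bullet> b) *\<^sub>R ?G b)) (at x)"
      using has_derivative_compose[OF Ck_on_has_derivative[OF Suc.prems(2) x] g] by (simp only:)
  next
    fix v
    have "Ck_on k S (\<lambda>x. (frechet_derivative s (at x) v \<bullet> b) *\<^sub>R frechet_derivative g (at (s x)) b)"
      for b
    proof (rule Ck_on_bilinear[OF assms(1) bounded_bilinear_scaleR])
      show "Ck_on k S (\<lambda>x. frechet_derivative s (at x) v \<bullet> b)"
        by (rule Ck_on_linear[OF assms(1) bounded_linear_inner_left]) (use Suc.prems(2) in simp)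
      show "Ck_on k S (\<lambda>x. frechet_derivative g (at (s x)) b)"
        by (rule Suc.IH) (use Suc.prems Ck_on_Suc_imp in auto)
    qed
    then show "Ck_on k S (\<lambda>x. \<Sum>b\<in>Basis. (frechet_derivative s (at x) v \<bullet> b)
                                  *\<^sub>R frechet_derivative g (at (s x)) b)"
      by (intro Ck_on_sum[OF assms(1)])
  qed
qed

lemma Ck_on_real_SucI:
  fixes f :: "real \<Rightarrow> real"
  assumes "open S" "\<And>x. x \<in> S \<Longrightarrow> (f has_real_derivative f' x) (at x)" "Ck_on k S f'"
  shows "Ck_on (Suc k) S f"
proof (rule Ck_on_SucI[OF assms(1)])
  show "(f has_derivative (\<lambda>v. v * f' x)) (at x)" if "x \<in> S" for x
    using assms(2)[OF that] by (simp add: has_field_derivative_def mult_commute_abs)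
  show "Ck_on k S (\<lambda>x. v * f' x)" for v
    by (intro Ck_on_mult Ck_on_const assms)
qed

lemma frechet_derivative_real:
  fixes f :: "real \<Rightarrow> real"
  assumes "f differentiable (at x)"
  shows "frechet_derivative f (at x) v = v * deriv f x"
proof -
  obtain D where D: "(f has_real_derivative D) (at x)"
    using assms by (auto simp: real_differentiable_def)
  show ?thesis
    using frechet_derivative_at[OF D[unfolded has_field_derivative_def]] DERIV_imp_deriv[OF D]
    by (metis mult.commute)
qed

lemma smooth_on_deriv:
  fixes f :: "real \<Rightarrow> real"
  assumes "open S" "smooth_on S f"
  shows "smooth_on S (deriv f)"
  unfolding smooth_on_def
proof
  fix k
  have C: "Ck_on (Suc k) S f" using assms(2) by (simp add: smooth_on_def)
  show "Ck_on k S (deriv f)"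
    by (rule Ck_on_cong[of S "\<lambda>x. frechet_derivative f (at x) 1", OF assms(1)])
      (use C frechet_derivative_real[of f] in auto)
qed

lemma smooth_on_DERIV:
  fixes f :: "real \<Rightarrow> real"
  assumes "smooth_on S f" "x \<in> S"
  shows "(f has_real_derivative deriv f x) (at x)"
proof -
  have "Ck_on 1 S f" using assms by (simp add: smooth_on_def)
  then have "f differentiable (at x)" using assms(2) by simp
  then show ?thesis
    using DERIV_imp_deriv by (auto simp: real_differentiable_def)
qed

text \<open>Differentiation only shifts the exponent, so the induction runs over all powers at once.
  The inverse and the square root are then instances, and the logarithm follows through its
  derivative.\<close>

lemma Ck_on_powr: "Ck_on k {0<..} (\<lambda>x::real. x powr a)"
proof (induction k arbitrary: a)
  case 0
  then show ?case by (auto intro!: continuous_intros)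
next
  case (Suc k)
  show ?case
  proof (rule Ck_on_real_SucI)
    show "((\<lambda>x. x powr a) has_real_derivative a * x powr (a - 1)) (at x)" if "x \<in> {0<..}" for x
      using that by (intro has_real_derivative_powr) simp
    show "Ck_on k {0<..} (\<lambda>x. a * x powr (a - 1))"
      by (intro Ck_on_mult Ck_on_const Suc) simp
  qed simp
qed

lemma smooth_on_powr: "smooth_on {0<..} (\<lambda>x::real. x powr a)"
  by (simp add: smooth_on_def Ck_on_powr)

lemma smooth_on_cong:
  "open S \<Longrightarrow> smooth_on S f \<Longrightarrow> (\<And>x. x \<in> S \<Longrightarrow> f x = g x) \<Longrightarrow> smooth_on S g"
  unfolding smooth_on_def using Ck_on_cong by blast

lemma smooth_on_inverse: "smooth_on {0<..} (inverse :: real \<Rightarrow> real)"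
  by (rule smooth_on_cong[OF _ smooth_on_powr[of "-1"]]) (auto simp: powr_minus)

lemma smooth_on_sqrt: "smooth_on {0<..} sqrt"
  by (rule smooth_on_cong[OF _ smooth_on_powr[of "1/2"]]) (auto simp: powr_half_sqrt)

lemma smooth_on_ln: "smooth_on {0<..} (ln :: real \<Rightarrow> real)"
  unfolding smooth_on_def
proof
  fix k
  show "Ck_on k {0<..} (ln :: real \<Rightarrow> real)"
  proof (cases k)
    case (Suc n)
    have "Ck_on n {0<..} (inverse :: real \<Rightarrow> real)"
      using smooth_on_inverse by (simp add: smooth_on_def)
    then show ?thesis unfolding Suc
      by (intro Ck_on_real_SucI[where f'=inverse]) (auto intro: DERIV_ln)
  qed (auto intro!: continuous_intros)
qed

lemma smooth_on_subset: "smooth_on S f \<Longrightarrow> T \<subseteq> S \<Longrightarrow> smooth_on T f"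
  unfolding smooth_on_def using Ck_on_subset by blast

lemma smooth_on_const: "smooth_on S (\<lambda>x. c)"
  by (simp add: smooth_on_def Ck_on_const)

lemma smooth_on_mult:
  fixes f g :: "'v::euclidean_space \<Rightarrow> 'w::real_normed_algebra"
  shows "open S \<Longrightarrow> smooth_on S f \<Longrightarrow> smooth_on S g \<Longrightarrow> smooth_on S (\<lambda>x. f x * g x)"
  by (simp add: smooth_on_def Ck_on_mult)

lemma smooth_on_add:
  "open S \<Longrightarrow> smooth_on S f \<Longrightarrow> smooth_on S g \<Longrightarrow> smooth_on S (\<lambda>x. f x + g x)"
  by (simp add: smooth_on_def Ck_on_add)

lemma smooth_on_linear:
  "open S \<Longrightarrow> bounded_linear L \<Longrightarrow> smooth_on S f \<Longrightarrow> smooth_on S (\<lambda>x. L (f x))"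
  by (simp add: smooth_on_def Ck_on_linear)

lemma smooth_on_bounded_linear: "open S \<Longrightarrow> bounded_linear L \<Longrightarrow> smooth_on S L"
  by (simp add: smooth_on_def Ck_on_bounded_linear)

lemma smooth_on_compose:
  fixes s :: "'u::euclidean_space \<Rightarrow> 'v::euclidean_space"
  assumes "open S" "open T" "s ` S \<subseteq> T" "smooth_on T g" "smooth_on S s"
  shows "smooth_on S (\<lambda>x. g (s x))"
  using assms by (auto simp: smooth_on_def intro: Ck_on_compose)

lemma smooth_on_has_derivative:
  assumes "smooth_on S f" "x \<in> S"
  shows "(f has_derivative frechet_derivative f (at x)) (at x)"
  by (rule Ck_on_has_derivative[of 0]) (use assms smooth_on_def in blast)+

lemma smooth_on_frechet_derivative:
  assumes "smooth_on S f"
  shows "smooth_on S (\<lambda>x. frechet_derivative f (at x) v)"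
  unfolding smooth_on_def
proof
  fix k
  have "Ck_on (Suc k) S f" using assms smooth_on_def by blast
  then show "Ck_on k S (\<lambda>x. frechet_derivative f (at x) v)" by simp
qed

lemma smooth_on_continuous: "smooth_on S f \<Longrightarrow> continuous_on S f"
  using Ck_on.simps(1) smooth_on_def by blast

section \<open>Wirtinger calculus\<close>

lemma has_real_derivative_along_line:
  fixes u :: "'v::euclidean_space \<Rightarrow> real"
  assumes "(u has_derivative D) (at (x + t *\<^sub>R v))"
  shows "((\<lambda>t. u (x + t *\<^sub>R v)) has_real_derivative D v) (at t)"
proof -
  have "((\<lambda>t. u (x + t *\<^sub>R v)) has_derivative (\<lambda>k. D (k *\<^sub>R v))) (at t)"
    by (rule has_derivative_compose[where f="\<lambda>t. x + t *\<^sub>R v" and g=u, OF _ assms]) (auto intro!: derivative_eq_intros)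
  moreover have "D (k *\<^sub>R v) = k * D v" for k
    using linear_scale[OF has_derivative_linear[OF assms]] by simp
  ultimately show ?thesis
    by (simp add: has_field_derivative_def mult_commute_abs)
qed

text \<open>Two mean value theorems: the difference in direction \<open>w\<close> is differentiated
  along \<open>v\<close>, and the resulting difference of \<open>Dv\<close> is then differentiated
  along \<open>w\<close>. The bound on \<open>dist x y\<close> makes the intermediate point converge
  to \<open>x\<close> as \<open>t\<close> tends to 0.\<close>

lemma second_difference_mean_value:
  fixes u :: "'v::euclidean_space \<Rightarrow> real"
  assumes u: "smooth_on (ball x r) u" and t: "0 < t" "t * (norm v + norm w) < r"
  shows "\<exists>y. dist x y \<le> t * (norm v + norm w) \<and>
    u (x + t *\<^sub>R v + t *\<^sub>R w) - u (x + t *\<^sub>R v) - u (x + t *\<^sub>R w) + u x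
      = t\<^sup>2 * frechet_derivative (\<lambda>y. frechet_derivative u (at y) v) (at y) w"
proof -
  define Dv where "Dv = (\<lambda>y. frechet_derivative u (at y) v)"
  have Dv: "smooth_on (ball x r) Dv"
    unfolding Dv_def by (rule smooth_on_frechet_derivative[OF u])
  have nm: "norm (\<xi> *\<^sub>R v + \<eta> *\<^sub>R w) \<le> t * (norm v + norm w)"
    if "0 \<le> \<xi>" "\<xi> \<le> t" "0 \<le> \<eta>" "\<eta> \<le> t" for \<xi> \<eta>
  proof -
    have "norm (\<xi> *\<^sub>R v + \<eta> *\<^sub>R w) \<le> \<xi> * norm v + \<eta> * norm w"
      using norm_triangle_ineq[of "\<xi> *\<^sub>R v" "\<eta> *\<^sub>R w"] that by simp
    also have "\<dots> \<le> t * norm v + t * norm w"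
      using that by (intro add_mono mult_right_mono) auto
    finally show ?thesis by (simp add: distrib_left)
  qed
  have inb: "x + \<xi> *\<^sub>R v + \<eta> *\<^sub>R w \<in> ball x r"
    if "0 \<le> \<xi>" "\<xi> \<le> t" "0 \<le> \<eta>" "\<eta> \<le> t" for \<xi> \<eta>
    using nm[OF that] t by (simp add: dist_norm norm_minus_commute add_ac)
  define g where "g = (\<lambda>\<xi>. u (x + \<xi> *\<^sub>R v + t *\<^sub>R w) - u (x + \<xi> *\<^sub>R v))"
  have g: "(g has_real_derivative Dv (x + \<xi> *\<^sub>R v + t *\<^sub>R w) - Dv (x + \<xi> *\<^sub>R v)) (at \<xi>)"
    if "0 \<le> \<xi>" "\<xi> \<le> t" for \<xi>
  proof -
    have b1: "(x + t *\<^sub>R w) + \<xi> *\<^sub>R v \<in> ball x r" and b2: "x + \<xi> *\<^sub>R v \<in> ball x r"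
      using inb[of \<xi> t] inb[of \<xi> 0] that t by (auto simp: algebra_simps)
    show ?thesis
      using DERIV_diff[OF
          has_real_derivative_along_line[OF smooth_on_has_derivative[OF u b1]]
          has_real_derivative_along_line[OF smooth_on_has_derivative[OF u b2]]]
      unfolding g_def Dv_def by (simp add: algebra_simps)
  qed
  obtain \<xi> where \<xi>: "0 < \<xi>" "\<xi> < t"
    "g t - g 0 = (t - 0) * (Dv (x + \<xi> *\<^sub>R v + t *\<^sub>R w) - Dv (x + \<xi> *\<^sub>R v))"
    using MVT2[OF t(1) g] by blast
  have k: "((\<lambda>\<eta>. Dv (x + \<xi> *\<^sub>R v + \<eta> *\<^sub>R w)) has_real_derivative
      frechet_derivative Dv (at (x + \<xi> *\<^sub>R v + \<eta> *\<^sub>R w)) w) (at \<eta>)"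
    if "0 \<le> \<eta>" "\<eta> \<le> t" for \<eta>
    by (rule has_real_derivative_along_line[OF smooth_on_has_derivative[OF Dv]])
      (use that \<xi> inb in auto)
  obtain \<eta> where \<eta>: "0 < \<eta>" "\<eta> < t"
    "Dv (x + \<xi> *\<^sub>R v + t *\<^sub>R w) - Dv (x + \<xi> *\<^sub>R v + 0 *\<^sub>R w)
      = (t - 0) * frechet_derivative Dv (at (x + \<xi> *\<^sub>R v + \<eta> *\<^sub>R w)) w"
    using MVT2[OF t(1) k] by blast
  have "dist x (x + \<xi> *\<^sub>R v + \<eta> *\<^sub>R w) \<le> t * (norm v + norm w)"
    using nm[of \<xi> \<eta>] \<xi> \<eta> by (simp add: dist_norm norm_minus_commute add_ac)
  moreover have "u (x + t *\<^sub>R v + t *\<^sub>R w) - u (x + t *\<^sub>R v) - u (x + t *\<^sub>R w) + u x = g t - g 0"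
    by (simp add: g_def)
  ultimately show ?thesis
    using \<xi>(3) \<eta>(3) unfolding Dv_def[symmetric]
    by (intro exI[of _ "x + \<xi> *\<^sub>R v + \<eta> *\<^sub>R w"]) (simp add: power2_eq_square)
qed

text \<open>The second difference quotient is symmetric in \<open>v\<close> and \<open>w\<close>; by
  continuity of the second derivative it converges to \<open>E v w x\<close> and, with the roles
  exchanged, to \<open>E w v x\<close>.\<close>

lemma frechet_derivative_symmetric_real:
  fixes u :: "'v::euclidean_space \<Rightarrow> real"
  assumes "open S" "smooth_on S u" "x \<in> S"
  shows "frechet_derivative (\<lambda>y. frechet_derivative u (at y) v) (at x) w
       = frechet_derivative (\<lambda>y. frechet_derivative u (at y) w) (at x) v"
proof -
  define E where "E v w y = frechet_derivative (\<lambda>y. frechet_derivative u (at y) v) (at y) w" for v w y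
  have lim: "\<exists>d>0. \<forall>t. 0 < t \<and> t < d \<longrightarrow>
      \<bar>(u (x + t *\<^sub>R v + t *\<^sub>R w) - u (x + t *\<^sub>R v) - u (x + t *\<^sub>R w) + u x) / t\<^sup>2 - E v w x\<bar> < e"
    if "e > 0" for v w e
  proof -
    obtain r where r: "r > 0" "ball x r \<subseteq> S"
      using assms by (meson openE)
    have ur: "smooth_on (ball x r) u" using smooth_on_subset[OF assms(2) r(2)] .
    have "continuous_on (ball x r) (E v w)"
      unfolding E_def by (intro smooth_on_continuous smooth_on_frechet_derivative ur)
    then have "isCont (E v w) x"
      using continuous_on_interior[of "ball x r" "E v w" x] r(1) by simp
    then have "\<exists>d>0. \<forall>y. dist y x < d \<longrightarrow> \<bar>E v w y - E v w x\<bar> < e"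
      using that unfolding continuous_at_eps_delta dist_real_def by blast
    then obtain d where d: "d > 0" "\<forall>y. dist y x < d \<longrightarrow> \<bar>E v w y - E v w x\<bar> < e"
      by blast
    define N where "N = norm v + norm w + 1"
    have N: "N > 0" "norm v + norm w < N"
      by (auto simp: N_def add_nonneg_pos)
    show ?thesis
    proof (intro exI[of _ "min d r / N"] conjI allI impI)
      show "0 < min d r / N" using d(1) r(1) N(1) by simp
      fix t assume t: "0 < t \<and> t < min d r / N"
      then have tN: "t * N < min d r" using N by (simp add: pos_less_divide_eq)
      moreover have "t * (norm v + norm w) < t * N" using t N by simp
      ultimately have t': "t * (norm v + norm w) < r" "t * (norm v + norm w) < d" by auto
      obtain y where y: "dist x y \<le> t * (norm v + norm w)"
        and Q: "u (x + t *\<^sub>R v + t *\<^sub>R w) - u (x + t *\<^sub>R v) - u (x + t *\<^sub>R w) + u x = t\<^sup>2 * E v w y"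
        using second_difference_mean_value[OF ur conjunct1[OF t] t'(1), folded E_def] by blast
      have "dist y x < d" using y t'(2) by (simp add: dist_commute)
      then have bd: "\<bar>E v w y - E v w x\<bar> < e" using d(2) by blast
      show "\<bar>(u (x + t *\<^sub>R v + t *\<^sub>R w) - u (x + t *\<^sub>R v) - u (x + t *\<^sub>R w) + u x) / t\<^sup>2 - E v w x\<bar> < e"
        unfolding Q using bd t by simp
    qed
  qed
  have "\<bar>E v w x - E w v x\<bar> < e" if e: "e > 0" for e
  proof -
    have e2: "e/2 > 0" using e by simp
    obtain d1 where d1: "d1 > 0" "\<forall>t. 0 < t \<and> t < d1 \<longrightarrow>
        \<bar>(u (x + t *\<^sub>R v + t *\<^sub>R w) - u (x + t *\<^sub>R v) - u (x + t *\<^sub>R w) + u x) / t\<^sup>2 - E v w x\<bar> < e/2"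
      using lim[OF e2, of v w] by blast
    obtain d2 where d2: "d2 > 0" "\<forall>t. 0 < t \<and> t < d2 \<longrightarrow>
        \<bar>(u (x + t *\<^sub>R w + t *\<^sub>R v) - u (x + t *\<^sub>R w) - u (x + t *\<^sub>R v) + u x) / t\<^sup>2 - E w v x\<bar> < e/2"
      using lim[OF e2, of w v] by blast
    define t where "t = min d1 d2 / 2"
    have t: "0 < t" "t < d1" "t < d2" using d1(1) d2(1) by (auto simp: t_def)
    have eq: "u (x + t *\<^sub>R w + t *\<^sub>R v) - u (x + t *\<^sub>R w) - u (x + t *\<^sub>R v) + u x
      = u (x + t *\<^sub>R v + t *\<^sub>R w) - u (x + t *\<^sub>R v) - u (x + t *\<^sub>R w) + u x"
      by (simp add: algebra_simps)
    have tri: "\<bar>X - p\<bar> < e/2 \<Longrightarrow> \<bar>X - q\<bar> < e/2 \<Longrightarrow> \<bar>p - q\<bar> < e" for X p q by linarith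
    show ?thesis
      by (rule tri[OF d1(2)[rule_format, of t] d2(2)[rule_format, of t, unfolded eq]]) (simp_all add: t)
  qed
  then have "\<not> 0 < \<bar>E v w x - E w v x\<bar>" using less_irrefl by blast
  then have "E v w x = E w v x" by simp
  then show ?thesis by (simp add: E_def)
qed

lemma frechet_derivative_linear_image:
  assumes "bounded_linear L" "f differentiable (at x)"
  shows "frechet_derivative (\<lambda>y. L (f y)) (at x) v = L (frechet_derivative f (at x) v)"
  using frechet_derivative_at[OF bounded_linear.has_derivative[OF assms(1)
        assms(2)[unfolded frechet_derivative_works]]] by metis

lemma smooth_on_differentiable: "smooth_on S f \<Longrightarrow> x \<in> S \<Longrightarrow> f differentiable (at x)"
  using smooth_on_has_derivative by (auto simp: differentiable_def)

lemma frechet_derivative_cong_open: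
  assumes "open S" "x \<in> S" "\<And>y. y \<in> S \<Longrightarrow> u y = w y"
  shows "frechet_derivative u (at x) = frechet_derivative w (at x)"
proof -
  have "(u has_derivative D) (at x) \<longleftrightarrow> (w has_derivative D) (at x)" for D
    using has_derivative_transform_within_open[OF _ assms(1,2), of u D UNIV w]
      has_derivative_transform_within_open[OF _ assms(1,2), of w D UNIV u] assms(3) by auto
  then show ?thesis by (simp add: frechet_derivative_def)
qed

lemma frechet_derivative_symmetric:
  fixes u :: "'v::euclidean_space \<Rightarrow> 'w::euclidean_space"
  assumes "open S" "smooth_on S u" "x \<in> S"
  shows "frechet_derivative (\<lambda>y. frechet_derivative u (at y) v) (at x) w
       = frechet_derivative (\<lambda>y. frechet_derivative u (at y) w) (at x) v"
proof (rule euclidean_eqI)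
  fix b :: 'w
  let ?L = "\<lambda>z::'w. z \<bullet> b"
  note L = bounded_linear_inner_left[of b]
  have ub: "smooth_on S (\<lambda>y. ?L (u y))" by (rule smooth_on_linear[OF assms(1) L assms(2)])
  have 1: "frechet_derivative (\<lambda>y. frechet_derivative (\<lambda>y. ?L (u y)) (at y) v) (at x) w
      = ?L (frechet_derivative (\<lambda>y. frechet_derivative u (at y) v) (at x) w)" for v w
  proof -
    have d: "(\<lambda>y. frechet_derivative u (at y) v) differentiable (at x)"
      by (rule smooth_on_differentiable[OF smooth_on_frechet_derivative[OF assms(2)] assms(3)])
    have "frechet_derivative (\<lambda>y. frechet_derivative (\<lambda>y. ?L (u y)) (at y) v) (at x)
        = frechet_derivative (\<lambda>y. ?L (frechet_derivative u (at y) v)) (at x)"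
      by (rule frechet_derivative_cong_open[OF assms(1,3)])
        (simp add: frechet_derivative_linear_image[OF L smooth_on_differentiable[OF assms(2)]])
    then show ?thesis by (simp add: frechet_derivative_linear_image[OF L d])
  qed
  show "?L (frechet_derivative (\<lambda>y. frechet_derivative u (at y) v) (at x) w)
      = ?L (frechet_derivative (\<lambda>y. frechet_derivative u (at y) w) (at x) v)"
    using frechet_derivative_symmetric_real[OF assms(1) ub assms(3)] unfolding 1 .
qed

lemma smooth_on_cmult:
  fixes f :: "'v::euclidean_space \<Rightarrow> 'w::real_normed_algebra"
  shows "open S \<Longrightarrow> smooth_on S f \<Longrightarrow> smooth_on S (\<lambda>x. c * f x)"
  by (intro smooth_on_mult smooth_on_const)

section \<open>Wirtinger derivatives on the complex plane\<close>

lemma smooth_on_dz: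
  assumes "open S" "smooth_on S u"
  shows "smooth_on S (dz u)" "smooth_on S (dzbar u)"
proof -
  have "smooth_on S (\<lambda>x. (1/2) * (frechet_derivative u (at x) 1 + c * frechet_derivative u (at x) \<i>))" for c
    by (intro smooth_on_cmult smooth_on_add smooth_on_frechet_derivative assms)
  from this[of "-\<i>"] this[of \<i>] show "smooth_on S (dz u)" "smooth_on S (dzbar u)"
    by (auto simp: dz_def[abs_def] dzbar_def[abs_def])
qed

text \<open>The splitting of a real linear map into a complex linear and an antilinear part; for a
  differential the two coefficients are the values of \<open>dz\<close> and
  \<open>dzbar\<close>.\<close>

lemma real_linear_complex:
  assumes "linear (D :: complex \<Rightarrow> complex)"
  shows "D v = (D 1 - \<i> * D \<i>) / 2 * v + (D 1 + \<i> * D \<i>) / 2 * cnj v"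
proof -
  have v: "v = Re v *\<^sub>R 1 + Im v *\<^sub>R \<i>" by (simp add: complex_eq_iff)
  have c: "of_real (Re v) = (v + cnj v) / 2" "of_real (Im v) = - \<i> * (v - cnj v) / 2"
    by (simp_all add: complex_eq_iff)
  have "D v = Re v * D 1 + Im v * D \<i>"
    by (subst v, simp only: linear_add[OF assms] linear_scale[OF assms], simp only: scaleR_conv_of_real)
  also have "\<dots> = (D 1 - \<i> * D \<i>) / 2 * v + (D 1 + \<i> * D \<i>) / 2 * cnj v"
    unfolding c by (simp add: field_simps)
  finally show ?thesis .
qed

lemma has_derivative_dz:
  assumes "smooth_on S u" "x \<in> S"
  shows "(u has_derivative (\<lambda>v. dz u x * v + dzbar u x * cnj v)) (at x)"
proof -
  have "frechet_derivative u (at x) = (\<lambda>v. dz u x * v + dzbar u x * cnj v)"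
    unfolding dz_def dzbar_def
    using real_linear_complex[OF has_derivative_linear[OF smooth_on_has_derivative[OF assms]]] by blast
  then show ?thesis using smooth_on_has_derivative[OF assms] by simp
qed

lemma dz_eqI:
  assumes "(u has_derivative (\<lambda>v. p * v + q * cnj v)) (at x)"
  shows "dz u x = p" "dzbar u x = q"
  unfolding dz_def dzbar_def frechet_derivative_at[OF assms, symmetric] by (simp_all add: field_simps)

lemma dz_dzbar_commute:
  assumes "open S" "smooth_on S u" "x \<in> S"
  shows "dz (dzbar u) x = dzbar (dz u) x"
proof -
  let ?u = "\<lambda>v y. frechet_derivative u (at y) v"
  have d: "(?u v has_derivative frechet_derivative (?u v) (at x)) (at x)" for v
    by (rule smooth_on_has_derivative[OF smooth_on_frechet_derivative[OF assms(2)] assms(3)])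
  have D: "frechet_derivative (\<lambda>y. (?u 1 y + c * ?u \<i> y) / 2) (at x) v
      = (frechet_derivative (?u 1) (at x) v + c * frechet_derivative (?u \<i>) (at x) v) / 2" for c v
  proof -
    have "((\<lambda>y. (?u 1 y + c * ?u \<i> y) / 2) has_derivative
      (\<lambda>v. (frechet_derivative (?u 1) (at x) v + c * frechet_derivative (?u \<i>) (at x) v) / 2)) (at x)"
      using has_derivative_mult_right[OF has_derivative_add[OF d[of 1] has_derivative_mult_right[OF d[of \<i>], of c]], of "1/2"]
      by simp
    from frechet_derivative_at[OF this] show ?thesis by (rule fun_cong[OF sym])
  qed
  have s: "frechet_derivative (?u \<i>) (at x) 1 = frechet_derivative (?u 1) (at x) \<i>"
    by (rule frechet_derivative_symmetric[OF assms])
  have e: "dzbar u = (\<lambda>y. (?u 1 y + \<i> * ?u \<i> y) / 2)"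
    "dz u = (\<lambda>y. (?u 1 y + (-\<i>) * ?u \<i> y) / 2)"
    by (simp_all add: dz_def dzbar_def fun_eq_iff)
  show ?thesis
    unfolding dz_def[of "dzbar u"] dzbar_def[of "dz u"] unfolding e D s by (simp add: field_simps)
qed

lemma smooth_on_ln_compose:
  assumes "open S" "smooth_on S f" "\<And>x. x \<in> S \<Longrightarrow> f x > (0::real)"
  shows "smooth_on S (\<lambda>x. ln (f x))"
  by (rule smooth_on_compose[OF assms(1) _ _ smooth_on_ln assms(2)]) (use assms(3) in auto)

text \<open>\<open>curvature_density\<close> records only a real part. For a real function
  \<open>dzbar\<close> is the conjugate of \<open>dz\<close>, so commuting the mixed derivatives
  shows that dz dzbar ln \<eta> is real; the curvature hypothesis therefore determines it
  completely.\<close>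

lemma log_density_derivatives:
  fixes \<eta> :: "complex \<Rightarrow> real"
  assumes S: "open S" and \<eta>: "smooth_on S \<eta>" "\<And>x. x \<in> S \<Longrightarrow> \<eta> x > 0"
    and \<kappa>: "\<And>x. x \<in> S \<Longrightarrow> curvature_density \<eta> x = - \<kappa> x"
  defines "a \<equiv> dz (\<lambda>y. of_real (ln (\<eta> y)))"
  shows "smooth_on S a"
    and "\<And>x. x \<in> S \<Longrightarrow> ((\<lambda>y. ln (\<eta> y)) has_derivative (\<lambda>v. 2 * Re (a x * v))) (at x)"
    and "\<And>x. x \<in> S \<Longrightarrow> (a has_derivative (\<lambda>v. dz a x * v + of_real (\<kappa> x) * cnj v)) (at x)"
proof -
  define u :: "complex \<Rightarrow> complex" where "u = (\<lambda>y. of_real (ln (\<eta> y)))"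
  have u: "smooth_on S u"
    unfolding u_def by (rule smooth_on_linear[OF S bounded_linear_of_real smooth_on_ln_compose[OF S \<eta>]])
  show a: "smooth_on S a" unfolding a_def u_def[symmetric] by (rule smooth_on_dz[OF S u])
  fix x assume x: "x \<in> S"
  have bar: "dzbar u y = cnj (a y)" and re: "((\<lambda>y. ln (\<eta> y)) has_derivative (\<lambda>v. 2 * Re (a y * v))) (at y)"
    if y: "y \<in> S" for y
  proof -
    let ?D = "frechet_derivative (\<lambda>y. ln (\<eta> y)) (at y)"
    have l: "((\<lambda>y. ln (\<eta> y)) has_derivative ?D) (at y)"
      by (rule smooth_on_has_derivative[OF smooth_on_ln_compose[OF S \<eta>] y])
    have "(u has_derivative (\<lambda>v. of_real (?D v))) (at y)"
      unfolding u_def by (rule bounded_linear.has_derivative[OF bounded_linear_of_real l])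
    then have f: "frechet_derivative u (at y) = (\<lambda>v. of_real (?D v))"
      by (rule frechet_derivative_at[symmetric])
    show b: "dzbar u y = cnj (a y)"
      by (simp add: a_def u_def[symmetric] dzbar_def dz_def f)
    have "of_real (?D v) = dz u y * v + dzbar u y * cnj v" for v
      using fun_cong[OF f, of v] fun_cong[OF frechet_derivative_at[OF has_derivative_dz[OF u y]], of v]
      by simp
    then have "of_real (?D v) = a y * v + cnj (a y * v)" for v
      by (simp add: b a_def u_def[symmetric])
    then have "?D v = 2 * Re (a y * v)" for v
      by (metis complex_add_cnj of_real_eq_iff)
    then have "?D = (\<lambda>v. 2 * Re (a y * v))" by (rule ext)
    then show "((\<lambda>y. ln (\<eta> y)) has_derivative (\<lambda>v. 2 * Re (a y * v))) (at y)"
      using l by (simp only:)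
  qed
  show "((\<lambda>y. ln (\<eta> y)) has_derivative (\<lambda>v. 2 * Re (a x * v))) (at x)" using re x .
  have ua: "dz u = a" by (simp add: a_def u_def)
  have da: "(a has_derivative (\<lambda>v. dz a x * v + dzbar a x * cnj v)) (at x)"
    by (rule has_derivative_dz[OF a x])
  have "((\<lambda>y. cnj (a y)) has_derivative (\<lambda>v. cnj (dzbar a x) * v + cnj (dz a x) * cnj v)) (at x)"
    using bounded_linear.has_derivative[OF bounded_linear_cnj da] by (simp add: add.commute)
  then have "(dzbar u has_derivative (\<lambda>v. cnj (dzbar a x) * v + cnj (dz a x) * cnj v)) (at x)"
    by (rule has_derivative_transform_within_open[OF _ S x]) (simp add: bar)
  then have c: "dz (dzbar u) x = cnj (dzbar a x)" by (rule dz_eqI)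
  with dz_dzbar_commute[OF S u x] ua have real: "cnj (dzbar a x) = dzbar a x" by simp
  have "Re (dzbar a x) = \<kappa> x"
    using \<kappa>[OF x] c real unfolding curvature_density_def u_def[symmetric] by simp
  then have "dzbar a x = of_real (\<kappa> x)"
    using real by (simp add: complex_eq_iff)
  then show "(a has_derivative (\<lambda>v. dz a x * v + of_real (\<kappa> x) * cnj v)) (at x)"
    using da by simp
qed

text \<open>Couples differentiability with the four Wirtinger derivatives, read as coefficients of
  the differential. Product, quotient and conjugation rules can then be chained, and
  \<open>has_wirt_imp\<close> extracts the values at the end.\<close>

definition has_wirt ::
    "(complex^2 \<Rightarrow> complex) \<Rightarrow> complex \<Rightarrow> complex \<Rightarrow> complex \<Rightarrow> complex \<Rightarrow> complex^2 \<Rightarrow> bool" where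
  "has_wirt u p1 p2 q1 q2 x \<longleftrightarrow>
     (u has_derivative (\<lambda>v. p1 * v $ 1 + p2 * v $ 2 + q1 * cnj (v $ 1) + q2 * cnj (v $ 2))) (at x)"

lemma has_wirt_imp:
  assumes "has_wirt u p1 p2 q1 q2 x"
  shows "wirt 1 u x = p1" "wirt 2 u x = p2" "wirtbar 1 u x = q1" "wirtbar 2 u x = q2"
  unfolding wirt_def wirtbar_def
    frechet_derivative_at[OF assms[unfolded has_wirt_def], symmetric]
  by (simp_all add: axis_def algebra_simps)

lemma has_wirt_eq:
  "has_wirt u p1 p2 q1 q2 x \<Longrightarrow> p1 = p1' \<Longrightarrow> p2 = p2' \<Longrightarrow> q1 = q1' \<Longrightarrow> q2 = q2'
     \<Longrightarrow> has_wirt u p1' p2' q1' q2' x"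
  by simp

lemma has_wirt_transform:
  "has_wirt u p1 p2 q1 q2 x \<Longrightarrow> open U \<Longrightarrow> x \<in> U \<Longrightarrow> (\<And>y. y \<in> U \<Longrightarrow> u y = w y)
     \<Longrightarrow> has_wirt w p1 p2 q1 q2 x"
  unfolding has_wirt_def using has_derivative_transform_within_open by blast

lemma has_wirt_const: "has_wirt (\<lambda>y. c) 0 0 0 0 x"
  by (simp add: has_wirt_def)

lemma has_wirt_snd: "has_wirt (\<lambda>y. y $ 2) 0 1 0 0 x"
  by (auto simp: has_wirt_def intro!: bounded_linear_imp_has_derivative bounded_linear_vec_nth)

lemma has_wirt_fst:
  assumes "(g has_derivative (\<lambda>v. p * v + q * cnj v)) (at (x $ 1))"
  shows "has_wirt (\<lambda>y. g (y $ 1)) p 0 q 0 x"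
  unfolding has_wirt_def
  using has_derivative_compose[OF bounded_linear_imp_has_derivative[OF bounded_linear_vec_nth] assms]
  by simp

lemma has_wirt_add:
  assumes "has_wirt u p1 p2 q1 q2 x" "has_wirt w r1 r2 s1 s2 x"
  shows "has_wirt (\<lambda>y. u y + w y) (p1 + r1) (p2 + r2) (q1 + s1) (q2 + s2) x"
  using has_derivative_add[OF assms[unfolded has_wirt_def]]
  by (simp add: has_wirt_def algebra_simps)

lemma has_wirt_diff:
  assumes "has_wirt u p1 p2 q1 q2 x" "has_wirt w r1 r2 s1 s2 x"
  shows "has_wirt (\<lambda>y. u y - w y) (p1 - r1) (p2 - r2) (q1 - s1) (q2 - s2) x"
  using has_derivative_diff[OF assms[unfolded has_wirt_def]]
  by (simp add: has_wirt_def algebra_simps)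

lemma has_wirt_mult:
  assumes "has_wirt u p1 p2 q1 q2 x" "has_wirt w r1 r2 s1 s2 x"
  shows "has_wirt (\<lambda>y. u y * w y) (u x * r1 + p1 * w x) (u x * r2 + p2 * w x)
    (u x * s1 + q1 * w x) (u x * s2 + q2 * w x) x"
  using has_derivative_mult[OF assms[unfolded has_wirt_def]]
  by (simp add: has_wirt_def algebra_simps)

lemma has_wirt_inverse:
  assumes "has_wirt u p1 p2 q1 q2 x" "u x \<noteq> 0"
  shows "has_wirt (\<lambda>y. inverse (u y)) (- p1 / (u x)\<^sup>2) (- p2 / (u x)\<^sup>2) (- q1 / (u x)\<^sup>2) (- q2 / (u x)\<^sup>2) x"
  unfolding has_wirt_def
  by (rule has_derivative_eq_rhs[OF Deriv.has_derivative_inverse[OF assms(2) assms(1)[unfolded has_wirt_def]]])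
    (use assms(2) in \<open>simp add: field_simps power2_eq_square fun_eq_iff\<close>)

lemma has_wirt_divide:
  assumes "has_wirt u p1 p2 q1 q2 x" "has_wirt w r1 r2 s1 s2 x" "w x \<noteq> 0"
  shows "has_wirt (\<lambda>y. u y / w y) ((p1 * w x - u x * r1) / (w x)\<^sup>2) ((p2 * w x - u x * r2) / (w x)\<^sup>2)
    ((q1 * w x - u x * s1) / (w x)\<^sup>2) ((q2 * w x - u x * s2) / (w x)\<^sup>2) x"
  unfolding divide_inverse[of "u _"]
  by (rule has_wirt_eq[OF has_wirt_mult[OF assms(1) has_wirt_inverse[OF assms(2,3)]]])
    (use assms(3) in \<open>simp_all add: field_simps power2_eq_square\<close>)

lemma has_wirt_cnj:
  assumes "has_wirt u p1 p2 q1 q2 x"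
  shows "has_wirt (\<lambda>y. cnj (u y)) (cnj q1) (cnj q2) (cnj p1) (cnj p2) x"
  using bounded_linear.has_derivative[OF bounded_linear_cnj assms[unfolded has_wirt_def]]
  by (simp add: has_wirt_def algebra_simps)

text \<open>A differential of the form 2 Re(c dz + d dw) says that \<partial>s has coordinates
  \<open>c\<close> and \<open>d\<close> and that its conjugate gives the antiholomorphic
  part.\<close>

lemma has_wirt_of_real:
  assumes "(s has_derivative (\<lambda>v. 2 * Re (c * v $ 1 + d * v $ 2))) (at x)"
    "(k has_real_derivative k') (at (s x))"
  shows "has_wirt (\<lambda>y. of_real (k (s y))) (of_real k' * c) (of_real k' * d)
    (of_real k' * cnj c) (of_real k' * cnj d) x"
proof -
  have "((\<lambda>y. complex_of_real (k (s y))) has_derivative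
      (\<lambda>v. of_real (k' * (2 * Re (c * v $ 1 + d * v $ 2))))) (at x)"
    using bounded_linear.has_derivative[OF bounded_linear_of_real
        has_derivative_compose[OF assms(1) assms(2)[unfolded has_field_derivative_def]]] .
  moreover have e: "complex_of_real (k' * (2 * Re (c * v $ 1 + d * v $ 2)))
    = k' * c * v $ 1 + k' * d * v $ 2 + k' * cnj c * cnj (v $ 1) + k' * cnj d * cnj (v $ 2)" for v
  proof -
    have "complex_of_real (2 * Re z) = z + cnj z" for z by (simp add: complex_add_cnj)
    then show ?thesis by (simp only: of_real_mult[of k']) (simp add: algebra_simps)
  qed
  ultimately show ?thesis by (simp only: has_wirt_def e)
qed

text \<open>Turns a product with an inverse into a check by multiplication: the connection matrix is
  guessed in \<open>conn\<close> and verified without inverting the metric.\<close>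

lemma matrix_inv_mult_eqI:
  fixes H :: "'a::field^'n^'n"
  assumes "invertible H" "H ** M = N"
  shows "matrix_inv H ** N = M"
proof -
  have "matrix_inv H ** H = mat 1"
    unfolding matrix_inv_def using assms(1) by (metis (mono_tags, lifting) invertible_def someI_ex)
  moreover have "matrix_inv H ** (H ** M) = (matrix_inv H ** H) ** M" by (simp add: matrix_mul_assoc)
  ultimately show ?thesis using assms(2) by simp
qed

section \<open>Permutation sums in dimension two\<close>

lemma sum_permutes_2:
  fixes F :: "(2 \<Rightarrow> 2) \<Rightarrow> 'a::comm_monoid_add"
  shows "(\<Sum>\<sigma> | \<sigma> permutes UNIV. F \<sigma>) = F id + F (Transposition.transpose 1 2)"
proof -
  have ne: "(1::2) \<noteq> 2" by simp
  have "{\<sigma>::2\<Rightarrow>2. \<sigma> permutes {1,2}} = {id, Transposition.transpose 1 2}"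
    by (auto simp: permutes_doubleton_iff)
  then have "{\<sigma>::2\<Rightarrow>2. \<sigma> permutes UNIV} = {id, Transposition.transpose 1 2}"
    by (simp only: UNIV_2)
  moreover have "(id::2\<Rightarrow>2) \<noteq> Transposition.transpose 1 2"
    using ne by (metis id_apply transpose_apply_first)
  ultimately show ?thesis by simp
qed

lemma wedge_coeff_2:
  "wedge_coeff a = a 1 $ 1 $ 1 * a 2 $ 2 $ 2 - a 1 $ 1 $ 2 * a 2 $ 2 $ 1
    - a 1 $ 2 $ 1 * a 2 $ 1 $ 2 + a 1 $ 2 $ 2 * a (2::2) $ 1 $ 1"
  unfolding wedge_coeff_def sum_permutes_2 by (simp add: UNIV_2 sign_swap_id sign_id algebra_simps)

lemma top_chern_coeff_2:
  "top_chern_coeff H x = wedge_coeff (\<lambda>i. curvature_entry H i i x)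
    - wedge_coeff (\<lambda>i. curvature_entry H i (if i = 1 then 2 else 1) (x::complex^2))"
  by (simp add: top_chern_coeff_def sum_permutes_2 sign_swap_id sign_id wedge_coeff_2)


section \<open>Curvature of metrics with Calabi symmetry\<close>

text \<open>One chart of the ruled surface. The sign \<epsilon> is 1 for the fibre coordinate w and
  -1 for 1 / w, so that one computation serves neighbourhoods of both divisors.\<close>

locale calabi_chart =
  fixes S :: "complex set" and h \<rho> :: "complex \<Rightarrow> real" and \<epsilon> :: real and f :: "real \<Rightarrow> real"
  assumes open_S: "open S"
    and smooth_h: "smooth_on S h" and h_pos: "\<And>z. z \<in> S \<Longrightarrow> h z > 0"
    and smooth_\<rho>: "smooth_on S \<rho>" and \<rho>_pos: "\<And>z. z \<in> S \<Longrightarrow> \<rho> z > 0"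
    and curv_h: "\<And>z. z \<in> S \<Longrightarrow> curvature_density h z = - \<rho> z"
    and curv_\<rho>: "\<And>z. z \<in> S \<Longrightarrow> curvature_density \<rho> z = - 2 * \<rho> z"
    and \<epsilon>: "\<epsilon> * \<epsilon> = 1"
    and smooth_f: "smooth_on UNIV f"
begin

definition "U = {x::complex^2. x $ 1 \<in> S \<and> x $ 2 \<noteq> 0}"
definition "\<sigma> x = \<epsilon> * ln ((cmod (x $ 2))\<^sup>2) + ln (h (x $ 1))" for x :: "complex^2"
text \<open>\<open>a\<close> and \<open>b\<close> are the coefficients of the Chern connections of
  \<open>h\<close> and \<rho>. The curvature assumptions say that their antiholomorphic derivatives
  are \<rho> and 2 \<rho>.\<close>

definition "a = dz (\<lambda>y. of_real (ln (h y)))"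
definition "b = dz (\<lambda>y. of_real (ln (\<rho> y)))"

abbreviation "f1 \<equiv> deriv f"
abbreviation "f2 \<equiv> deriv (deriv f)"
abbreviation "f3 \<equiv> deriv (deriv (deriv f))"
abbreviation "f4 \<equiv> deriv (deriv (deriv (deriv f)))"

text \<open>The coordinates of \<open>\<partial>s\<close>.\<close>

definition "th1 x = a (x $ 1)" for x :: "complex^2"
definition "th2 x = of_real \<epsilon> / x $ 2" for x :: "complex^2"

definition "gmat x = (\<chi> k l. (if k = 1 \<and> l = 1 then of_real (\<rho> (x $ 1)) else 0)
     + wirt l (wirtbar k (\<lambda>y. of_real (f (\<sigma> y)))) x)" for x :: "complex^2"

section \<open>The metric and its first derivatives in one chart\<close>

lemma open_U: "open U"
proof -
  have "U = (\<lambda>x. x $ 1) -` S \<inter> (\<lambda>x. x $ 2) -` (- {0})"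
    by (auto simp: U_def)
  then show ?thesis
    using open_S by (auto intro!: open_Int open_vimage continuous_intros)
qed

lemma derivs_f:
  "(f has_real_derivative f1 t) (at t)" "(f1 has_real_derivative f2 t) (at t)"
  "(f2 has_real_derivative f3 t) (at t)" "(f3 has_real_derivative f4 t) (at t)"
  using smooth_f smooth_on_deriv[of UNIV] smooth_on_DERIV[of UNIV] by blast+

lemma smooth_a: "smooth_on S a"
  and deriv_ln_h: "z \<in> S \<Longrightarrow> ((\<lambda>y. ln (h y)) has_derivative (\<lambda>v. 2 * Re (a z * v))) (at z)"
  and deriv_a: "z \<in> S \<Longrightarrow> (a has_derivative (\<lambda>v. dz a z * v + of_real (\<rho> z) * cnj v)) (at z)"
  using log_density_derivatives[OF open_S smooth_h h_pos curv_h] by (auto simp: a_def)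

lemma deriv_ln_\<rho>: "z \<in> S \<Longrightarrow> ((\<lambda>y. ln (\<rho> y)) has_derivative (\<lambda>v. 2 * Re (b z * v))) (at z)"
  and deriv_b: "z \<in> S \<Longrightarrow> (b has_derivative (\<lambda>v. dz b z * v + of_real (2 * \<rho> z) * cnj v)) (at z)"
  using log_density_derivatives[OF open_S smooth_\<rho> \<rho>_pos, of "\<lambda>z. 2 * \<rho> z"] curv_\<rho>
  by (auto simp: b_def)

lemma deriv_\<rho>:
  assumes z: "z \<in> S"
  shows "((\<lambda>y. complex_of_real (\<rho> y)) has_derivative
    (\<lambda>v. of_real (\<rho> z) * b z * v + of_real (\<rho> z) * cnj (b z) * cnj v)) (at z)"
proof -
  have "((\<lambda>y. exp (ln (\<rho> y))) has_derivative (\<lambda>v. \<rho> z * (2 * Re (b z * v)))) (at z)"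
    using has_derivative_exp[OF deriv_ln_\<rho>[OF z]] \<rho>_pos[OF z] by (simp add: mult_ac)
  then have "(\<rho> has_derivative (\<lambda>v. \<rho> z * (2 * Re (b z * v)))) (at z)"
    by (rule has_derivative_transform_within_open[OF _ open_S z]) (simp add: \<rho>_pos)
  from bounded_linear.has_derivative[OF bounded_linear_of_real this]
  show ?thesis
    by (rule has_derivative_eq_rhs) (auto simp: fun_eq_iff complex_eq_iff algebra_simps)
qed

text \<open>A third derivative of ln h, obtained by commuting: the \<open>dzbar\<close> of
  \<open>dz a\<close> is the \<open>dz\<close> of \<open>dzbar a\<close>, which is \<rho>, and the
  logarithmic derivative of \<rho> is \<open>b\<close>. The curvature needs it because
  \<open>dz a\<close> occurs in \<open>conn\<close>.\<close>

lemma deriv_dz_a: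
  assumes z: "z \<in> S"
  shows "(dz a has_derivative (\<lambda>v. dz (dz a) z * v + of_real (\<rho> z) * b z * cnj v)) (at z)"
proof -
  have "((\<lambda>y. of_real (\<rho> y)) has_derivative
    (\<lambda>v. of_real (\<rho> z) * b z * v + of_real (\<rho> z) * cnj (b z) * cnj v)) (at z)"
    by (rule deriv_\<rho>[OF z])
  then have "(dzbar a has_derivative
    (\<lambda>v. of_real (\<rho> z) * b z * v + of_real (\<rho> z) * cnj (b z) * cnj v)) (at z)"
    by (rule has_derivative_transform_within_open[OF _ open_S z]) (simp add: dz_eqI(2)[OF deriv_a])
  then have "dzbar (dz a) z = of_real (\<rho> z) * b z"
    using dz_eqI(1) dz_dzbar_commute[OF open_S smooth_a z] by metis
  then show ?thesis
    using has_derivative_dz[OF smooth_on_dz(1)[OF open_S smooth_a] z] by simp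
qed

lemma deriv_\<sigma>:
  assumes x: "x \<in> U"
  shows "(\<sigma> has_derivative (\<lambda>v. 2 * Re (th1 x * v $ 1 + th2 x * v $ 2))) (at x)"
proof -
  have x1: "x $ 1 \<in> S" and x2: "x $ 2 \<noteq> 0" using x by (auto simp: U_def)
  have 1: "((\<lambda>y::complex^2. ln (h (y $ 1))) has_derivative (\<lambda>v. 2 * Re (a (x $ 1) * v $ 1))) (at x)"
    by (rule has_derivative_compose[OF bounded_linear_imp_has_derivative[OF bounded_linear_vec_nth]
          deriv_ln_h[OF x1]])
  have q: "((\<lambda>y::complex^2. (cmod (y $ 2))\<^sup>2) has_derivative (\<lambda>v. 2 * Re (cnj (x $ 2) * v $ 2))) (at x)"
    unfolding cmod_power2
    by (auto intro!: derivative_eq_intros bounded_linear_imp_has_derivative bounded_linear_vec_nth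
        simp: fun_eq_iff algebra_simps)
  have "((\<lambda>y::complex^2. ln ((cmod (y $ 2))\<^sup>2)) has_derivative
      (\<lambda>v. 2 * Re (cnj (x $ 2) * v $ 2) * inverse ((cmod (x $ 2))\<^sup>2))) (at x)"
    by (rule has_derivative_ln[OF _ q]) (use x2 in simp)
  moreover have "2 * Re (cnj (x $ 2) * w) * inverse ((cmod (x $ 2))\<^sup>2) = 2 * Re (w / x $ 2)" for w
    unfolding Re_divide cmod_power2 by (simp add: divide_inverse algebra_simps)
  ultimately have 2: "((\<lambda>y::complex^2. ln ((cmod (y $ 2))\<^sup>2)) has_derivative
      (\<lambda>v. 2 * Re (v $ 2 / x $ 2))) (at x)" by simp
  have "Re (th2 x * w) = \<epsilon> * Re (w / x $ 2)" for w
  proof -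
    have "th2 x * w = of_real \<epsilon> * (w / x $ 2)" by (simp add: th2_def)
    moreover have "Re (of_real \<epsilon> * z) = \<epsilon> * Re z" for z by simp
    ultimately show ?thesis by metis
  qed
  then have "\<epsilon> * (2 * Re (v $ 2 / x $ 2)) + 2 * Re (a (x $ 1) * v $ 1)
      = 2 * Re (th1 x * v $ 1 + th2 x * v $ 2)" for v :: "complex^2"
    unfolding plus_complex.sel th1_def by simp
  then show ?thesis
    using has_derivative_add[OF has_derivative_mult_right[OF 2, of \<epsilon>] 1]
    unfolding \<sigma>_def[abs_def] by simp
qed

lemma has_wirt_\<sigma>:
  assumes "x \<in> U" "(k has_real_derivative k') (at (\<sigma> x))"
  shows "has_wirt (\<lambda>y. of_real (k (\<sigma> y))) (of_real k' * th1 x) (of_real k' * th2 x)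
    (of_real k' * cnj (th1 x)) (of_real k' * cnj (th2 x)) x"
  by (rule has_wirt_of_real[OF deriv_\<sigma>[OF assms(1)] assms(2)])

lemma has_wirt_th1:
  assumes "x \<in> U"
  shows "has_wirt th1 (dz a (x $ 1)) 0 (of_real (\<rho> (x $ 1))) 0 x"
  unfolding th1_def[abs_def] using assms deriv_a by (intro has_wirt_fst) (auto simp: U_def)

lemma has_wirt_th2:
  assumes "x \<in> U"
  shows "has_wirt th2 0 (- th2 x / x $ 2) 0 0 x"
  unfolding th2_def[abs_def]
  by (rule has_wirt_eq, rule has_wirt_divide[OF has_wirt_const has_wirt_snd])
    (use assms in \<open>auto simp: U_def field_simps power2_eq_square\<close>)

lemma has_wirt_\<rho>:
  assumes "x \<in> U"
  shows "has_wirt (\<lambda>y. of_real (\<rho> (y $ 1))) (of_real (\<rho> (x $ 1)) * b (x $ 1)) 0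
    (of_real (\<rho> (x $ 1)) * cnj (b (x $ 1))) 0 x"
  using assms deriv_\<rho> by (intro has_wirt_fst) (auto simp: U_def)

lemma wirtbar_potential:
  assumes "x \<in> U"
  shows "wirtbar 1 (\<lambda>y. of_real (f (\<sigma> y))) x = of_real (f1 (\<sigma> x)) * cnj (th1 x)"
    "wirtbar 2 (\<lambda>y. of_real (f (\<sigma> y))) x = of_real (f1 (\<sigma> x)) * cnj (th2 x)"
  using has_wirt_imp[OF has_wirt_\<sigma>[OF assms derivs_f(1)]] by auto

text \<open>The Hessian of f(s) consists of f''(s) times the square of \<partial>s and f'(s) times
  the Hessian of s. The latter is the pull-back of the base form, because \<open>th1\<close> has
  antiholomorphic derivative \<rho> while \<open>th2\<close> is holomorphic; this is where the
  factor 1 + f' comes from.\<close>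

lemma gmat_entries:
  assumes x: "x \<in> U"
  shows "gmat x $ 1 $ 1 = of_real (1 + f1 (\<sigma> x)) * of_real (\<rho> (x $ 1))
            + of_real (f2 (\<sigma> x)) * th1 x * cnj (th1 x)"
    and "gmat x $ 1 $ 2 = of_real (f2 (\<sigma> x)) * cnj (th1 x) * th2 x"
    and "gmat x $ 2 $ 1 = of_real (f2 (\<sigma> x)) * th1 x * cnj (th2 x)"
    and "gmat x $ 2 $ 2 = of_real (f2 (\<sigma> x)) * th2 x * cnj (th2 x)"
proof -
  note 1 = has_wirt_imp(1,2)[OF has_wirt_transform[OF has_wirt_mult[OF has_wirt_\<sigma>[OF x derivs_f(2)]
    has_wirt_cnj[OF has_wirt_th1[OF x]]] open_U x wirtbar_potential(1)[symmetric]]]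
  note 2 = has_wirt_imp(1,2)[OF has_wirt_transform[OF has_wirt_mult[OF has_wirt_\<sigma>[OF x derivs_f(2)]
    has_wirt_cnj[OF has_wirt_th2[OF x]]] open_U x wirtbar_potential(2)[symmetric]]]
  show "gmat x $ 1 $ 1 = of_real (1 + f1 (\<sigma> x)) * of_real (\<rho> (x $ 1))
            + of_real (f2 (\<sigma> x)) * th1 x * cnj (th1 x)"
   "gmat x $ 1 $ 2 = of_real (f2 (\<sigma> x)) * cnj (th1 x) * th2 x"
   "gmat x $ 2 $ 1 = of_real (f2 (\<sigma> x)) * th1 x * cnj (th2 x)"
   "gmat x $ 2 $ 2 = of_real (f2 (\<sigma> x)) * th2 x * cnj (th2 x)"
    by (simp_all add: gmat_def 1 2 algebra_simps)
qed

text \<open>The completed square: dz and \<partial>s are orthogonal for the metric. Positivity, the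
  cone estimates and the comparison of charts all start from this formula.\<close>

lemma hform_gmat:
  assumes x: "x \<in> U"
  shows "hform (gmat x) v = (1 + f1 (\<sigma> x)) * \<rho> (x $ 1) * (cmod (v $ 1))\<^sup>2
    + f2 (\<sigma> x) * (cmod (th1 x * v $ 1 + th2 x * v $ 2))\<^sup>2"
proof -
  let ?w = "th1 x * v $ 1 + th2 x * v $ 2"
  have "(\<Sum>k\<in>UNIV. \<Sum>l\<in>UNIV. cnj (v $ k) * gmat x $ k $ l * v $ l)
    = of_real ((1 + f1 (\<sigma> x)) * \<rho> (x $ 1)) * (v $ 1 * cnj (v $ 1)) + of_real (f2 (\<sigma> x)) * (?w * cnj ?w)"
    by (simp add: UNIV_2 gmat_entries[OF x] algebra_simps)
  also have "\<dots> = of_real ((1 + f1 (\<sigma> x)) * \<rho> (x $ 1) * (cmod (v $ 1))\<^sup>2 + f2 (\<sigma> x) * (cmod ?w)\<^sup>2)"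
    by (simp only: complex_norm_square[symmetric] of_real_mult of_real_add of_real_power)
  finally show ?thesis by (simp only: hform_def Re_complex_of_real)
qed

end

section \<open>Smoothness and the Kaehler property\<close>

lemma smooth_on_wirt:
  fixes u :: "complex^'n::finite \<Rightarrow> complex"
  assumes "open S" "smooth_on S u"
  shows "smooth_on S (wirt l u)" "smooth_on S (wirtbar l u)"
proof -
  have "smooth_on S (\<lambda>x. (1/2) * (frechet_derivative u (at x) (axis l 1)
                              + c * frechet_derivative u (at x) (axis l \<i>)))" for c
    by (intro smooth_on_cmult smooth_on_add smooth_on_frechet_derivative assms)
  from this[of "-\<i>"] this[of \<i>] show "smooth_on S (wirt l u)" "smooth_on S (wirtbar l u)"
    by (auto simp: wirt_def[abs_def] wirtbar_def[abs_def])
qed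

lemma wirtbar_cong_open:
  "open U \<Longrightarrow> x \<in> U \<Longrightarrow> (\<And>y. y \<in> U \<Longrightarrow> u y = w y) \<Longrightarrow> wirtbar k u x = wirtbar k w x"
  using frechet_derivative_cong_open[of U x u w] by (simp add: wirtbar_def)

context calabi_chart
begin

lemma smooth_on_fst:
  assumes "smooth_on S (g :: complex \<Rightarrow> 'w::real_normed_vector)"
  shows "smooth_on U (\<lambda>x. g (x $ 1))"
  by (rule smooth_on_compose[OF open_U open_S _ assms
        smooth_on_bounded_linear[OF open_U bounded_linear_vec_nth]]) (auto simp: U_def)

lemma smooth_\<sigma>: "smooth_on U \<sigma>"
proof -
  have lin: "smooth_on U (\<lambda>x::complex^2. Re (x $ 2))" "smooth_on U (\<lambda>x::complex^2. Im (x $ 2))"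
    by (intro smooth_on_bounded_linear[OF open_U] bounded_linear_compose[OF _ bounded_linear_vec_nth]
        bounded_linear_Re bounded_linear_Im)+
  have "smooth_on U (\<lambda>x::complex^2. (cmod (x $ 2))\<^sup>2)"
    unfolding cmod_power2 unfolding power2_eq_square by (intro smooth_on_add smooth_on_mult open_U lin)
  then have "smooth_on U (\<lambda>x::complex^2. ln ((cmod (x $ 2))\<^sup>2))"
    by (rule smooth_on_ln_compose[OF open_U]) (simp add: U_def)
  moreover have "smooth_on U (\<lambda>x. ln (h (x $ 1)))"
    by (rule smooth_on_fst[OF smooth_on_ln_compose[OF open_S smooth_h h_pos]])
  ultimately show ?thesis
    unfolding \<sigma>_def[abs_def] by (intro smooth_on_add smooth_on_cmult open_U)
qed

lemma smooth_gmat: "smooth_on U (\<lambda>x. gmat x $ k $ l)"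
proof -
  have "smooth_on U (\<lambda>x. f (\<sigma> x))"
    by (rule smooth_on_compose[OF open_U _ _ smooth_f smooth_\<sigma>]) auto
  then have 1: "smooth_on U (\<lambda>x. wirt l (wirtbar k (\<lambda>y. of_real (f (\<sigma> y)))) x)"
    by (intro smooth_on_wirt[OF open_U] smooth_on_linear[OF open_U bounded_linear_of_real])
  have "smooth_on U (\<lambda>x. of_real (\<rho> (x $ 1)) :: complex)"
    by (intro smooth_on_linear[OF open_U bounded_linear_of_real] smooth_on_fst smooth_\<rho>)
  then have "smooth_on U (\<lambda>x. if k = 1 \<and> l = 1 then of_real (\<rho> (x $ 1)) else (0::complex))"
    by (cases "k = 1 \<and> l = 1") (simp_all only: if_True if_False smooth_on_const simp_thms)
  from smooth_on_add[OF open_U this 1] show ?thesis by (simp add: gmat_def)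
qed

text \<open>This table serves twice: its symmetry gives closedness in \<open>kahler_on_gmat\<close>,
  and it is the target of the multiplication in \<open>conn_eq\<close>.\<close>

lemma wirt_gmat:
  assumes x: "x \<in> U"
  defines "g \<equiv> complex_of_real (1 + f1 (\<sigma> x))" and "p \<equiv> complex_of_real (f2 (\<sigma> x))"
    and "p' \<equiv> complex_of_real (f3 (\<sigma> x))" and "r \<equiv> complex_of_real (\<rho> (x $ 1))"
  shows "wirt 1 (\<lambda>y. gmat y $ 1 $ 1) x = p * th1 x * r + g * r * b (x $ 1)
           + p' * th1 x * th1 x * cnj (th1 x) + p * dz a (x $ 1) * cnj (th1 x) + p * th1 x * r"
    and "wirt 2 (\<lambda>y. gmat y $ 1 $ 1) x = p * th2 x * r + p' * th2 x * th1 x * cnj (th1 x)"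
    and "wirt 1 (\<lambda>y. gmat y $ 1 $ 2) x = p' * th1 x * cnj (th1 x) * th2 x + p * r * th2 x"
    and "wirt 2 (\<lambda>y. gmat y $ 1 $ 2) x = p' * th2 x * cnj (th1 x) * th2 x
           - p * cnj (th1 x) * th2 x / x $ 2"
    and "wirt 1 (\<lambda>y. gmat y $ 2 $ 1) x = p' * th1 x * th1 x * cnj (th2 x) + p * dz a (x $ 1) * cnj (th2 x)"
    and "wirt 2 (\<lambda>y. gmat y $ 2 $ 1) x = p' * th2 x * th1 x * cnj (th2 x)"
    and "wirt 1 (\<lambda>y. gmat y $ 2 $ 2) x = p' * th1 x * th2 x * cnj (th2 x)"
    and "wirt 2 (\<lambda>y. gmat y $ 2 $ 2) x = p' * th2 x * th2 x * cnj (th2 x)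
           - p * th2 x * cnj (th2 x) / x $ 2"
proof -
  have dg: "((\<lambda>t. 1 + f1 t) has_real_derivative f2 (\<sigma> x)) (at (\<sigma> x))"
    using derivs_f(2) by (auto intro!: derivative_eq_intros)
  note G = has_wirt_\<sigma>[OF x dg] and P = has_wirt_\<sigma>[OF x derivs_f(3)] and R = has_wirt_\<rho>[OF x]
    and T1 = has_wirt_th1[OF x] and T2 = has_wirt_th2[OF x]
  note C1 = has_wirt_cnj[OF T1] and C2 = has_wirt_cnj[OF T2]
  note e11 = has_wirt_imp(1,2)[OF has_wirt_transform[OF has_wirt_add[OF has_wirt_mult[OF G R]
        has_wirt_mult[OF has_wirt_mult[OF P T1] C1]] open_U x gmat_entries(1)[symmetric]]]
  note e12 = has_wirt_imp(1,2)[OF has_wirt_transform[OF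
        has_wirt_mult[OF has_wirt_mult[OF P C1] T2] open_U x gmat_entries(2)[symmetric]]]
  note e21 = has_wirt_imp(1,2)[OF has_wirt_transform[OF
        has_wirt_mult[OF has_wirt_mult[OF P T1] C2] open_U x gmat_entries(3)[symmetric]]]
  note e22 = has_wirt_imp(1,2)[OF has_wirt_transform[OF
        has_wirt_mult[OF has_wirt_mult[OF P T2] C2] open_U x gmat_entries(4)[symmetric]]]
  show "wirt 1 (\<lambda>y. gmat y $ 1 $ 1) x = p * th1 x * r + g * r * b (x $ 1)
           + p' * th1 x * th1 x * cnj (th1 x) + p * dz a (x $ 1) * cnj (th1 x) + p * th1 x * r"
    "wirt 2 (\<lambda>y. gmat y $ 1 $ 1) x = p * th2 x * r + p' * th2 x * th1 x * cnj (th1 x)"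
    "wirt 1 (\<lambda>y. gmat y $ 1 $ 2) x = p' * th1 x * cnj (th1 x) * th2 x + p * r * th2 x"
    "wirt 2 (\<lambda>y. gmat y $ 1 $ 2) x = p' * th2 x * cnj (th1 x) * th2 x
           - p * cnj (th1 x) * th2 x / x $ 2"
    "wirt 1 (\<lambda>y. gmat y $ 2 $ 1) x = p' * th1 x * th1 x * cnj (th2 x) + p * dz a (x $ 1) * cnj (th2 x)"
    "wirt 2 (\<lambda>y. gmat y $ 2 $ 1) x = p' * th2 x * th1 x * cnj (th2 x)"
    "wirt 1 (\<lambda>y. gmat y $ 2 $ 2) x = p' * th1 x * th2 x * cnj (th2 x)"
    "wirt 2 (\<lambda>y. gmat y $ 2 $ 2) x = p' * th2 x * th2 x * cnj (th2 x)
           - p * th2 x * cnj (th2 x) / x $ 2"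
    by (simp_all add: e11 e12 e21 e22 g_def p_def p'_def r_def algebra_simps)
qed

lemma kahler_on_gmat:
  assumes "\<And>t. f2 t > 0" "\<And>t. 1 + f1 t > 0"
  shows "kahler_on U gmat"
  unfolding kahler_on_def
proof (intro conjI allI ballI impI)
  show "smooth_on U (\<lambda>x. gmat x $ k $ l)" for k l by (rule smooth_gmat)
next
  fix x and k l :: 2 assume x: "x \<in> U"
  have "k = 1 \<or> k = 2" "l = 1 \<or> l = 2" by (rule exhaust_2)+
  then show "gmat x $ k $ l = cnj (gmat x $ l $ k)"
    by (auto simp: gmat_entries[OF x] mult_ac)
next
  fix x v assume x: "x \<in> U" and v: "v \<noteq> (0::complex^2)"
  have th2: "th2 x \<noteq> 0" and r: "\<rho> (x $ 1) > 0"
    using x \<epsilon> \<rho>_pos by (auto simp: th2_def U_def)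
  show "hform (gmat x) v > 0"
  proof (cases "v $ 1 = 0")
    case True
    then have "v $ 2 \<noteq> 0" using v by (auto simp: vec_eq_iff forall_2)
    then show ?thesis unfolding hform_gmat[OF x] using True th2 assms by simp
  next
    case False
    then show ?thesis
      unfolding hform_gmat[OF x]
      using assms r by (intro add_pos_nonneg[OF mult_pos_pos[OF mult_pos_pos]]) (auto simp: less_imp_le)
  qed
next
  fix x and k l j :: 2 assume x: "x \<in> U"
  have "k = 1 \<or> k = 2" "l = 1 \<or> l = 2" "j = 1 \<or> j = 2" by (rule exhaust_2)+
  then show "wirt j (\<lambda>y. gmat y $ k $ l) x = wirt l (\<lambda>y. gmat y $ k $ j) x"
    by (auto simp: wirt_gmat[OF x] mult_ac add_ac)
qed

text \<open>\<open>P\<close> and \<open>Q\<close> are the logarithmic derivatives of 1 + f' and f''.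
  Along a profile, where f'' = \<phi>(\<gamma>), they become \<phi> / \<gamma> and \<phi>'.
  \<open>dP\<close> and \<open>dQ\<close> are their derivatives in s.\<close>

definition "P s = f2 s / (1 + f1 s)" for s
definition "Q s = f3 s / f2 s" for s
definition "dP s = (f3 s * (1 + f1 s) - (f2 s)\<^sup>2) / (1 + f1 s)\<^sup>2" for s
definition "dQ s = (f4 s * f2 s - (f3 s)\<^sup>2) / (f2 s)\<^sup>2" for s

lemma deriv_P: "1 + f1 s \<noteq> 0 \<Longrightarrow> (P has_real_derivative dP s) (at s)"
  unfolding P_def[abs_def] dP_def
  by (rule derivative_eq_intros derivs_f refl | simp add: power2_eq_square)+

lemma deriv_Q: "f2 s \<noteq> 0 \<Longrightarrow> (Q has_real_derivative dQ s) (at s)"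
  unfolding Q_def[abs_def] dQ_def
  by (rule derivative_eq_intros derivs_f refl | simp add: power2_eq_square)+

text \<open>The matrix \<open>H\<^sup>-\<^sup>1 \<partial>\<^sub>l H\<close>, symmetric in the lower indices because the metric is Kaehler.\<close>

definition "conn l x = (\<chi> (i::2) (j::2).
   if i = 1 \<and> j = 1 then
     (if l = 1 then 2 * (of_real (P (\<sigma> x)) * th1 x) + b (x $ 1) else of_real (P (\<sigma> x)) * th2 x)
   else if i = 1 then (if l = 1 then of_real (P (\<sigma> x)) * th2 x else 0)
   else if j = 1 then
     (if l = 1 then (dz a (x $ 1) - th1 x * b (x $ 1)
          + th1 x * th1 x * (of_real (Q (\<sigma> x)) - 2 * of_real (P (\<sigma> x)))) / th2 x
      else th1 x * (of_real (Q (\<sigma> x)) - of_real (P (\<sigma> x))))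
   else (if l = 1 then th1 x * (of_real (Q (\<sigma> x)) - of_real (P (\<sigma> x)))
      else of_real (Q (\<sigma> x)) * th2 x - 1 / x $ 2))" for l :: 2 and x :: "complex^2"


section \<open>Connection, curvature and the higher scalar curvature in one chart\<close>

lemma invertible_gmat:
  assumes x: "x \<in> U" and pos: "f2 (\<sigma> x) > 0" "1 + f1 (\<sigma> x) > 0"
  shows "det (gmat x) = of_real ((1 + f1 (\<sigma> x)) * \<rho> (x $ 1) * f2 (\<sigma> x)) * (th2 x * cnj (th2 x))"
    and "invertible (gmat x)"
proof -
  show d: "det (gmat x) = of_real ((1 + f1 (\<sigma> x)) * \<rho> (x $ 1) * f2 (\<sigma> x)) * (th2 x * cnj (th2 x))"
    by (simp add: det_2 gmat_entries[OF x] algebra_simps)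
  have "th2 x \<noteq> 0" "\<rho> (x $ 1) \<noteq> 0"
    using x \<epsilon> \<rho>_pos[of "x $ 1"] by (auto simp: th2_def U_def)
  then show "invertible (gmat x)"
    using pos unfolding invertible_det_nz d by (simp del: of_real_add of_real_mult)
qed

lemma conn_eq:
  assumes x: "x \<in> U" and pos: "f2 (\<sigma> x) > 0" "1 + f1 (\<sigma> x) > 0"
  shows "matrix_inv (gmat x) ** (\<chi> p q. wirt l (\<lambda>u. gmat u $ p $ q) x) = conn l x"
proof (rule matrix_inv_mult_eqI[OF invertible_gmat(2)[OF assms]])
  define g p q where "g = complex_of_real (1 + f1 (\<sigma> x))" and "p = complex_of_real (f2 (\<sigma> x))"
    and "q = complex_of_real (Q (\<sigma> x))"
  have nz: "th2 x \<noteq> 0" "x $ 2 \<noteq> 0" "g \<noteq> 0" "p \<noteq> 0"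
    using x \<epsilon> pos by (auto simp: th2_def U_def g_def p_def simp del: of_real_add)
  have P: "complex_of_real (P (\<sigma> x)) = p / g" and Q: "complex_of_real (f3 (\<sigma> x)) = p * q"
    using pos by (simp_all add: P_def g_def p_def q_def Q_def)
  have "l = 1 \<or> l = 2" by (rule exhaust_2)
  then show "gmat x ** conn l x = (\<chi> p q. wirt l (\<lambda>u. gmat u $ p $ q) x)"
    unfolding vec_eq_iff forall_2 matrix_matrix_mult_def sum_2
    by (auto simp: gmat_entries[OF x] wirt_gmat[OF x] conn_def P Q g_def[symmetric] p_def[symmetric]
        q_def[symmetric] simp del: of_real_add)
      (use nz in \<open>auto simp: field_simps\<close>)
qed


lemma conn_entries:
  "conn 1 y $ 1 $ 1 = 2 * (of_real (P (\<sigma> y)) * th1 y) + b (y $ 1)"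
  "conn 2 y $ 1 $ 1 = of_real (P (\<sigma> y)) * th2 y"
  "conn 1 y $ 1 $ 2 = of_real (P (\<sigma> y)) * th2 y"
  "conn 2 y $ 1 $ 2 = 0"
  "conn 1 y $ 2 $ 1 = (dz a (y $ 1) - th1 y * b (y $ 1)
      + th1 y * th1 y * (of_real (Q (\<sigma> y)) - 2 * of_real (P (\<sigma> y)))) / th2 y"
  "conn 2 y $ 2 $ 1 = th1 y * (of_real (Q (\<sigma> y)) - of_real (P (\<sigma> y)))"
  "conn 1 y $ 2 $ 2 = th1 y * (of_real (Q (\<sigma> y)) - of_real (P (\<sigma> y)))"
  "conn 2 y $ 2 $ 2 = of_real (Q (\<sigma> y)) * th2 y - 1 / y $ 2"
  by (simp_all add: conn_def)

text \<open>In the entry \<open>$ 2 $ 1\<close> the term \<rho> b coming from \<open>dz a\<close>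
  cancels against the one from \<open>th1 * b\<close>; what is left of the two is - 2 \<rho>
  \<open>th1\<close>, the summand -1 in the bracket.\<close>

lemma wirtbar_conn:
  assumes x: "x \<in> U" and pos: "f2 (\<sigma> x) > 0" "1 + f1 (\<sigma> x) > 0"
  defines "r \<equiv> complex_of_real (\<rho> (x $ 1))" and "A \<equiv> th1 x" and "E \<equiv> th2 x"
    and "p \<equiv> complex_of_real (P (\<sigma> x))" and "q \<equiv> complex_of_real (Q (\<sigma> x))"
    and "dp \<equiv> complex_of_real (dP (\<sigma> x))" and "dq \<equiv> complex_of_real (dQ (\<sigma> x))"
  shows "wirtbar 1 (\<lambda>y. conn 1 y $ 1 $ 1) x = 2 * (dp * cnj A * A + p * r) + 2 * r"
    "wirtbar 2 (\<lambda>y. conn 1 y $ 1 $ 1) x = 2 * dp * cnj E * A"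
    "wirtbar 1 (\<lambda>y. conn 2 y $ 1 $ 1) x = dp * cnj A * E"
    "wirtbar 2 (\<lambda>y. conn 2 y $ 1 $ 1) x = dp * cnj E * E"
    "wirtbar 1 (\<lambda>y. conn 1 y $ 1 $ 2) x = dp * cnj A * E"
    "wirtbar 2 (\<lambda>y. conn 1 y $ 1 $ 2) x = dp * cnj E * E"
    "wirtbar 1 (\<lambda>y. conn 2 y $ 1 $ 2) x = 0"
    "wirtbar 2 (\<lambda>y. conn 2 y $ 1 $ 2) x = 0"
    "wirtbar 1 (\<lambda>y. conn 1 y $ 2 $ 1) x
       = (2 * A * r * (q - 2 * p - 1) + A * A * (dq - 2 * dp) * cnj A) / E"
    "wirtbar 2 (\<lambda>y. conn 1 y $ 2 $ 1) x = A * A * (dq - 2 * dp) * cnj E / E"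
    "wirtbar 1 (\<lambda>y. conn 2 y $ 2 $ 1) x = r * (q - p) + A * (dq - dp) * cnj A"
    "wirtbar 2 (\<lambda>y. conn 2 y $ 2 $ 1) x = A * (dq - dp) * cnj E"
    "wirtbar 1 (\<lambda>y. conn 1 y $ 2 $ 2) x = r * (q - p) + A * (dq - dp) * cnj A"
    "wirtbar 2 (\<lambda>y. conn 1 y $ 2 $ 2) x = A * (dq - dp) * cnj E"
    "wirtbar 1 (\<lambda>y. conn 2 y $ 2 $ 2) x = dq * cnj A * E"
    "wirtbar 2 (\<lambda>y. conn 2 y $ 2 $ 2) x = dq * cnj E * E"
proof -
  have x1: "x $ 1 \<in> S" and nz: "x $ 2 \<noteq> 0" "th2 x \<noteq> 0"
    using x \<epsilon> by (auto simp: U_def th2_def)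
  have "1 + f1 (\<sigma> x) \<noteq> 0" "f2 (\<sigma> x) \<noteq> 0" using pos by auto
  note Pw = has_wirt_\<sigma>[OF x deriv_P[OF this(1)]] and Qw = has_wirt_\<sigma>[OF x deriv_Q[OF this(2)]]
    and T1 = has_wirt_th1[OF x] and T2 = has_wirt_th2[OF x]
  note Bw = has_wirt_fst[of b, OF deriv_b[OF x1]] and Aw = has_wirt_fst[of "dz a", OF deriv_dz_a[OF x1]]
  note W = has_wirt_imp(3,4)
  note e1 = W[OF has_wirt_add[OF has_wirt_mult[OF has_wirt_const[of 2] has_wirt_mult[OF Pw T1]] Bw]]
  note e2 = W[OF has_wirt_mult[OF Pw T2]]
  note e3 = W[OF has_wirt_divide[OF has_wirt_add[OF has_wirt_diff[OF Aw has_wirt_mult[OF T1 Bw]]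
      has_wirt_mult[OF has_wirt_mult[OF T1 T1] has_wirt_diff[OF Qw has_wirt_mult[OF has_wirt_const[of 2] Pw]]]]
      T2 nz(2)]]
  note e4 = W[OF has_wirt_mult[OF T1 has_wirt_diff[OF Qw Pw]]]
  note e5 = W[OF has_wirt_diff[OF has_wirt_mult[OF Qw T2] has_wirt_divide[OF has_wirt_const[of 1] has_wirt_snd nz(1)]]]
  note e6 = W[OF has_wirt_const[of 0]]
  show "wirtbar 1 (\<lambda>y. conn 1 y $ 1 $ 1) x = 2 * (dp * cnj A * A + p * r) + 2 * r"
    "wirtbar 2 (\<lambda>y. conn 1 y $ 1 $ 1) x = 2 * dp * cnj E * A"
    "wirtbar 1 (\<lambda>y. conn 2 y $ 1 $ 1) x = dp * cnj A * E"
    "wirtbar 2 (\<lambda>y. conn 2 y $ 1 $ 1) x = dp * cnj E * E"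
    "wirtbar 1 (\<lambda>y. conn 1 y $ 1 $ 2) x = dp * cnj A * E"
    "wirtbar 2 (\<lambda>y. conn 1 y $ 1 $ 2) x = dp * cnj E * E"
    "wirtbar 1 (\<lambda>y. conn 2 y $ 1 $ 2) x = 0"
    "wirtbar 2 (\<lambda>y. conn 2 y $ 1 $ 2) x = 0"
    "wirtbar 1 (\<lambda>y. conn 1 y $ 2 $ 1) x
       = (2 * A * r * (q - 2 * p - 1) + A * A * (dq - 2 * dp) * cnj A) / E"
    "wirtbar 2 (\<lambda>y. conn 1 y $ 2 $ 1) x = A * A * (dq - 2 * dp) * cnj E / E"
    "wirtbar 1 (\<lambda>y. conn 2 y $ 2 $ 1) x = r * (q - p) + A * (dq - dp) * cnj A"
    "wirtbar 2 (\<lambda>y. conn 2 y $ 2 $ 1) x = A * (dq - dp) * cnj E"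
    "wirtbar 1 (\<lambda>y. conn 1 y $ 2 $ 2) x = r * (q - p) + A * (dq - dp) * cnj A"
    "wirtbar 2 (\<lambda>y. conn 1 y $ 2 $ 2) x = A * (dq - dp) * cnj E"
    "wirtbar 1 (\<lambda>y. conn 2 y $ 2 $ 2) x = dq * cnj A * E"
    "wirtbar 2 (\<lambda>y. conn 2 y $ 2 $ 2) x = dq * cnj E * E"
    unfolding conn_entries e1 e2 e3 e4 e5 e6 r_def A_def E_def p_def q_def dp_def dq_def
    using nz by (simp_all add: field_simps power2_eq_square th1_def)
qed

lemma curvature_entry_gmat:
  assumes x: "x \<in> U" and pos: "\<And>t. f2 t > 0" "\<And>t. 1 + f1 t > 0"
  shows "curvature_entry gmat i j x $ k $ l = - wirtbar k (\<lambda>y. conn l y $ i $ j) x / of_real (2 * pi)"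
  using wirtbar_cong_open[OF open_U x, of "\<lambda>y. (matrix_inv (gmat y) ** (\<chi> p q. wirt l (\<lambda>u. gmat u $ p $ q) y)) $ i $ j"
      "\<lambda>y. conn l y $ i $ j"] conn_eq[OF _ pos]
  by (simp add: curvature_entry_def)

text \<open>All terms with \<open>th1\<close> cancel in the top Chern form, as they must: a
  holomorphic change of the fibre coordinate makes \<open>th1\<close> vanish at any given point. The
  rest shares the factor \<rho> |\<open>th2\<close>|^2 with the volume form.\<close>

lemma is_higher_scalar_curvature_gmat:
  assumes x: "x \<in> U" and pos: "\<And>t. f2 t > 0" "\<And>t. 1 + f1 t > 0"
  defines "s \<equiv> \<sigma> x"
  shows "is_higher_scalar_curvature gmat x c \<longleftrightarrow>
    c * (1 + f1 s) * f2 s / 2 = (1 + P s) * dQ s + dP s * (Q s - P s)"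
proof -
  define r p q dp dq g w where "r = \<rho> (x $ 1)" and "p = P s" and "q = Q s"
    and "dp = dP s" and "dq = dQ s" and "g = 1 + f1 s" and "w = f2 s"
  define n where "n = (cmod (th2 x))\<^sup>2"
  have E: "th2 x \<noteq> 0" and r: "r > 0" using x \<epsilon> \<rho>_pos by (auto simp: U_def th2_def r_def)
  then have n: "n > 0" by (simp add: n_def)
  have nE: "th2 x * cnj (th2 x) = of_real n"
    by (simp add: n_def complex_norm_square[symmetric])
  have "top_power_coeff gmat x = 2 * det (gmat x)"
    by (simp add: top_power_coeff_def wedge_coeff_2 det_2)
  then have tp: "top_power_coeff gmat x = of_real (2 * (g * r * w) * n)"
    unfolding invertible_gmat(1)[OF x pos(1,2)] nE by (simp add: g_def r_def w_def s_def)
  \<comment> \<open>Both curvature factors carry 1 / (2 pi); multiplying by \<open>k\<^sup>2\<close>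
    clears these denominators.\<close>
  define k where "k = complex_of_real (2 * pi)"
  have k: "k \<noteq> 0" and k2: "k\<^sup>2 \<noteq> 0" by (simp_all add: k_def)
  have "k\<^sup>2 * top_chern_coeff gmat x
      = 2 * of_real r * ((1 + of_real p) * of_real dq + of_real dp * (of_real q - of_real p)) * (th2 x * cnj (th2 x))"
    unfolding top_chern_coeff_2 wedge_coeff_2 curvature_entry_gmat[OF x pos] k_def[symmetric]
    by (simp add: wirtbar_conn[OF x pos(1,2)] r_def[symmetric] p_def[symmetric] q_def[symmetric]
        dp_def[symmetric] dq_def[symmetric] s_def[symmetric])
      (use k E in \<open>simp add: field_simps power2_eq_square\<close>)
  then have tc: "k\<^sup>2 * top_chern_coeff gmat x = of_real (2 * r * ((1 + p) * dq + dp * (q - p)) * n)"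
    unfolding nE by simp
  have "is_higher_scalar_curvature gmat x c \<longleftrightarrow>
      k\<^sup>2 * top_chern_coeff gmat x = k\<^sup>2 * (of_real (c / (2 * (2 * pi)\<^sup>2)) * top_power_coeff gmat x)"
    unfolding mult_left_cancel[OF k2] by (simp add: is_higher_scalar_curvature_def fact_2)
  also have "k\<^sup>2 * (of_real (c / (2 * (2 * pi)\<^sup>2)) * top_power_coeff gmat x) = of_real (c * (g * r * w) * n)"
    unfolding tp k_def by (simp add: field_simps)
  also have "k\<^sup>2 * top_chern_coeff gmat x = of_real (c * (g * r * w) * n) \<longleftrightarrow>
      2 * r * ((1 + p) * dq + dp * (q - p)) * n = c * (g * r * w) * n"
    unfolding tc of_real_eq_iff ..
  also have "\<dots> \<longleftrightarrow> c * g * w / 2 = (1 + p) * dq + dp * (q - p)"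
  proof -
    have "2 * r * ((1 + p) * dq + dp * (q - p)) * n = (r * n) * (2 * ((1 + p) * dq + dp * (q - p)))"
      "c * (g * r * w) * n = (r * n) * (c * g * w)" by (simp_all add: mult_ac)
    moreover have "r * n \<noteq> 0" using n r by simp
    ultimately have "2 * r * ((1 + p) * dq + dp * (q - p)) * n = c * (g * r * w) * n
        \<longleftrightarrow> 2 * ((1 + p) * dq + dp * (q - p)) = c * g * w"
      using mult_left_cancel[of "r * n"] by metis
    also have "\<dots> \<longleftrightarrow> c * g * w / 2 = (1 + p) * dq + dp * (q - p)" by auto
    finally show ?thesis .
  qed
  finally show ?thesis by (simp add: g_def w_def p_def q_def dp_def dq_def)
qed

end

section \<open>Comparison with the model edge metric\<close>

lemma hform_model_edge_metric:
  "hform (model_edge_metric 2 \<beta> x) v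
     = (cmod (v $ 1))\<^sup>2 + cmod (x $ 2) powr (2 * \<beta> - 2) * (cmod (v $ (2::2)))\<^sup>2"
proof -
  have "hform (model_edge_metric 2 \<beta> x) v
      = Re (v $ 1 * cnj (v $ 1) + of_real (cmod (x $ 2) powr (2 * \<beta> - 2)) * (v $ 2 * cnj (v $ 2)))"
    by (simp add: hform_def model_edge_metric_def UNIV_2 mult_ac)
  then show ?thesis
    unfolding complex_norm_square[symmetric] by (simp flip: of_real_power of_real_mult)
qed

text \<open>The obstacle is the shear \<open>a * v + w\<close>. The upper bound is the inequality (x
  + y)^2 \<le> 2 x^2 + 2 y^2. For the lower bound the same inequality is applied to w = (a v + w) -
  a v, and the error in v is absorbed by the base term. The v terms use P \<le> q2, the w terms the
  finer bounds of P by multiples of \<xi>.\<close>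

lemma edge_form_bounds:
  fixes p q w :: complex and g P :: real
  assumes g: "R1 \<le> g" "g \<le> R2" "R1 > 0" and P: "q1 * \<xi> \<le> P" "P \<le> q2 * \<xi>" "P \<ge> 0" "P \<le> q2"
    and q: "q1 > 0" "q2 > 0" and \<xi>: "\<xi> \<ge> 0" and a: "cmod a \<le> A" and X: "X = \<xi> * (cmod w)\<^sup>2"
  defines "t \<equiv> min 1 (R1 / (2 * (q2 * A\<^sup>2 + 1)))"
  shows "min (R1 / 2) (t * q1 / 2) * ((cmod v)\<^sup>2 + X) \<le> g * (cmod v)\<^sup>2 + P * (cmod (a * v + w))\<^sup>2"
    and "g * (cmod v)\<^sup>2 + P * (cmod (a * v + w))\<^sup>2 \<le> (R2 + 2 * q2 * A\<^sup>2 + 2 * q2) * ((cmod v)\<^sup>2 + X)"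
proof -
  define y where "y = (cmod v)\<^sup>2"
  have y: "y \<ge> 0" by (simp add: y_def)
  have X0: "X \<ge> 0" using X \<xi> by simp
  have sq: "(cmod (b + c))\<^sup>2 \<le> 2 * (cmod b)\<^sup>2 + 2 * (cmod c)\<^sup>2" for b c
  proof -
    have "(cmod (b + c))\<^sup>2 \<le> (cmod b + cmod c)\<^sup>2"
      by (intro power_mono norm_triangle_ineq norm_ge_zero)
    also have "\<dots> \<le> 2 * (cmod b)\<^sup>2 + 2 * (cmod c)\<^sup>2"
      using sum_squares_bound[of "cmod b" "cmod c"] by (simp add: power2_sum)
    finally show ?thesis .
  qed
  have av: "(cmod (a * v))\<^sup>2 \<le> A\<^sup>2 * y"
    unfolding norm_mult power_mult_distrib y_def
    by (intro mult_right_mono power_mono a) auto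
  have PX: "P * (cmod w)\<^sup>2 \<le> q2 * X" "q1 * X \<le> P * (cmod w)\<^sup>2"
    using mult_right_mono[OF P(2), of "(cmod w)\<^sup>2"] mult_right_mono[OF P(1), of "(cmod w)\<^sup>2"]
    by (simp_all add: X mult.assoc)
  have PA: "P * (A\<^sup>2 * y) \<le> q2 * (A\<^sup>2 * y)"
    using P(4) y by (intro mult_right_mono) auto
  have gy: "R1 * y \<le> g * y" "g * y \<le> R2 * y" using g y by (auto intro: mult_right_mono)
  have "P * (cmod (a * v + w))\<^sup>2 \<le> P * (2 * (A\<^sup>2 * y) + 2 * (cmod w)\<^sup>2)"
    using sq[of "a * v" w] av P(3) by (intro mult_left_mono) auto
  also have "\<dots> \<le> 2 * (q2 * (A\<^sup>2 * y)) + 2 * (q2 * X)"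
    using PX PA by (simp add: distrib_left)
  finally have "g * y + P * (cmod (a * v + w))\<^sup>2 \<le> R2 * y + (2 * (q2 * (A\<^sup>2 * y)) + 2 * (q2 * X))"
    using gy by simp
  also have "\<dots> \<le> (R2 + 2 * q2 * A\<^sup>2 + 2 * q2) * (y + X)"
  proof -
    have "0 \<le> R2 * X" "0 \<le> q2 * (A\<^sup>2 * X)" "0 \<le> q2 * y" using g q y X0 by auto
    then show ?thesis by (simp add: algebra_simps)
  qed
  finally show "g * (cmod v)\<^sup>2 + P * (cmod (a * v + w))\<^sup>2 \<le> (R2 + 2 * q2 * A\<^sup>2 + 2 * q2) * ((cmod v)\<^sup>2 + X)"
    by (simp add: y_def)
  have qA: "q2 * A\<^sup>2 \<ge> 0" using q by simp
  have t: "0 < t" "t \<le> 1" using g qA by (auto simp: t_def add_nonneg_pos)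
  \<comment> \<open>\<open>t\<close> is chosen so small that the error costs at most half of
    \<open>R1\<close>; the other half survives in the lower bound. The summand 1 keeps the
    denominator positive when \<open>A\<close> is 0.\<close>
  have "t * (q2 * A\<^sup>2 + 1) \<le> R1 / (2 * (q2 * A\<^sup>2 + 1)) * (q2 * A\<^sup>2 + 1)"
    using qA by (intro mult_right_mono) (auto simp: t_def)
  also have "\<dots> = R1 / 2"
  proof -
    have "R1 / (2 * D) * D = R1 / 2" if "D \<noteq> 0" for D using that by simp
    then show ?thesis using qA by (metis add_nonneg_pos less_irrefl zero_less_one)
  qed
  finally have tA: "t * (q2 * A\<^sup>2) \<le> R1 / 2" using t by (simp add: distrib_left)
  have "(cmod w)\<^sup>2 \<le> 2 * (cmod (a * v + w))\<^sup>2 + 2 * (A\<^sup>2 * y)"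
    using sq[of "a * v + w" "- (a * v)"] av by simp
  then have "P * (cmod w)\<^sup>2 \<le> P * (2 * (cmod (a * v + w))\<^sup>2 + 2 * (A\<^sup>2 * y))"
    using P(3) by (rule mult_left_mono)
  then have "q1 * X \<le> 2 * (P * (cmod (a * v + w))\<^sup>2) + 2 * (q2 * (A\<^sup>2 * y))"
    using PX PA by (simp add: distrib_left)
  then have "t * (q1 * X) \<le> t * (2 * (P * (cmod (a * v + w))\<^sup>2) + 2 * (q2 * (A\<^sup>2 * y)))"
    using t by (intro mult_left_mono) auto
  also have "\<dots> = 2 * (t * (P * (cmod (a * v + w))\<^sup>2)) + 2 * (t * (q2 * A\<^sup>2) * y)"
    by (simp add: algebra_simps)
  also have "\<dots> \<le> 2 * (P * (cmod (a * v + w))\<^sup>2) + 2 * (R1 / 2 * y)"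
    using t tA y P(3) by (intro add_mono mult_left_mono mult_right_mono mult_left_le_one_le) auto
  finally have "t * q1 / 2 * X + R1 / 2 * y \<le> g * y + P * (cmod (a * v + w))\<^sup>2"
    using gy by (simp add: field_simps)
  moreover have "min (R1 / 2) (t * q1 / 2) * (y + X) \<le> R1 / 2 * y + t * q1 / 2 * X"
    unfolding distrib_left using y X0 by (intro add_mono mult_right_mono) auto
  ultimately show "min (R1 / 2) (t * q1 / 2) * ((cmod v)\<^sup>2 + X) \<le> g * (cmod v)\<^sup>2 + P * (cmod (a * v + w))\<^sup>2"
    by (simp add: y_def)
qed

context calabi_chart
begin

text \<open>Here \<epsilon> s = ln |x2|^2 + \<epsilon> ln h with ln h bounded near
  \<open>z0\<close>, so exp(\<beta> \<epsilon> s) is comparable to |x2|^(2 \<beta>). The factor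
  |\<open>th2\<close>|^2 = 1 / |x2|^2 lowers the exponent to the 2 \<beta> - 2 of the model.\<close>

lemma conical_bounds:
  assumes z0: "z0 \<in> S" and \<beta>: "\<beta> > 0" and \<gamma>: "\<And>t. 1 \<le> 1 + f1 t" "\<And>t. 1 + f1 t \<le> M"
    and decay: "\<And>s1. \<exists>c1>0. \<exists>c2>0. \<forall>s. \<epsilon> * s \<le> s1 \<longrightarrow>
      c1 * exp (\<beta> * (\<epsilon> * s)) \<le> f2 s \<and> f2 s \<le> c2 * exp (\<beta> * (\<epsilon> * s))"
  obtains r C1 C2 where "r > 0" "C1 > 0" "C2 > 0" "ball z0 r \<subseteq> S"
    "\<And>x v. x \<in> U \<Longrightarrow> x $ 1 \<in> ball z0 r \<Longrightarrow> cmod (x $ 2) < 1 \<Longrightarrow>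
      C1 * hform (model_edge_metric 2 \<beta> x) v \<le> hform (gmat x) v \<and>
      hform (gmat x) v \<le> C2 * hform (model_edge_metric 2 \<beta> x) v"
proof -
  obtain r where r: "r > 0" "cball z0 r \<subseteq> S" using open_contains_cball open_S z0 by blast
  have bdd: "\<exists>B>0. \<forall>z\<in>cball z0 r. norm (k z) \<le> B" if "continuous_on (cball z0 r) k"
    for k :: "complex \<Rightarrow> 'w::real_normed_vector"
    using compact_imp_bounded[OF compact_continuous_image[OF that compact_cball]]
    by (auto simp: bounded_pos)
  have c: "continuous_on (cball z0 r) k" if "smooth_on S k" for k :: "complex \<Rightarrow> 'w::real_normed_vector"
    using continuous_on_subset[OF smooth_on_continuous[OF that] r(2)] .
  obtain K where K: "K > 0" "\<forall>z\<in>cball z0 r. \<bar>ln (h z)\<bar> \<le> K"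
    using bdd[OF c[OF smooth_on_ln_compose[OF open_S smooth_h h_pos]]] by auto
  obtain A where A: "A > 0" "\<forall>z\<in>cball z0 r. cmod (a z) \<le> A"
    using bdd[OF c[OF smooth_a]] by auto
  obtain B where B: "B > 0" "\<forall>z\<in>cball z0 r. \<bar>ln (\<rho> z)\<bar> \<le> B"
    using bdd[OF c[OF smooth_on_ln_compose[OF open_S smooth_\<rho> \<rho>_pos]]] by auto
  \<comment> \<open>For |x2| < 1 the logarithm of the fibre coordinate is negative, so \<epsilon> s
    stays below the bound \<open>K\<close> of |ln h|.\<close>
  obtain c1 c2 where c12: "c1 > 0" "c2 > 0" "\<forall>s. \<epsilon> * s \<le> K \<longrightarrow>
      c1 * exp (\<beta> * (\<epsilon> * s)) \<le> f2 s \<and> f2 s \<le> c2 * exp (\<beta> * (\<epsilon> * s))"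
    using decay[of K] by blast
  have M: "M \<ge> 1" using \<gamma>[of 0] by simp
  define q1 q2 where "q1 = c1 * exp (- (\<beta> * K))" and "q2 = c2 * exp (\<beta> * K)"
  define R1 R2 where "R1 = exp (- B)" and "R2 = M * exp B"
  have q: "q1 > 0" "q2 > 0" using c12 by (auto simp: q1_def q2_def)
  define t where "t = min 1 (R1 / (2 * (q2 * A\<^sup>2 + 1)))"
  have t: "t > 0" using q by (auto simp: t_def R1_def add_nonneg_pos)
  show ?thesis
  proof (rule that[of r "min (R1 / 2) (t * q1 / 2)" "R2 + 2 * q2 * A\<^sup>2 + 2 * q2"])
    show "r > 0" "ball z0 r \<subseteq> S" using r by auto
    show "min (R1 / 2) (t * q1 / 2) > 0" using t q by (simp add: R1_def)
    show "R2 + 2 * q2 * A\<^sup>2 + 2 * q2 > 0" using M q by (auto simp: R2_def intro!: add_nonneg_pos)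
    fix x v :: "complex^2" assume x: "x \<in> U" and x1: "x $ 1 \<in> ball z0 r" and x2: "cmod (x $ 2) < 1"
    have x1': "x $ 1 \<in> cball z0 r" and xS: "x $ 1 \<in> S" and x20: "x $ 2 \<noteq> 0"
      using x1 x by (auto simp: U_def)
    define \<xi> where "\<xi> = cmod (x $ 2) powr (2 * \<beta>)"
    have \<xi>: "\<xi> \<ge> 0" "\<xi> \<le> 1" using x2 \<beta> by (auto simp: \<xi>_def intro!: powr_le1)
    have eK: "\<bar>\<epsilon> * ln (h (x $ 1))\<bar> \<le> K"
    proof -
      have "\<bar>\<epsilon>\<bar> = 1" using \<epsilon> by (simp add: abs_square_eq_1 flip: power2_eq_square)
      then show ?thesis using K(2) x1' by (simp add: abs_mult)
    qed
    have es: "\<epsilon> * \<sigma> x = 2 * ln (cmod (x $ 2)) + \<epsilon> * ln (h (x $ 1))"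
      using \<epsilon> x20 by (simp add: \<sigma>_def distrib_left mult.assoc[symmetric] ln_realpow)
    have "2 * ln (cmod (x $ 2)) \<le> 0" using x2 x20 by simp
    then have le: "\<epsilon> * \<sigma> x \<le> K" using es eK by linarith
    have ex: "exp (\<beta> * (\<epsilon> * \<sigma> x)) = \<xi> * exp (\<beta> * (\<epsilon> * ln (h (x $ 1))))"
      unfolding es \<xi>_def using x20 by (simp add: powr_def algebra_simps exp_add)
    have "- (\<beta> * K) \<le> \<beta> * (\<epsilon> * ln (h (x $ 1)))" "\<beta> * (\<epsilon> * ln (h (x $ 1))) \<le> \<beta> * K"
      using eK mult_left_mono[of "- K" "\<epsilon> * ln (h (x $ 1))" \<beta>] mult_left_mono[of "\<epsilon> * ln (h (x $ 1))" K \<beta>] \<beta>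
      by (auto simp: abs_le_iff)
    then have eb: "exp (- (\<beta> * K)) \<le> exp (\<beta> * (\<epsilon> * ln (h (x $ 1))))"
      "exp (\<beta> * (\<epsilon> * ln (h (x $ 1)))) \<le> exp (\<beta> * K)" by auto
    have f2: "c1 * (\<xi> * exp (\<beta> * (\<epsilon> * ln (h (x $ 1))))) \<le> f2 (\<sigma> x)"
      "f2 (\<sigma> x) \<le> c2 * (\<xi> * exp (\<beta> * (\<epsilon> * ln (h (x $ 1)))))"
      using c12(3) le unfolding ex[symmetric] by auto
    have P: "q1 * \<xi> \<le> f2 (\<sigma> x)" "f2 (\<sigma> x) \<le> q2 * \<xi>"
    proof -
      have "q1 * \<xi> \<le> c1 * (\<xi> * exp (\<beta> * (\<epsilon> * ln (h (x $ 1)))))"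
        using mult_left_mono[OF eb(1), of "c1 * \<xi>"] c12 \<xi> by (simp add: q1_def mult_ac)
      then show "q1 * \<xi> \<le> f2 (\<sigma> x)" using f2 by linarith
      have "c2 * (\<xi> * exp (\<beta> * (\<epsilon> * ln (h (x $ 1))))) \<le> q2 * \<xi>"
        using mult_left_mono[OF eb(2), of "c2 * \<xi>"] c12 \<xi> by (simp add: q2_def mult_ac)
      then show "f2 (\<sigma> x) \<le> q2 * \<xi>" using f2 by linarith
    qed
    have P0: "0 \<le> f2 (\<sigma> x)" using P(1) q \<xi> by (meson mult_nonneg_nonneg less_imp_le order_trans)
    have P1: "f2 (\<sigma> x) \<le> q2" using P(2) mult_left_mono[OF \<xi>(2), of q2] q by linarith
    have \<rho>: "exp (- B) \<le> \<rho> (x $ 1)" "\<rho> (x $ 1) \<le> exp B"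
    proof -
      have "\<bar>ln (\<rho> (x $ 1))\<bar> \<le> B" using B(2) x1' by blast
      then have "- B \<le> ln (\<rho> (x $ 1))" "ln (\<rho> (x $ 1)) \<le> B" by linarith+
      then have "exp (- B) \<le> exp (ln (\<rho> (x $ 1)))" "exp (ln (\<rho> (x $ 1))) \<le> exp B" by auto
      then show "exp (- B) \<le> \<rho> (x $ 1)" "\<rho> (x $ 1) \<le> exp B" using \<rho>_pos[OF xS] by simp_all
    qed
    have g: "R1 \<le> (1 + f1 (\<sigma> x)) * \<rho> (x $ 1)" "(1 + f1 (\<sigma> x)) * \<rho> (x $ 1) \<le> R2"
      using mult_mono[of 1 "1 + f1 (\<sigma> x)" "exp (- B)" "\<rho> (x $ 1)"]
        mult_mono[of "1 + f1 (\<sigma> x)" M "\<rho> (x $ 1)" "exp B"] \<gamma>[of "\<sigma> x"] \<rho> \<rho>_pos[OF xS] M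
      by (auto simp: R1_def R2_def)
    have th1: "cmod (th1 x) \<le> A" using A(2) x1' by (simp add: th1_def)
    have X: "cmod (x $ 2) powr (2 * \<beta> - 2) * (cmod (v $ 2))\<^sup>2 = \<xi> * (cmod (th2 x * v $ 2))\<^sup>2"
    proof -
      have "\<epsilon>\<^sup>2 = 1" using \<epsilon> by (simp add: power2_eq_square)
      then have "(cmod (th2 x))\<^sup>2 = 1 / (cmod (x $ 2))\<^sup>2"
        by (simp add: th2_def norm_divide power_divide)
      moreover have "cmod (x $ 2) powr (2 * \<beta> - 2) = \<xi> / (cmod (x $ 2))\<^sup>2"
        using x20 by (simp add: \<xi>_def powr_diff)
      ultimately show ?thesis by (simp add: norm_mult power_mult_distrib)
    qed
    show "min (R1 / 2) (t * q1 / 2) * hform (model_edge_metric 2 \<beta> x) v \<le> hform (gmat x) v \<and>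
        hform (gmat x) v \<le> (R2 + 2 * q2 * A\<^sup>2 + 2 * q2) * hform (model_edge_metric 2 \<beta> x) v"
      unfolding hform_gmat[OF x] hform_model_edge_metric t_def
      using edge_form_bounds[OF g _ P P0 P1 q \<xi>(1) th1 X, of "v $ 1"] by (simp add: R1_def)
  qed
qed

end

section \<open>The momentum profile\<close>

lemma constant_on_closed_interval:
  fixes W :: "real \<Rightarrow> real"
  assumes "a < b" "continuous_on {a..b} W"
    "\<And>x. a < x \<Longrightarrow> x < b \<Longrightarrow> (W has_real_derivative 0) (at x)" "x \<in> {a..b}"
  shows "W x = W a"
  using DERIV_isconst2[of a b W x] assms by auto

text \<open>The scale of the solution: slope \<beta> at 1 forces the higher scalar curvature to be
  -12 times this number.\<close>

definition profile_rate :: "real \<Rightarrow> real \<Rightarrow> real" where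
  "profile_rate \<beta> M = \<beta> / ((M + 2) * (M - 1))"

text \<open>The function V. The factor x + M + 1 is forced by the missing quadratic term in the
  numerator of V - 1.\<close>

definition profile_square :: "real \<Rightarrow> real \<Rightarrow> real \<Rightarrow> real" where
  "profile_square \<beta> M x = 1 + 2 * profile_rate \<beta> M * (x - 1) * (M - x) * (x + M + 1) / x"

definition conical_profile :: "real \<Rightarrow> real \<Rightarrow> real \<Rightarrow> real" where
  "conical_profile \<beta> M x = x * (sqrt (profile_square \<beta> M x) - 1)"

text \<open>
  Along the equation, \<open>W = x\<^sup>2 V' / 2\<close> for \<open>V = (1 + g / x)\<^sup>2\<close> satisfies \<open>W' = c x\<^sup>2 / 2\<close>: in terms of
  \<open>V\<close> the equation is linear.
\<close>

lemma profile_derivatives: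
  fixes g g1 :: "real \<Rightarrow> real"
  assumes "x > 0" "(g has_real_derivative g1 x) (at x)" "(g1 has_real_derivative g2) (at x)"
  shows "((\<lambda>x. (x + g x) * (x * g1 x - g x) / x) has_real_derivative
      (x + g x) * g2 + (g1 x - g x / x)\<^sup>2) (at x)"
    and "((\<lambda>x. ((x + g x) / x)\<^sup>2) has_real_derivative
      2 * ((x + g x) * (x * g1 x - g x) / x) / x\<^sup>2) (at x)"
  using assms
  by (auto intro!: derivative_eq_intros simp: field_simps power2_eq_square)

lemma conical_profile_unique:
  fixes g g1 g2 :: "real \<Rightarrow> real"
  assumes M: "M > 1"
    and g: "\<And>x. x \<in> {1..M} \<Longrightarrow> (g has_real_derivative g1 x) (at x)"
    and g1: "\<And>x. x \<in> {1..M} \<Longrightarrow> (g1 has_real_derivative g2 x) (at x)"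
    and ode: "\<And>x. 1 < x \<Longrightarrow> x < M \<Longrightarrow> c * x\<^sup>2 / 2 = (x + g x) * g2 x + (g1 x - g x / x)\<^sup>2"
    and bd: "g 1 = 0" "g M = 0" "g1 1 = \<beta>" "g1 M = - \<beta>'"
    and pos: "\<And>x. 1 < x \<Longrightarrow> x < M \<Longrightarrow> g x > 0"
  shows "\<beta>' = \<beta> * (2 * M + 1) / (M + 2)"
    and "\<And>x. x \<in> {1..M} \<Longrightarrow> g x = conical_profile \<beta> M x"
proof -
  define W where "W = (\<lambda>x. (x + g x) * (x * g1 x - g x) / x)"
  define V where "V = (\<lambda>x. ((x + g x) / x)\<^sup>2)"
  define k where "k = profile_rate \<beta> M"
  have W: "(W has_real_derivative (x + g x) * g2 x + (g1 x - g x / x)\<^sup>2) (at x)"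
    and V: "(V has_real_derivative 2 * W x / x\<^sup>2) (at x)" if "x \<in> {1..M}" for x
    using profile_derivatives[OF _ g g1, of x] that by (auto simp: W_def V_def)
  \<comment> \<open>The constant of integration: W 1 = \<beta>, because g vanishes at 1 and has
    slope \<beta> there.\<close>
  define K where "K = \<beta> - c / 6"
  have W': "W x = c * x ^ 3 / 6 + K" if x: "x \<in> {1..M}" for x
  proof -
    have "W x - c * x ^ 3 / 6 = W 1 - c * 1 ^ 3 / 6"
    proof (rule constant_on_closed_interval[OF M _ _ x, of "\<lambda>x. W x - c * x ^ 3 / 6"])
      show "continuous_on {1..M} (\<lambda>x. W x - c * x ^ 3 / 6)"
        by (intro continuous_intros continuous_at_imp_continuous_on ballI DERIV_isCont[OF W]) auto
      show "((\<lambda>x. W x - c * x ^ 3 / 6) has_real_derivative 0) (at x)" if "1 < x" "x < M" for x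
        by (rule derivative_eq_intros W refl | use that ode[OF that] in simp)+
    qed
    then show ?thesis by (simp add: W_def bd K_def)
  qed
  \<comment> \<open>V' = 2 W / x^2 = c x / 3 + 2 K / x^2 integrates to the terms on the left; the
    right-hand side is the value at 1, where V = 1.\<close>
  have V': "V x - c * x\<^sup>2 / 6 + 2 * K / x = 1 - c / 6 + 2 * K" if x: "x \<in> {1..M}" for x
  proof -
    have "V x - c * x\<^sup>2 / 6 + 2 * K / x = V 1 - c * 1\<^sup>2 / 6 + 2 * K / 1"
    proof (rule constant_on_closed_interval[OF M _ _ x, of "\<lambda>x. V x - c * x\<^sup>2 / 6 + 2 * K / x"])
      show "continuous_on {1..M} (\<lambda>x. V x - c * x\<^sup>2 / 6 + 2 * K / x)"
        by (intro continuous_intros continuous_at_imp_continuous_on[of _ V] ballI DERIV_isCont[OF V]) auto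
      show "((\<lambda>x. V x - c * x\<^sup>2 / 6 + 2 * K / x) has_real_derivative 0) (at x)" if "1 < x" "x < M" for x
      proof -
        have "((\<lambda>x. V x - c * x\<^sup>2 / 6 + 2 * K / x) has_real_derivative
            2 * W x / x\<^sup>2 - c * (2 * x) / 6 - 2 * K / x\<^sup>2) (at x)"
          by (rule derivative_eq_intros V refl | use that in \<open>simp add: power2_eq_square field_simps\<close>)+
        moreover have "2 * W x / x\<^sup>2 - c * (2 * x) / 6 - 2 * K / x\<^sup>2 = 0"
          using W'[of x] that by (simp add: field_simps power2_eq_square power3_eq_cube)
        ultimately show ?thesis by simp
      qed
    qed
    then show ?thesis by (simp add: V_def bd)
  qed
  have kM: "\<beta> = k * ((M + 2) * (M - 1))" using M by (simp add: k_def profile_rate_def)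
  \<comment> \<open>The vanishing of g at M is a linear relation between c and K. The factor M - 1
    divides out, and with K = \<beta> - c / 6 it fixes c.\<close>
  have "V M = 1" using M by (simp add: V_def bd)
  then have "c * (M\<^sup>2 - 1) / 6 = 2 * K * (1 / M - 1)" using V'[of M] M by (simp add: field_simps)
  then have "c * (M + 1) * (M - 1) * M / 6 = - 2 * K * (M - 1)"
    using M by (simp add: field_simps power2_eq_square)
  then have "(M - 1) * (c * (M + 1) * M / 6) = (M - 1) * (- 2 * K)" by (simp add: algebra_simps)
  from mult_left_cancel[THEN iffD1, OF _ this] M have "c * (M + 1) * M / 6 = - 2 * K" by simp
  then have "((M + 2) * (M - 1)) * (c / 6) = ((M + 2) * (M - 1)) * (- 2 * k)"
    using kM by (simp add: K_def algebra_simps)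
  from mult_left_cancel[THEN iffD1, OF _ this] M have c: "c = - 12 * k" by simp
  then have K: "K = k * (M * (M + 1))" using kM by (simp add: K_def algebra_simps)
  \<comment> \<open>The slope at M enters only here: W is already known, so it can be solved
    for.\<close>
  have "W M = - \<beta>' * M" using M by (simp add: W_def bd)
  then have "\<beta>' * M = M * (k * ((2 * M + 1) * (M - 1)))"
    using W'[of M] M unfolding c K by (simp add: algebra_simps power3_eq_cube)
  then have "\<beta>' = k * ((2 * M + 1) * (M - 1))" using M by simp
  then show "\<beta>' = \<beta> * (2 * M + 1) / (M + 2)"
    unfolding kM using M by (simp add: nonzero_eq_divide_eq)
  fix x assume x: "x \<in> {1..M}"
  then have x0: "x > 0" by simp
  have "V x = profile_square \<beta> M x"
    using V'[OF x] x0 unfolding c K profile_square_def k_def[symmetric]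
    by (simp add: field_simps power2_eq_square)
  moreover have "sqrt (V x) = (x + g x) / x"
  proof -
    \<comment> \<open>The root of V is the absolute value of 1 + g / x; positivity of g selects the
      sign.\<close>
    have "g x \<ge> 0" using pos[of x] bd x by (cases "x = 1 \<or> x = M") auto
    then show ?thesis using x0 by (simp add: V_def)
  qed
  ultimately show "g x = conical_profile \<beta> M x"
    using x0 by (simp add: conical_profile_def field_simps)
qed

section \<open>The explicit profile: smoothness, equation and boundary slopes\<close>

locale profile_data =
  fixes \<beta> M :: real
  assumes \<beta>: "\<beta> > 0" and M: "M > 1"
begin

abbreviation "k \<equiv> profile_rate \<beta> M"
abbreviation "V \<equiv> profile_square \<beta> M"
abbreviation "\<phi> \<equiv> conical_profile \<beta> M"
definition "\<beta>' = \<beta> * (2 * M + 1) / (M + 2)"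
text \<open>An open neighbourhood of [1, M] on which the root is smooth. It witnesses
  \<open>smooth_up_to_boundary\<close> and allows two-sided derivatives at the ends.\<close>

definition "T = {x. 0 < x \<and> 0 < V x}"

lemma k_pos: "k > 0" and \<beta>_k: "\<beta> = k * ((M + 2) * (M - 1))" and \<beta>'_k: "\<beta>' = k * ((2 * M + 1) * (M - 1))"
proof -
  show "k > 0" using \<beta> M by (simp add: profile_rate_def)
  show k: "\<beta> = k * ((M + 2) * (M - 1))" using M by (simp add: profile_rate_def)
  show "\<beta>' = k * ((2 * M + 1) * (M - 1))"
    unfolding \<beta>'_def using M by (subst k) (simp add: nonzero_divide_eq_eq)
qed

lemma \<beta>'_gt: "\<beta>' > \<beta>" "\<beta>' > 0"
proof -
  have "\<beta> * (M + 2) < \<beta> * (2 * M + 1)" using \<beta> M by (intro mult_strict_left_mono) auto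
  then show "\<beta>' > \<beta>" using M by (simp add: \<beta>'_def field_simps)
  with \<beta> show "\<beta>' > 0" by simp
qed

lemma V_ge_1: "x \<in> {1..M} \<Longrightarrow> V x \<ge> 1" and V_gt_1: "1 < x \<Longrightarrow> x < M \<Longrightarrow> V x > 1"
  using k_pos M by (auto simp: profile_square_def)

lemma subset_T: "{1..M} \<subseteq> T"
  using V_ge_1 by (force simp: T_def)

lemma smooth_V: "smooth_on {0<..} V"
proof -
  have "smooth_on {0<..} (\<lambda>x. 1 + (2 * k) * ((x + - 1) * (M + - 1 * x) * (x + (M + 1)) * inverse x))"
    by (intro smooth_on_add smooth_on_mult smooth_on_const smooth_on_inverse
        smooth_on_bounded_linear[OF _ bounded_linear_ident]) auto
  then show ?thesis
    by (rule smooth_on_cong[rotated]) (auto simp: profile_square_def field_simps)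
qed

lemma open_T: "open T"
proof -
  have "T = {x\<in>{0<..}. V x \<in> {0<..}}" by (auto simp: T_def)
  also have "open \<dots>"
    using continuous_open_preimage[OF smooth_on_continuous[OF smooth_V], of "{0<..}"]
    by (simp add: Int_def vimage_def)
  finally show ?thesis .
qed

lemma smooth_\<phi>: "smooth_on T \<phi>"
proof -
  have "smooth_on T (\<lambda>x. sqrt (V x))"
    by (rule smooth_on_compose[OF open_T _ _ smooth_on_sqrt smooth_on_subset[OF smooth_V]])
      (auto simp: T_def)
  then have "smooth_on T (\<lambda>x. x * (sqrt (V x) + - 1))"
    by (intro smooth_on_mult smooth_on_add smooth_on_const open_T smooth_on_bounded_linear[OF _ bounded_linear_ident])
  then show ?thesis by (simp add: conical_profile_def[abs_def])
qed

text \<open>Rationalising \<open>sqrt (V x) - 1\<close> displays the simple zeros at 1 and M, with a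
  cofactor that is positive and continuous on the closed interval.\<close>

lemma \<phi>_factor:
  assumes "x \<in> {1..M}"
  shows "\<phi> x = 2 * k * (x - 1) * (M - x) * (x + M + 1) / (sqrt (V x) + 1)"
proof -
  have s: "sqrt (V x) > 0" using V_ge_1[OF assms] by simp
  have "(sqrt (V x) - 1) * (sqrt (V x) + 1) = V x - 1"
    using V_ge_1[OF assms] by (simp add: algebra_simps)
  then have "sqrt (V x) - 1 = (V x - 1) / (sqrt (V x) + 1)"
    using s by (subst nonzero_eq_divide_eq) auto
  then show ?thesis
    using assms by (simp add: conical_profile_def) (simp add: profile_square_def)
qed

lemma \<phi>_pos: "1 < x \<Longrightarrow> x < M \<Longrightarrow> \<phi> x > 0"
  using V_gt_1[of x] by (simp add: conical_profile_def)

lemma \<phi>_ends: "\<phi> 1 = 0" "\<phi> M = 0"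
  by (simp_all add: conical_profile_def profile_square_def)

lemma deriv_V:
  assumes "x > 0"
  shows "(V has_real_derivative 2 * (- 2 * k * x ^ 3 + k * (M * (M + 1))) / x\<^sup>2) (at x)"
proof -
  \<comment> \<open>V split into powers of x, by (M - x) (x + M + 1) = M (M + 1) - x (x +
    1).\<close>
  have "((\<lambda>x. 1 + 2 * k * (1 - x\<^sup>2 + M * (M + 1) * (1 - 1 / x))) has_real_derivative
      2 * k * (- 2 * x + M * (M + 1) * (1 / x\<^sup>2))) (at x)"
    by (rule derivative_eq_intros refl | use assms in \<open>simp add: power2_eq_square\<close>)+
  moreover have "2 * k * (- 2 * x + M * (M + 1) * (1 / x\<^sup>2))
      = 2 * (- 2 * k * x ^ 3 + k * (M * (M + 1))) / x\<^sup>2"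
    using assms by (simp add: field_simps power2_eq_square power3_eq_cube)
  ultimately have "((\<lambda>x. 1 + 2 * k * (1 - x\<^sup>2 + M * (M + 1) * (1 - 1 / x))) has_real_derivative
      2 * (- 2 * k * x ^ 3 + k * (M * (M + 1))) / x\<^sup>2) (at x)" by simp
  then show ?thesis
    by (rule has_field_derivative_transform_within_open[of _ _ _ "{0<..}"])
      (use assms in \<open>auto simp: profile_square_def field_simps power2_eq_square\<close>)
qed

lemma deriv_\<phi>:
  assumes "x \<in> T"
  shows "(\<phi> has_real_derivative deriv \<phi> x) (at x)"
    and "(deriv \<phi> has_real_derivative deriv (deriv \<phi>) x) (at x)"
  using smooth_on_DERIV[OF smooth_\<phi> assms] smooth_on_DERIV[OF smooth_on_deriv[OF open_T smooth_\<phi>] assms]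
  by auto

text \<open>V' is computed twice, from V = ((x + \<phi>) / x)^2 and from the explicit formula. The
  result is the function W of the uniqueness proof; differentiating it yields
  \<open>\<phi>_ode\<close>, and its values at 1 and M yield the two slopes.\<close>

lemma \<phi>_first_integral:
  assumes "x \<in> T"
  shows "(x + \<phi> x) * (x * deriv \<phi> x - \<phi> x) / x = - 2 * k * x ^ 3 + k * (M * (M + 1))"
proof -
  have x: "x > 0" using assms by (simp add: T_def)
  have "((\<lambda>x. ((x + \<phi> x) / x)\<^sup>2) has_real_derivative
      2 * ((x + \<phi> x) * (x * deriv \<phi> x - \<phi> x) / x) / x\<^sup>2) (at x)"
    by (rule profile_derivatives(2)[OF x deriv_\<phi>[OF assms]])
  then have "(V has_real_derivative 2 * ((x + \<phi> x) * (x * deriv \<phi> x - \<phi> x) / x) / x\<^sup>2) (at x)"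
    by (rule has_field_derivative_transform_within_open[OF _ open_T assms])
      (auto simp: T_def conical_profile_def field_simps)
  note eq = DERIV_unique[OF this deriv_V[OF x]]
  have "y = z" if "2 * y / x\<^sup>2 = 2 * z / x\<^sup>2" for y z using that x by simp
  from this[OF eq] show ?thesis .
qed

lemma \<phi>_ode:
  assumes "x \<in> T"
  shows "- 12 * k * x\<^sup>2 / 2 = (x + \<phi> x) * deriv (deriv \<phi>) x + (deriv \<phi> x - \<phi> x / x)\<^sup>2"
proof -
  have x: "x > 0" using assms by (simp add: T_def)
  have "((\<lambda>x. - 2 * k * x ^ 3 + k * (M * (M + 1))) has_real_derivative
      (x + \<phi> x) * deriv (deriv \<phi>) x + (deriv \<phi> x - \<phi> x / x)\<^sup>2) (at x)"
    by (rule has_field_derivative_transform_within_open[OF profile_derivatives(1)[OF x deriv_\<phi>[OF assms]]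
          open_T assms \<phi>_first_integral])
  moreover have "((\<lambda>x. - 2 * k * x ^ 3 + k * (M * (M + 1))) has_real_derivative - 6 * k * x\<^sup>2) (at x)"
    by (auto intro!: derivative_eq_intros)
  ultimately show ?thesis using DERIV_unique by fastforce
qed

lemma deriv_\<phi>_ends: "deriv \<phi> 1 = \<beta>" "deriv \<phi> M = - \<beta>'"
proof -
  have "1 \<in> T" "M \<in> T" using subset_T M by auto
  note W = \<phi>_first_integral[OF this(1)] \<phi>_first_integral[OF this(2)]
  show "deriv \<phi> 1 = \<beta>"
    using W(1) unfolding \<phi>_ends by (subst \<beta>_k) (simp add: algebra_simps)
  have "M * deriv \<phi> M = M * (- 2 * k * M\<^sup>2 + k * (M + 1))"
    using W(2) M unfolding \<phi>_ends by (simp add: algebra_simps power2_eq_square power3_eq_cube)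
  from mult_left_cancel[THEN iffD1, OF _ this] M show "deriv \<phi> M = - \<beta>'"
    by (simp add: \<beta>'_k algebra_simps power2_eq_square)
qed


text \<open>
  \<open>1 / \<phi> = 1 / (k (x - 1) (M - x) (x + M + 1)) + 1 / (x (sqrt V + 1))\<close>, where the second summand is
  continuous up to the boundary; \<open>flow_time\<close> integrates this by partial fractions.
\<close>

definition "R = (SOME R. \<forall>x\<in>{1..M}. (R has_real_derivative 1 / (x * (sqrt (V x) + 1))) (at x within {1..M}))"
definition "E x = R x - ln (x + M + 1) / (k * (M + 2) * (2 * M + 1))" for x
definition "flow_time x = ln (x - 1) / \<beta> - ln (M - x) / \<beta>' + E x" for x

section \<open>The time function of the flow\<close>

lemma denominator_pos: "x \<in> {1..M} \<Longrightarrow> sqrt (V x) + 1 > 0"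
  using V_ge_1[of x] by (intro add_nonneg_pos) auto

lemma deriv_R:
  assumes "x \<in> {1..M}"
  shows "(R has_real_derivative 1 / (x * (sqrt (V x) + 1))) (at x within {1..M})"
proof -
  have "continuous_on {1..M} (\<lambda>x. 1 / (x * (sqrt (V x) + 1)))"
    using denominator_pos
    by (intro continuous_intros smooth_on_continuous[OF smooth_on_subset[OF smooth_V]]) force+
  then obtain R' where
    "\<And>x. x \<in> {1..M} \<Longrightarrow> (R' has_vector_derivative 1 / (x * (sqrt (V x) + 1))) (at x within {1..M})"
    by (rule antiderivative_continuous) blast
  then have "\<forall>x\<in>{1..M}. (R' has_real_derivative 1 / (x * (sqrt (V x) + 1))) (at x within {1..M})"
    by (simp add: has_real_derivative_iff_has_vector_derivative)
  then have "\<forall>x\<in>{1..M}. (R has_real_derivative 1 / (x * (sqrt (V x) + 1))) (at x within {1..M})"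
    unfolding R_def
    by (rule someI[where P="\<lambda>R. \<forall>x\<in>{1..M}. (R has_real_derivative 1 / (x * (sqrt (V x) + 1))) (at x within {1..M})"])
  then show ?thesis using assms by blast
qed

lemma continuous_E: "continuous_on {1..M} E"
proof -
  have "continuous_on {1..M} R"
    by (rule DERIV_continuous_on[OF deriv_R])
  then show ?thesis
    unfolding E_def[abs_def] using M k_pos by (auto intro!: continuous_intros)
qed

lemma deriv_flow_time:
  assumes x: "1 < x" "x < M"
  shows "(flow_time has_real_derivative 1 / \<phi> x) (at x)"
proof -
  have xM: "x \<in> {1..M}" using x by simp
  have R: "(R has_real_derivative 1 / (x * (sqrt (V x) + 1))) (at x)"
    using deriv_R[OF xM] x at_within_interior[of x "{1..M}"] by simp
  define A where "A = 1 / \<beta> * (1 / (x - 1)) + 1 / \<beta>' * (1 / (M - x))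
      - 1 / (k * (M + 2) * (2 * M + 1)) * (1 / (x + M + 1))"
  have "(flow_time has_real_derivative A + 1 / (x * (sqrt (V x) + 1))) (at x)"
  proof -
    have l: "((\<lambda>x. ln (p * x + q) / e) has_real_derivative 1 / e * (p / (p * x + q))) (at x)"
      if "p * x + q > 0" for p q e
    proof -
      have "((\<lambda>x. ln (p * x + q)) has_real_derivative 1 / (p * x + q) * p) (at x)"
        by (rule DERIV_chain2[where g="\<lambda>x. p * x + q", OF DERIV_ln_divide[OF that]]) (auto intro!: derivative_eq_intros)
      from DERIV_cdivide[OF this, of e] show ?thesis by (simp add: mult.commute)
    qed
    have l1: "((\<lambda>x. ln (x - 1) / \<beta>) has_real_derivative 1 / \<beta> * (1 / (x - 1))) (at x)"
      and l2: "((\<lambda>x. ln (M - x) / \<beta>') has_real_derivative - (1 / \<beta>' * (1 / (M - x)))) (at x)"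
      and l3: "((\<lambda>x. ln (x + M + 1) / (k * (M + 2) * (2 * M + 1))) has_real_derivative
        1 / (k * (M + 2) * (2 * M + 1)) * (1 / (x + M + 1))) (at x)"
      using l[of 1 "-1" \<beta>] l[of "-1" M \<beta>'] l[of 1 "M + 1" "k * (M + 2) * (2 * M + 1)"] x M
      by (simp_all add: add.assoc)
    show ?thesis
      unfolding flow_time_def[abs_def] E_def[abs_def] A_def
      by (rule DERIV_cong[OF DERIV_add[OF DERIV_diff[OF l1 l2] DERIV_diff[OF R l3]]]) simp
  qed
  moreover have "A = 1 / (k * ((x - 1) * (M - x) * (x + M + 1)))"
  proof -
    \<comment> \<open>Partial fractions for the cubic: a, b, d are the factors x - 1, M - x, x + M +
      1, and p = M + 2, q = M - 1, s = 2 M + 1 are the differences of the roots 1, M and - (M +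
      1).\<close>
    have pf: "1 / (k * (p * q)) * (1 / a) + 1 / (k * (s * q)) * (1 / b) - 1 / (k * p * s) * (1 / d)
        = 1 / (k * (a * b * d))"
      if nz: "p \<noteq> 0" "q \<noteq> 0" "s \<noteq> 0" "a \<noteq> 0" "b \<noteq> 0" "d \<noteq> 0"
        and e: "b = q - a" "d = p + a" "s = p + q" for p q s a b d
    proof -
      have num: "s * b * d + p * a * d - q * a * b = p * q * s"
        unfolding e by (simp add: algebra_simps)
      have "X / (k * X * Y) = 1 / (k * Y)" if "X \<noteq> 0" for X Y using that by simp
      then have "(s * b * d + p * a * d - q * a * b) / (k * (p * q * s) * (a * b * d)) = 1 / (k * (a * b * d))"
        unfolding num using nz by (metis mult_eq_0_iff)
      moreover have "s * b * d / (k * (p * q * s) * (a * b * d)) = 1 / (k * (p * q)) * (1 / a)"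
        "p * a * d / (k * (p * q * s) * (a * b * d)) = 1 / (k * (s * q)) * (1 / b)"
        "q * a * b / (k * (p * q * s) * (a * b * d)) = 1 / (k * p * s) * (1 / d)"
        using nz by simp_all
      ultimately show ?thesis by (simp only: add_divide_distrib diff_divide_distrib)
    qed
    show ?thesis unfolding A_def \<beta>'_k by (subst \<beta>_k, rule pf) (use x M in auto)
  qed
  moreover have "1 / (k * ((x - 1) * (M - x) * (x + M + 1))) + 1 / (x * (sqrt (V x) + 1)) = 1 / \<phi> x"
  proof -
    \<comment> \<open>With u = sqrt V - 1 one has q = x u (u + 2) / 2 and \<phi> = x u, so the claim
      becomes 2 / (x u (u + 2)) + 1 / (x (u + 2)) = 1 / (x u).\<close>
    define q where "q = k * ((x - 1) * (M - x) * (x + M + 1))"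
    define u where "u = sqrt (V x) - 1"
    have u: "u > 0" "sqrt (V x) = u + 1" using V_gt_1[OF x] by (auto simp: u_def)
    have "(u + 1)\<^sup>2 = V x" using V_gt_1[OF x] by (simp add: u_def)
    then have "x * ((u + 1)\<^sup>2 - 1) = 2 * q"
      using x by (simp add: q_def profile_square_def)
    then have q: "q = x * (u + 2) * u / 2" by (simp add: algebra_simps power2_eq_square)
    have "1 / (x * w * u / 2) + 1 / (x * w) = 1 / (x * u)" if "w > 0" "w = 2 + u" for w
    proof -
      have "1 / (x * w * u / 2) + 1 / (x * w) = (2 + u) / (x * w * u)"
        using that(1) u(1) x by (simp add: field_simps)
      also have "\<dots> = 1 / (x * u)" using that u(1) x by simp
      finally show ?thesis .
    qed
    from this[of "u + 2"] show ?thesis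
      unfolding q_def[symmetric] conical_profile_def u(2) q using u(1) by (simp add: add.assoc)
  qed
  ultimately show ?thesis by simp
qed

lemma bound_on_compact:
  assumes "continuous_on {a..b} (g :: real \<Rightarrow> real)"
  obtains B where "\<And>x. x \<in> {a..b} \<Longrightarrow> \<bar>g x\<bar> \<le> B"
proof -
  have "bounded (g ` {a..b})"
    using compact_continuous_image[OF assms] compact_imp_bounded by simp
  then obtain B where "\<forall>x\<in>{a..b}. \<bar>g x\<bar> \<le> B" by (auto simp: bounded_iff)
  then show thesis using that by blast
qed

text \<open>The logarithms tend to minus infinity at 1 and to infinity at M, while \<open>E\<close>
  is bounded by its continuity on the closed interval; the intermediate value theorem gives every
  time.\<close>

lemma flow_time_surj: "\<exists>x. 1 < x \<and> x < M \<and> flow_time x = s"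
proof -
  obtain B where B: "\<And>x. x \<in> {1..M} \<Longrightarrow> \<bar>E x\<bar> \<le> B"
    using bound_on_compact[OF continuous_E] by blast
  have l: "filterlim (\<lambda>x. ln (x - 1) / \<beta> - ln (M - x) / \<beta>') at_bot (at_right 1)"
    using \<beta> \<beta>'_gt M by real_asymp
  have r: "filterlim (\<lambda>x. ln (x - 1) / \<beta> - ln (M - x) / \<beta>') at_top (at_left M)"
    using \<beta> \<beta>'_gt M by real_asymp
  have "eventually (\<lambda>x. ln (x - 1) / \<beta> - ln (M - x) / \<beta>' \<le> s - B \<and> x \<in> {1<..<M}) (at_right 1)"
    using l M eventually_at_right_real[of 1 M] by (auto simp: filterlim_at_bot eventually_conj_iff)
  then obtain x1 where x1: "ln (x1 - 1) / \<beta> - ln (M - x1) / \<beta>' \<le> s - B" "x1 \<in> {1<..<M}"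
    by (metis (mono_tags, lifting) eventually_happens trivial_limit_at_right_real)
  have "eventually (\<lambda>x. ln (x - 1) / \<beta> - ln (M - x) / \<beta>' \<ge> s + B \<and> x \<in> {1<..<M}) (at_left M)"
    using r M eventually_at_left_real[of 1 M] by (auto simp: filterlim_at_top eventually_conj_iff)
  then obtain x2 where x2: "ln (x2 - 1) / \<beta> - ln (M - x2) / \<beta>' \<ge> s + B" "x2 \<in> {1<..<M}"
    by (metis (mono_tags, lifting) eventually_happens trivial_limit_at_left_real)
  have f1: "flow_time x1 \<le> s" and f2: "s \<le> flow_time x2"
    using x1 x2 B[of x1] B[of x2] by (auto simp: flow_time_def)
  have cont: "isCont flow_time x" if "1 < x" "x < M" for x
    using DERIV_isCont[OF deriv_flow_time[OF that]] .
  show ?thesis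
  \<comment> \<open>The two points come from separate limits, so their order is not known at this
    stage.\<close>
  proof (cases "x1 \<le> x2")
    case True
    obtain x where "x1 \<le> x" "x \<le> x2" "flow_time x = s"
      using IVT[of flow_time x1 s x2, OF f1 f2 True] cont x1(2) x2(2) by auto
    then show ?thesis using x1(2) x2(2) by (intro exI[of _ x]) auto
  next
    case False
    then obtain x where "x2 \<le> x" "x \<le> x1" "flow_time x = s"
      using IVT2[of flow_time x1 s x2, OF f1 f2] cont x1(2) x2(2) by auto
    then show ?thesis using x1(2) x2(2) by (intro exI[of _ x]) auto
  qed
qed

lemma flow_time_strict_mono:
  assumes "1 < x" "x < y" "y < M"
  shows "flow_time x < flow_time y"
proof (rule DERIV_pos_imp_increasing[OF assms(2)])
  fix z assume "x \<le> z" "z \<le> y"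
  then have z: "1 < z" "z < M" using assms by auto
  show "\<exists>d. (flow_time has_real_derivative d) (at z) \<and> 0 < d"
    using deriv_flow_time[OF z] \<phi>_pos[OF z] by (intro exI[of _ "1 / \<phi> z"]) simp
qed

lemma flow_time_inj:
  assumes "1 < x" "x < M" "1 < y" "y < M" "flow_time x = flow_time y"
  shows "x = y"
  using assms flow_time_strict_mono[of x y] flow_time_strict_mono[of y x] by (cases x y rule: linorder_cases) auto

section \<open>The flow as the inverse of the time function\<close>

definition "\<gamma> s = (THE x. 1 < x \<and> x < M \<and> flow_time x = s)" for s

lemma \<gamma>: "1 < \<gamma> s" "\<gamma> s < M" "flow_time (\<gamma> s) = s"
proof -
  have "\<exists>!x. 1 < x \<and> x < M \<and> flow_time x = s"
    using flow_time_surj[of s] flow_time_inj by blast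
  from theI'[OF this] show "1 < \<gamma> s" "\<gamma> s < M" "flow_time (\<gamma> s) = s"
    by (auto simp: \<gamma>_def)
qed

lemma \<gamma>_flow_time: "1 < x \<Longrightarrow> x < M \<Longrightarrow> \<gamma> (flow_time x) = x"
  using \<gamma>[of "flow_time x"] flow_time_inj by blast

lemma \<gamma>_strict_mono: "s < t \<Longrightarrow> \<gamma> s < \<gamma> t"
  using \<gamma>[of s] \<gamma>[of t] flow_time_strict_mono[of "\<gamma> t" "\<gamma> s"] by (cases "\<gamma> s" "\<gamma> t" rule: linorder_cases) auto

lemma deriv_\<gamma>: "(\<gamma> has_real_derivative \<phi> (\<gamma> s)) (at s)"
proof -
  let ?x = "\<gamma> s"
  \<comment> \<open>Half the distance to the nearer end, so that the closed interval of radius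
    \<open>d\<close> stays inside (1, M), where \<open>\<gamma>\<close> inverts
    \<open>flow_time\<close>.\<close>
  define d where "d = min (?x - 1) (M - ?x) / 2"
  have d0: "2 * d \<le> ?x - 1" "2 * d \<le> M - ?x" by (simp_all add: d_def)
  have d1: "d > 0" using \<gamma>[of s] by (simp add: d_def)
  have d2: "1 < z \<and> z < M" if "\<bar>z - ?x\<bar> \<le> d" for z
    using that d0 d1 by (auto simp: abs_le_iff)
  have "isCont \<gamma> (flow_time ?x)"
    by (rule isCont_inverse_function[OF d1])
      (use d2 \<gamma>_flow_time deriv_flow_time DERIV_isCont in blast)+
  then have "isCont \<gamma> s" by (simp add: \<gamma>)
  have "(\<gamma> has_real_derivative inverse (1 / \<phi> ?x)) (at s)"
    by (rule DERIV_inverse_function[where g=\<gamma> and x=s, OF deriv_flow_time[OF \<gamma>(1,2)], of "s - 1" "s + 1"])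
      (use \<phi>_pos[OF \<gamma>(1,2), of s] \<gamma>(3) \<open>isCont \<gamma> s\<close> in auto)
  then show ?thesis by simp
qed

lemma \<gamma>_at_bot: "(\<gamma> \<longlongrightarrow> 1) at_bot"
proof (rule order_tendstoI)
  show "eventually (\<lambda>s. a < \<gamma> s) at_bot" if "a < 1" for a
    using less_trans[OF that \<gamma>(1)] by simp
  fix a :: real assume "a > 1"
  \<comment> \<open>The midpoint keeps the threshold inside (1, M) also when \<open>a\<close> lies
    beyond M.\<close>
  then have b: "1 < min a ((1 + M) / 2)" "min a ((1 + M) / 2) < M"
    using M by (auto simp: min_less_iff_disj less_max_iff_disj)
  have "\<gamma> s < a" if "s < flow_time (min a ((1 + M) / 2))" for s
    using \<gamma>_strict_mono[OF that] unfolding \<gamma>_flow_time[OF b] by simp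
  then show "eventually (\<lambda>s. \<gamma> s < a) at_bot"
    unfolding eventually_at_bot_dense by blast
qed

lemma \<gamma>_at_top: "(\<gamma> \<longlongrightarrow> M) at_top"
proof (rule order_tendstoI)
  show "eventually (\<lambda>s. \<gamma> s < a) at_top" if "M < a" for a
    using less_trans[OF \<gamma>(2) that] by simp
  fix a :: real assume "a < M"
  then have b: "1 < max a ((1 + M) / 2)" "max a ((1 + M) / 2) < M"
    using M by (auto simp: min_less_iff_disj less_max_iff_disj)
  have "a < \<gamma> s" if "flow_time (max a ((1 + M) / 2)) < s" for s
    using \<gamma>_strict_mono[OF that] unfolding \<gamma>_flow_time[OF b] by simp
  then show "eventually (\<lambda>s. a < \<gamma> s) at_top"
    unfolding eventually_at_top_dense by blast
qed

text \<open>Bootstrapping: \<gamma>' = \<phi>(\<gamma>), so each order of differentiability of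
  \<gamma> gives the next.\<close>

lemma smooth_\<gamma>: "smooth_on UNIV \<gamma>"
  unfolding smooth_on_def
proof
  fix k show "Ck_on k UNIV \<gamma>"
  proof (induction k)
    case 0
    then show ?case
      by (auto intro!: continuous_at_imp_continuous_on DERIV_isCont[OF deriv_\<gamma>])
  next
    case (Suc k)
    have "Ck_on k UNIV (\<lambda>s. \<phi> (\<gamma> s))"
      by (rule Ck_on_compose[OF _ open_T _ _ Suc])
        (use smooth_\<phi> subset_T \<gamma> in \<open>auto simp: smooth_on_def less_imp_le intro!: subsetD[OF subset_T]\<close>)
    then show ?case by (intro Ck_on_real_SucI[OF _ deriv_\<gamma>]) auto
  qed
qed

lemma ln_\<phi>:
  assumes "1 < x" "x < M"
  shows "ln (\<phi> x) = ln (x - 1) + ln (M - x) + ln (2 * k * (x + M + 1) / (sqrt (V x) + 1))"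
proof -
  define Y where "Y = 2 * k * (x + M + 1) / (sqrt (V x) + 1)"
  have "\<phi> x = (x - 1) * (M - x) * Y"
    using \<phi>_factor[of x] assms by (simp add: Y_def mult_ac)
  moreover have "Y > 0"
    unfolding Y_def
    using assms k_pos V_gt_1[OF assms] by (intro divide_pos_pos mult_pos_pos add_pos_pos) auto
  ultimately show ?thesis using assms unfolding Y_def[symmetric] by (simp add: ln_mult)
qed

lemma continuous_ln_factor: "continuous_on {1..M} (\<lambda>x. ln (2 * k * (x + M + 1) / (sqrt (V x) + 1)))"
proof (intro continuous_intros smooth_on_continuous[OF smooth_on_subset[OF smooth_V]])
  show "\<forall>x\<in>{1..M}. sqrt (V x) + 1 \<noteq> 0" "{1..M} \<subseteq> {0<..}"
    using denominator_pos by force+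
  show "\<forall>x\<in>{1..M}. 2 * k * (x + M + 1) / (sqrt (V x) + 1) \<noteq> 0"
    using denominator_pos k_pos M by force
qed

lemma exp_bounds:
  assumes "\<bar>ln y - z\<bar> \<le> B" "y > (0::real)"
  shows "exp (- B) * exp z \<le> y" "y \<le> exp B * exp z"
proof -
  have "exp (- B + z) \<le> exp (ln y)" "exp (ln y) \<le> exp (B + z)" using assms(1) by auto
  then show "exp (- B) * exp z \<le> y" "y \<le> exp B * exp z"
    unfolding exp_add exp_ln[OF assms(2)] by auto
qed

text \<open>In ln \<phi>(x) - \<beta> \<open>flow_time x\<close> the singular terms ln(x - 1)
  cancel, since \<open>flow_time\<close> has coefficient 1 / \<beta> there. The remainder
  \<open>G\<close> is continuous on [1, \<gamma>(s1)], an interval away from M, hence bounded. At M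
  the same cancellation takes place with \<beta>' and ln(M - x).\<close>

lemma \<phi>_\<gamma>_at_bot:
  "\<exists>c1>0. \<exists>c2>0. \<forall>s\<le>s1. c1 * exp (\<beta> * s) \<le> \<phi> (\<gamma> s) \<and> \<phi> (\<gamma> s) \<le> c2 * exp (\<beta> * s)"
proof -
  define G where "G = (\<lambda>x. (1 + \<beta> / \<beta>') * ln (M - x)
      + ln (2 * k * (x + M + 1) / (sqrt (V x) + 1)) - \<beta> * E x)"
  have "continuous_on {1..\<gamma> s1} G"
    unfolding G_def using \<gamma>(2)[of s1]
    by (intro continuous_intros continuous_on_subset[OF continuous_ln_factor]
        continuous_on_subset[OF continuous_E]) auto
  then obtain B where B: "\<And>x. x \<in> {1..\<gamma> s1} \<Longrightarrow> \<bar>G x\<bar> \<le> B"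
    using bound_on_compact by blast
  have "\<bar>ln (\<phi> (\<gamma> s)) - \<beta> * s\<bar> \<le> B" if "s \<le> s1" for s
  proof -
    have "\<gamma> s \<le> \<gamma> s1" using \<gamma>_strict_mono[of s s1] that by (cases "s = s1") auto
    then have "\<bar>G (\<gamma> s)\<bar> \<le> B" using \<gamma>(1)[of s] by (intro B) auto
    moreover have "G (\<gamma> s) = ln (\<phi> (\<gamma> s)) - \<beta> * flow_time (\<gamma> s)"
      unfolding ln_\<phi>[OF \<gamma>(1,2)] G_def flow_time_def using \<beta> by (simp add: algebra_simps)
    ultimately show ?thesis by (simp add: \<gamma>(3))
  qed
  from exp_bounds[OF this \<phi>_pos[OF \<gamma>(1,2)]] show ?thesis
    by (intro exI[of _ "exp (- B)"] exI[of _ "exp B"] conjI) auto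
qed

lemma \<phi>_\<gamma>_at_top:
  "\<exists>c1>0. \<exists>c2>0. \<forall>s\<ge>s1. c1 * exp (- \<beta>' * s) \<le> \<phi> (\<gamma> s) \<and> \<phi> (\<gamma> s) \<le> c2 * exp (- \<beta>' * s)"
proof -
  define G where "G = (\<lambda>x. (1 + \<beta>' / \<beta>) * ln (x - 1)
      + ln (2 * k * (x + M + 1) / (sqrt (V x) + 1)) + \<beta>' * E x)"
  have "continuous_on {\<gamma> s1..M} G"
    unfolding G_def using \<gamma>(1)[of s1]
    by (intro continuous_intros continuous_on_subset[OF continuous_ln_factor]
        continuous_on_subset[OF continuous_E]) auto
  then obtain B where B: "\<And>x. x \<in> {\<gamma> s1..M} \<Longrightarrow> \<bar>G x\<bar> \<le> B"
    using bound_on_compact by blast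
  have "\<bar>ln (\<phi> (\<gamma> s)) - (- \<beta>' * s)\<bar> \<le> B" if "s \<ge> s1" for s
  proof -
    have "\<gamma> s1 \<le> \<gamma> s" using \<gamma>_strict_mono[of s1 s] that by (cases "s = s1") auto
    then have "\<bar>G (\<gamma> s)\<bar> \<le> B" using \<gamma>(2)[of s] by (intro B) auto
    moreover have "G (\<gamma> s) = ln (\<phi> (\<gamma> s)) + \<beta>' * flow_time (\<gamma> s)"
      unfolding ln_\<phi>[OF \<gamma>(1,2)] G_def flow_time_def using \<beta>'_gt by (simp add: algebra_simps)
    ultimately show ?thesis by (simp add: \<gamma>(3))
  qed
  from exp_bounds[OF this \<phi>_pos[OF \<gamma>(1,2)]] show ?thesis
    by (intro exI[of _ "exp (- B)"] exI[of _ "exp B"] conjI) auto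
qed

end

lemma antiderivative_on_reals:
  assumes "continuous_on UNIV (g :: real \<Rightarrow> real)"
  shows "\<exists>f. \<forall>x. (f has_real_derivative g x) (at x)"
proof -
  have "((\<lambda>u. LBINT y=0..u. g y) has_real_derivative g x) (at x)" for x
  proof -
    let ?a = "- \<bar>x\<bar> - 1" and ?b = "\<bar>x\<bar> + 1"
    have "((\<lambda>u. LBINT y=0..u. g y) has_vector_derivative g x) (at x within {?a..?b})"
      using interval_integral_FTC2[of ?a 0 ?b g x] continuous_on_subset[OF assms]
      by (auto simp: zero_ereal_def)
    moreover have "at x within {?a..?b} = at x" by (rule at_within_interior) auto
    ultimately show ?thesis by (simp add: has_real_derivative_iff_has_vector_derivative)
  qed
  then show ?thesis by blast
qed

section \<open>Charts of the ruled surface\<close>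

lemma has_derivative_vector_2:
  assumes "has_wirt A p1 p2 0 0 x" "has_wirt B r1 r2 0 0 x"
  shows "((\<lambda>y. vector [A y, B y] :: complex^2) has_derivative
    (\<lambda>v. vector [p1 * v $ 1 + p2 * v $ 2, r1 * v $ 1 + r2 * v $ 2])) (at x)"
proof -
  have vec: "vector [y, z] = axis 1 y + (axis 2 z :: complex^2)" for y z
    by (simp add: vec_eq_iff forall_2 axis_def)
  have bl: "bounded_linear (axis i :: complex \<Rightarrow> complex^2)" for i
    unfolding linear_conv_bounded_linear[symmetric]
    by (rule linearI) (auto simp: axis_def vec_eq_iff)
  show ?thesis
    unfolding vec
    using has_derivative_add[OF bounded_linear.has_derivative[OF bl assms(1)[unfolded has_wirt_def]]
        bounded_linear.has_derivative[OF bl assms(2)[unfolded has_wirt_def]]]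
    by simp
qed

lemma holomorphic_map_on_cong:
  assumes "open N" "holomorphic_map_on N F" "\<And>x. x \<in> N \<Longrightarrow> G x = F x"
  shows "holomorphic_map_on N G"
  unfolding holomorphic_map_on_def
proof
  fix x assume x: "x \<in> N"
  then obtain D where D: "(F has_derivative D) (at x)" "\<forall>c v. D (c *s v) = c *s D v"
    using assms(2) unfolding holomorphic_map_on_def by blast
  have "(G has_derivative D) (at x)"
    by (rule has_derivative_transform_within_open[OF D(1) assms(1) x]) (simp add: assms(3))
  with D(2) show "\<exists>D. (G has_derivative D) (at x) \<and> (\<forall>c v. D (c *s v) = c *s D v)" by blast
qed

section \<open>The base surface, the gluing functions and lines in the fibres\<close>

locale calabi_surface =
  fixes S :: "('a, 'i) surface" and L :: "('a, 'i, 'e) line_bundle"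
    and \<rho> h :: "'i \<Rightarrow> complex \<Rightarrow> real"
  assumes base: "calabi_base S \<rho> L h"
begin

abbreviation "X \<equiv> ruled_surface S L"
abbreviation "D0 \<equiv> zero_divisor S L"
abbreviation "Dinf \<equiv> infinity_divisor S L"
abbreviation "pr q \<equiv> prj L (lvec q)"
abbreviation "chart_set i \<equiv> zc S i ` nbh S i"

lemma base_parts: "compact_riemann_surface S" "kahler_form S \<rho>" "holomorphic_line_bundle S L"
  "hermitian_metric S L h"
  "\<And>i x. i \<in> idx S \<Longrightarrow> x \<in> chart_set i \<Longrightarrow> curvature_density (\<rho> i) x = - 2 * \<rho> i x"
  "\<And>i x. i \<in> idx S \<Longrightarrow> x \<in> chart_set i \<Longrightarrow> curvature_density (h i) x = - \<rho> i x"
  using base unfolding calabi_base_def by auto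

text \<open>The total area 2 pi excludes an empty surface. Uniqueness needs an actual chart in which
  the curvature equation can be read.\<close>

lemma nonempty: obtains i q where "i \<in> idx S" "q \<in> nbh S i"
proof -
  have "has_surface_integral S \<rho> (2 * pi)" using base by (simp add: calabi_base_def)
  then obtain J P where JP: "J \<subseteq> idx S" "\<forall>i\<in>J. P i \<subseteq> nbh S i"
      "2 * pi = (\<Sum>i\<in>J. set_lebesgue_integral lborel (zc S i ` P i) (\<lambda>x. 2 * \<rho> i x))"
    unfolding has_surface_integral_def by blast
  have "\<exists>i\<in>J. P i \<noteq> {}"
  proof (rule ccontr)
    assume "\<not> (\<exists>i\<in>J. P i \<noteq> {})"
    then have "2 * pi = 0" using JP(3) by (simp add: set_lebesgue_integral_def)
    then show False by simp
  qed
  then show thesis using JP that by blast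
qed

lemma open_chart_set: "i \<in> idx S \<Longrightarrow> open (chart_set i)"
  using base_parts(1) by (simp add: compact_riemann_surface_def)

lemma chart_homeo:
  assumes "i \<in> idx S"
  shows "homeomorphic_map (subtopology (spc S) (nbh S i)) (top_of_set (chart_set i)) (zc S i)"
    and "openin (spc S) (nbh S i)"
  using base_parts(1) assms by (auto simp: compact_riemann_surface_def)

lemma inj_zc: "i \<in> idx S \<Longrightarrow> inj_on (zc S i) (nbh S i)"
  using homeomorphic_imp_injective_map[OF chart_homeo(1)] openin_subset[OF chart_homeo(2)]
  by (simp add: inf.absorb2)

definition "ov i j = zc S i ` (nbh S i \<inter> nbh S j)"

lemma open_ov:
  assumes "i \<in> idx S" "j \<in> idx S"
  shows "open (ov i j)"
proof -
  have "openin (subtopology (spc S) (nbh S i)) (nbh S i \<inter> nbh S j)"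
    using openin_subtopology_Int2[OF chart_homeo(2)[OF assms(2)]] .
  then have "openin (top_of_set (chart_set i)) (ov i j)"
    unfolding ov_def using homeomorphic_imp_open_map[OF chart_homeo(1)[OF assms(1)]]
    by (simp add: open_map_def)
  then show ?thesis using open_chart_set[OF assms(1)] openin_open_eq by blast
qed

lemma transition_zc: "i \<in> idx S \<Longrightarrow> q \<in> nbh S i \<Longrightarrow> transition S i j (zc S i q) = zc S j q"
  by (simp add: transition_def inj_zc)

lemma deriv_transition:
  assumes "i \<in> idx S" "j \<in> idx S" "z \<in> ov i j"
  shows "(transition S i j has_field_derivative deriv (transition S i j) z) (at z)"
proof -
  have "transition S i j holomorphic_on ov i j"
    using base_parts(1) assms by (auto simp: compact_riemann_surface_def ov_def)
  then show ?thesis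
    using assms open_ov[OF assms(1,2)] holomorphic_derivI by blast
qed

text \<open>The cocycle of the line bundle, fixed by choice because
  \<open>holomorphic_line_bundle\<close> only asserts its existence.\<close>

definition "glue i j = (SOME g. g holomorphic_on ov i j \<and>
  (\<forall>v\<in>tot L. prj L v \<in> nbh S i \<inter> nbh S j \<longrightarrow> triv L j v = g (zc S i (prj L v)) * triv L i v))"

lemma glue:
  assumes "i \<in> idx S" "j \<in> idx S"
  shows "glue i j holomorphic_on ov i j"
    "\<And>v. v \<in> tot L \<Longrightarrow> prj L v \<in> nbh S i \<Longrightarrow> prj L v \<in> nbh S j
      \<Longrightarrow> triv L j v = glue i j (zc S i (prj L v)) * triv L i v"
proof -
  have "\<exists>g. g holomorphic_on ov i j \<and>
      (\<forall>v\<in>tot L. prj L v \<in> nbh S i \<inter> nbh S j \<longrightarrow> triv L j v = g (zc S i (prj L v)) * triv L i v)"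
    using base_parts(3) assms unfolding holomorphic_line_bundle_def ov_def by blast
  from someI_ex[OF this] show "glue i j holomorphic_on ov i j"
    "\<And>v. v \<in> tot L \<Longrightarrow> prj L v \<in> nbh S i \<Longrightarrow> prj L v \<in> nbh S j
      \<Longrightarrow> triv L j v = glue i j (zc S i (prj L v)) * triv L i v"
    unfolding glue_def by blast+
qed

lemma vector_over:
  assumes "i \<in> idx S" "q \<in> nbh S i"
  obtains v where "v \<in> tot L" "prj L v = q" "triv L i v = w"
proof -
  have "bij_betw (triv L i) {v\<in>tot L. prj L v = q} UNIV"
    using base_parts(3) assms by (simp add: holomorphic_line_bundle_def)
  then have "w \<in> triv L i ` {v\<in>tot L. prj L v = q}" by (simp add: bij_betw_def)
  then show thesis using that by auto
qed

text \<open>Fibre coordinates are onto: some vector has coordinate 1 in chart \<open>j\<close>, and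
  a vanishing cocycle would make it 0.\<close>

lemma glue_nz:
  assumes "i \<in> idx S" "j \<in> idx S" "z \<in> ov i j"
  shows "glue i j z \<noteq> 0"
proof -
  obtain q where q: "q \<in> nbh S i" "q \<in> nbh S j" "z = zc S i q" using assms(3) by (auto simp: ov_def)
  obtain v where "v \<in> tot L" "prj L v = q" "triv L j v = 1" using vector_over[OF assms(2) q(2)] .
  then show ?thesis using glue(2)[OF assms(1,2), of v] q by auto
qed

lemma is_zero_iff:
  assumes "v \<in> tot L" "i \<in> idx S" "prj L v \<in> nbh S i"
  shows "is_zero S L v \<longleftrightarrow> triv L i v = 0"
  using assms glue(2) unfolding is_zero_def by (metis mult_zero_right)

lemma prj_in_chart:
  assumes "v \<in> tot L"
  obtains i where "i \<in> idx S" "prj L v \<in> nbh S i"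
proof -
  have "prj L v \<in> topspace (spc S)" using base_parts(3) assms by (auto simp: holomorphic_line_bundle_def)
  then show thesis using base_parts(1) that unfolding compact_riemann_surface_def by blast
qed

lemma line_of_scale:
  assumes "v \<in> tot L" "v' \<in> tot L" "prj L v' = prj L v" "c \<noteq> 0" "t' = c * t"
    "\<And>i. i \<in> idx S \<Longrightarrow> prj L v \<in> nbh S i \<Longrightarrow> triv L i v' = c * triv L i v"
  shows "line_of S L v' t' = line_of S L v t"
proof -
  have sub: "line_of S L v' t' \<subseteq> line_of S L v t"
    if sc: "v \<in> tot L" "v' \<in> tot L" "prj L v' = prj L v" "c \<noteq> 0" "t' = c * t"
    "\<And>i. i \<in> idx S \<Longrightarrow> prj L v \<in> nbh S i \<Longrightarrow> triv L i v' = c * triv L i v" for v v' c t t'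
  proof (rule subrelI)
    fix u s assume "(u, s) \<in> line_of S L v' t'"
    then obtain d where d: "u \<in> tot L" "prj L u = prj L v'" "d \<noteq> 0" "s = d * t'"
      "\<And>i. i \<in> idx S \<Longrightarrow> prj L v' \<in> nbh S i \<Longrightarrow> triv L i u = d * triv L i v'"
      unfolding line_of_def by blast
    have "triv L i u = d * c * triv L i v" if "i \<in> idx S" "prj L v \<in> nbh S i" for i
      using d(5)[of i] sc(6)[of i] that sc(3) by simp
    then show "(u, s) \<in> line_of S L v t"
      using d(1-4) sc(3-5) unfolding line_of_def by (auto intro!: exI[of _ "d * c"])
  qed
  show ?thesis
  proof
    show "line_of S L v' t' \<subseteq> line_of S L v t" by (rule sub[OF assms])
    show "line_of S L v t \<subseteq> line_of S L v' t'"
      by (rule sub[of v' v "1 / c"]) (use assms in auto)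
  qed
qed

text \<open>\<open>lvec\<close> and \<open>lscal\<close> pick an arbitrary point of the line, known
  only up to a common nonzero factor. All later arguments use quantities in which this factor
  \<open>c\<close> drops out.\<close>

lemma line_of_representative:
  fixes t :: complex
  assumes "v \<in> tot L" "q = line_of S L v t"
  shows "\<exists>c. c \<noteq> 0 \<and> lvec q \<in> tot L \<and> pr q = prj L v \<and> lscal q = c * t \<and>
    (\<forall>i\<in>idx S. prj L v \<in> nbh S i \<longrightarrow> triv L i (lvec q) = c * triv L i v) \<and>
    line_of S L (lvec q) (lscal q) = q"
proof -
  have "(v, t) \<in> q" using assms unfolding line_of_def by (auto intro!: exI[of _ 1])
  then have "(lvec q, lscal q) \<in> q" unfolding lvec_def lscal_def by (metis prod.collapse someI)
  then obtain c where c: "c \<noteq> 0" "lvec q \<in> tot L" "pr q = prj L v" "lscal q = c * t"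
    "\<forall>i\<in>idx S. prj L v \<in> nbh S i \<longrightarrow> triv L i (lvec q) = c * triv L i v"
    unfolding assms(2) line_of_def by blast
  have "line_of S L (lvec q) (lscal q) = line_of S L v t"
    by (rule line_of_scale[OF assms(1) c(2,3,1,4)]) (use c(5) in blast)
  then show ?thesis using c unfolding assms(2) by blast
qed

lemma linesE:
  assumes "q \<in> lines S L"
  shows "lvec q \<in> tot L" "line_of S L (lvec q) (lscal q) = q"
    "\<And>i. i \<in> idx S \<Longrightarrow> pr q \<in> nbh S i \<Longrightarrow> triv L i (lvec q) \<noteq> 0 \<or> lscal q \<noteq> 0"
proof -
  obtain v t where v: "q = line_of S L v t" "v \<in> tot L" "\<not> is_zero S L v \<or> t \<noteq> 0"
    using assms by (auto simp: lines_def)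
  obtain c where c: "c \<noteq> 0" "lvec q \<in> tot L" "pr q = prj L v" "lscal q = c * t"
    "\<forall>i\<in>idx S. prj L v \<in> nbh S i \<longrightarrow> triv L i (lvec q) = c * triv L i v"
    "line_of S L (lvec q) (lscal q) = q"
    using line_of_representative[OF v(2,1)] by blast
  show "lvec q \<in> tot L" "line_of S L (lvec q) (lscal q) = q" using c by auto
  show "triv L i (lvec q) \<noteq> 0 \<or> lscal q \<noteq> 0" if "i \<in> idx S" "pr q \<in> nbh S i" for i
    using that c v(3) is_zero_iff[OF v(2), of i] by auto
qed

section \<open>Coordinates and coordinate changes of the ruled surface\<close>

lemma crd_eq: "crd X (i, b) q = vector [zc S i (pr q),
    if b then lscal q / triv L i (lvec q) else triv L i (lvec q) / lscal q]"
  by (simp add: ruled_surface_def Let_def)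

lemma charts_eq: "charts X = idx S \<times> UNIV"
  by (simp add: ruled_surface_def)

lemma dom_iff:
  assumes "i \<in> idx S"
  shows "q \<in> dom X (i, b) \<longleftrightarrow> q \<in> lines S L \<and> pr q \<in> nbh S i \<and>
    (if b then triv L i (lvec q) \<noteq> 0 else lscal q \<noteq> 0)"
  using is_zero_iff[OF linesE(1) assms]
  by (auto simp: ruled_surface_def zero_divisor_def infinity_divisor_def)

text \<open>Equal quotients make the representatives proportional in the chart \<open>i\<close>; the
  cocycle carries the same factor to every other chart, so the lines coincide.\<close>

lemma inj_crd:
  assumes i: "i \<in> idx S"
  shows "inj_on (crd X (i, b)) (dom X (i, b))"
proof (rule inj_onI)
  fix q q' assume q: "q \<in> dom X (i, b)" "q' \<in> dom X (i, b)" and eq: "crd X (i, b) q = crd X (i, b) q'"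
  note d = q[unfolded dom_iff[OF i]]
  have ql: "q \<in> lines S L" "q' \<in> lines S L" using d by auto
  have "zc S i (pr q) = zc S i (pr q')"
    using arg_cong[OF eq, of "\<lambda>x. x $ 1"] by (simp add: crd_eq)
  then have pr: "pr q' = pr q" using inj_onD[OF inj_zc[OF i]] d by metis
  have e: "(if b then lscal q / triv L i (lvec q) else triv L i (lvec q) / lscal q)
      = (if b then lscal q' / triv L i (lvec q') else triv L i (lvec q') / lscal q')"
    using arg_cong[OF eq, of "\<lambda>x. x $ 2"] by (simp add: crd_eq)
  obtain c where c: "c \<noteq> 0" "lscal q' = c * lscal q" "triv L i (lvec q') = c * triv L i (lvec q)"
  proof (cases b)
    case True
    then have "lscal q' = triv L i (lvec q') / triv L i (lvec q) * lscal q"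
      using e d by (simp add: field_simps)
    then show ?thesis using True d that[of "triv L i (lvec q') / triv L i (lvec q)"] by simp
  next
    case False
    then have "triv L i (lvec q') = lscal q' / lscal q * triv L i (lvec q)"
      using e d by (simp add: field_simps)
    then show ?thesis using False d that[of "lscal q' / lscal q"] by simp
  qed
  have "triv L j (lvec q') = c * triv L j (lvec q)" if "j \<in> idx S" "pr q \<in> nbh S j" for j
    using glue(2)[OF i that(1) linesE(1)[OF ql(1)]] glue(2)[OF i that(1) linesE(1)[OF ql(2)]] pr that d c(3)
    by simp
  then have "line_of S L (lvec q') (lscal q') = line_of S L (lvec q) (lscal q)"
    by (intro line_of_scale[OF linesE(1)[OF ql(1)] linesE(1)[OF ql(2)] pr c(1,2)])
  then show "q = q'" using linesE(2) ql by simp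
qed

lemma crd_surj:
  assumes i: "i \<in> idx S" and x: "x $ 1 \<in> chart_set i"
  obtains q where "q \<in> dom X (i, b)" "crd X (i, b) q = x"
proof -
  obtain p where p: "p \<in> nbh S i" "x $ 1 = zc S i p" using x by auto
  \<comment> \<open>The representative is normalised so that the denominator of the fibre coordinate
    is 1.\<close>
  define w t where "w = (if b then 1 else x $ 2)" and "t = (if b then x $ 2 else 1)"
  obtain v where v: "v \<in> tot L" "prj L v = p" "triv L i v = w" using vector_over[OF i p(1)] .
  define q where "q = line_of S L v t"
  obtain c where c: "c \<noteq> 0" "lvec q \<in> tot L" "pr q = prj L v" "lscal q = c * t"
    "\<forall>i\<in>idx S. prj L v \<in> nbh S i \<longrightarrow> triv L i (lvec q) = c * triv L i v"
    "line_of S L (lvec q) (lscal q) = q"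
    using line_of_representative[OF v(1) q_def] by blast
  have tr: "triv L i (lvec q) = c * w" using c(5) i v p by simp
  have "\<not> is_zero S L v \<or> t \<noteq> 0"
    using is_zero_iff[OF v(1) i] v p by (auto simp: w_def t_def)
  then have "q \<in> lines S L" using v(1) by (auto simp: lines_def q_def)
  then have "q \<in> dom X (i, b)"
    using c tr v p by (auto simp: dom_iff[OF i] w_def t_def)
  moreover have "crd X (i, b) q = x"
    using c tr v p by (simp add: crd_eq vec_eq_iff forall_2 w_def t_def)
  ultimately show thesis using that by blast
qed

lemma crd_image:
  assumes "i \<in> idx S"
  shows "crd X (i, b) ` dom X (i, b) = {x. x $ 1 \<in> chart_set i}"
proof
  show "crd X (i, b) ` dom X (i, b) \<subseteq> {x. x $ 1 \<in> chart_set i}"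
    by (auto simp: crd_eq dom_iff[OF assms])
  show "{x. x $ 1 \<in> chart_set i} \<subseteq> crd X (i, b) ` dom X (i, b)"
    using crd_surj[OF assms] by (metis (mono_tags, lifting) image_eqI mem_Collect_eq subsetI)
qed

lemma divisor_iff:
  assumes "i \<in> idx S" "q \<in> dom X (i, b)"
  shows "q \<in> (if b then Dinf else D0) \<longleftrightarrow> crd X (i, b) q $ 2 = 0"
    "q \<notin> (if b then D0 else Dinf)"
  using assms(2) is_zero_iff[OF linesE(1) assms(1), of q]
  by (auto simp: dom_iff[OF assms(1)] crd_eq zero_divisor_def infinity_divisor_def)

lemma divisors_iff:
  assumes "i \<in> idx S" "q \<in> dom X (i, b)"
  shows "q \<in> D0 \<union> Dinf \<longleftrightarrow> crd X (i, b) q $ 2 = 0"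
  using divisor_iff[OF assms] by (auto split: if_splits)

definition punctured where "punctured i = {x::complex^2. x $ 1 \<in> chart_set i \<and> x $ 2 \<noteq> 0}"

lemma crd_image_off:
  assumes "i \<in> idx S"
  shows "crd X (i, b) ` (dom X (i, b) - (D0 \<union> Dinf)) = punctured i"
proof -
  have "crd X (i, b) ` (dom X (i, b) - (D0 \<union> Dinf)) = {x \<in> crd X (i, b) ` dom X (i, b). x $ 2 \<noteq> 0}"
    using divisors_iff[OF assms] by auto
  then show ?thesis by (auto simp: crd_image[OF assms] punctured_def)
qed

text \<open>If g is the cocycle, w' = g w; the four cases express w' or 1 / w' through w or 1 / w,
  the flags marking the inverted coordinate.\<close>

definition fibre_change :: "'i \<Rightarrow> bool \<Rightarrow> 'i \<Rightarrow> bool \<Rightarrow> complex^2 \<Rightarrow> complex" where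
  "fibre_change i b j c x =
     (if b = c then if b then x $ 2 / glue i j (x $ 1) else glue i j (x $ 1) * x $ 2
      else if b then glue i j (x $ 1) / x $ 2 else 1 / (glue i j (x $ 1) * x $ 2))"

definition change :: "'i \<Rightarrow> bool \<Rightarrow> 'i \<Rightarrow> bool \<Rightarrow> complex^2 \<Rightarrow> complex^2" where
  "change i b j c x = vector [transition S i j (x $ 1), fibre_change i b j c x]"

text \<open>Charts of different kind share only points off both divisors, hence the condition on the
  fibre coordinate.\<close>

definition overlap :: "'i \<Rightarrow> bool \<Rightarrow> 'i \<Rightarrow> bool \<Rightarrow> (complex^2) set" where
  "overlap i b j c = {x. x $ 1 \<in> ov i j \<and> (b \<noteq> c \<longrightarrow> x $ 2 \<noteq> 0)}"

lemma open_overlap: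
  assumes "i \<in> idx S" "j \<in> idx S"
  shows "open (overlap i b j c)"
proof -
  have "overlap i b j c = (\<lambda>x. x $ 1) -` ov i j \<inter> (if b = c then UNIV else (\<lambda>x. x $ 2) -` (- {0}))"
    by (auto simp: overlap_def)
  then show ?thesis
    using open_ov[OF assms] by (auto intro!: open_Int open_vimage continuous_intros)
qed

lemma change_crd:
  assumes "i \<in> idx S" "j \<in> idx S" "q \<in> dom X (i, b)" "q \<in> dom X (j, c)"
  shows "crd X (i, b) q \<in> overlap i b j c" "crd X (j, c) q = change i b j c (crd X (i, b) q)"
proof -
  note d = assms(3)[unfolded dom_iff[OF assms(1)]] assms(4)[unfolded dom_iff[OF assms(2)]]
  have g: "triv L j (lvec q) = glue i j (zc S i (pr q)) * triv L i (lvec q)"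
    using glue(2)[OF assms(1,2) linesE(1)] d by auto
  show "crd X (i, b) q \<in> overlap i b j c"
    using d g by (auto simp: overlap_def crd_eq ov_def)
  show "crd X (j, c) q = change i b j c (crd X (i, b) q)"
    using d g transition_zc[OF assms(1), of "pr q" j]
    by (simp add: crd_eq change_def fibre_change_def vec_eq_iff forall_2)
qed

lemma crd_image_overlap:
  assumes ij: "i \<in> idx S" "j \<in> idx S"
  shows "crd X (i, b) ` (dom X (i, b) \<inter> dom X (j, c)) = overlap i b j c"
proof
  show "crd X (i, b) ` (dom X (i, b) \<inter> dom X (j, c)) \<subseteq> overlap i b j c"
    using change_crd[OF ij] by auto
  show "overlap i b j c \<subseteq> crd X (i, b) ` (dom X (i, b) \<inter> dom X (j, c))"
  proof
    fix x assume x: "x \<in> overlap i b j c"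
    then obtain p where p: "p \<in> nbh S i" "p \<in> nbh S j" "x $ 1 = zc S i p"
      by (auto simp: overlap_def ov_def)
    then obtain q where q: "q \<in> dom X (i, b)" "crd X (i, b) q = x"
      using crd_surj[OF ij(1), of x] by blast
    note d = q(1)[unfolded dom_iff[OF ij(1)]]
    have "zc S i (pr q) = zc S i p" using p q(2) by (auto simp: crd_eq)
    then have pr: "pr q = p" using inj_onD[OF inj_zc[OF ij(1)]] d p by metis
    have g: "triv L j (lvec q) = glue i j (zc S i (pr q)) * triv L i (lvec q)"
      using glue(2)[OF ij linesE(1)] d pr p by auto
    have nz: "glue i j (zc S i (pr q)) \<noteq> 0" using glue_nz[OF ij] pr p by (auto simp: ov_def)
    have "b \<noteq> c \<longrightarrow> x $ 2 \<noteq> 0" using x by (simp add: overlap_def)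
    then have "q \<in> dom X (j, c)"
      using d g nz pr p unfolding dom_iff[OF ij(2)] q(2)[symmetric] crd_eq by (auto split: if_splits)
    with q show "x \<in> crd X (i, b) ` (dom X (i, b) \<inter> dom X (j, c))" by auto
  qed
qed

text \<open>All antiholomorphic coefficients vanish, so the differential is complex linear. Its
  first component involves dz alone because the change respects the projection;
  \<open>hform_change\<close> relies on this.\<close>

lemma change_derivative:
  assumes ij: "i \<in> idx S" "j \<in> idx S" and x: "x \<in> overlap i b j c"
  obtains D where "(change i b j c has_derivative D) (at x)" "\<And>k v. D (k *s v) = k *s D v"
    "\<And>v. D v $ 1 = deriv (transition S i j) (x $ 1) * v $ 1"
proof -
  have x1: "x $ 1 \<in> ov i j" and nz: "glue i j (x $ 1) \<noteq> 0"
    using x glue_nz[OF ij] by (auto simp: overlap_def)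
  let ?T = "deriv (transition S i j) (x $ 1)"
  have T: "has_wirt (\<lambda>y. transition S i j (y $ 1)) ?T 0 0 0 x"
    by (rule has_wirt_fst) (use deriv_transition[OF ij x1] in \<open>simp add: has_field_derivative_def\<close>)
  have G: "has_wirt (\<lambda>y. glue i j (y $ 1)) (deriv (glue i j) (x $ 1)) 0 0 0 x"
    by (rule has_wirt_fst)
      (use holomorphic_derivI[OF glue(1)[OF ij] open_ov[OF ij] x1] in \<open>simp add: has_field_derivative_def\<close>)
  obtain r1 r2 where F: "has_wirt (fibre_change i b j c) r1 r2 0 0 x"
  proof (cases "b = c")
    case True
    show ?thesis
    proof (cases b)
      case True
      have "has_wirt (\<lambda>y. y $ 2 / glue i j (y $ 1)) (- (x $ 2 * deriv (glue i j) (x $ 1)) / (glue i j (x $ 1))\<^sup>2)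
        (glue i j (x $ 1) / (glue i j (x $ 1))\<^sup>2) 0 0 x"
        by (rule has_wirt_eq[OF has_wirt_divide[OF has_wirt_snd G nz]]) auto
      then show ?thesis using that True \<open>b = c\<close> by (simp add: fibre_change_def[abs_def])
    next
      case False
      have "has_wirt (\<lambda>y. glue i j (y $ 1) * y $ 2) (deriv (glue i j) (x $ 1) * x $ 2) (glue i j (x $ 1)) 0 0 x"
        by (rule has_wirt_eq[OF has_wirt_mult[OF G has_wirt_snd]]) auto
      then show ?thesis using that False \<open>b = c\<close> by (simp add: fibre_change_def[abs_def])
    qed
  next
    case bc: False
    then have x2: "x $ 2 \<noteq> 0" using x by (simp add: overlap_def)
    show ?thesis
    proof (cases b)
      case True
      have "has_wirt (\<lambda>y. glue i j (y $ 1) / y $ 2) (deriv (glue i j) (x $ 1) * x $ 2 / (x $ 2)\<^sup>2)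
        (- glue i j (x $ 1) / (x $ 2)\<^sup>2) 0 0 x"
        by (rule has_wirt_eq[OF has_wirt_divide[OF G has_wirt_snd x2]]) auto
      then show ?thesis using that True bc by (simp add: fibre_change_def[abs_def])
    next
      case False
      have "has_wirt (\<lambda>y. 1 / (glue i j (y $ 1) * y $ 2))
        (- (deriv (glue i j) (x $ 1) * x $ 2) / (glue i j (x $ 1) * x $ 2)\<^sup>2)
        (- glue i j (x $ 1) / (glue i j (x $ 1) * x $ 2)\<^sup>2) 0 0 x"
        by (rule has_wirt_eq[OF has_wirt_divide[OF has_wirt_const has_wirt_mult[OF G has_wirt_snd]]])
          (use x2 nz in auto)
      then show ?thesis using that False bc by (simp add: fibre_change_def[abs_def])
    qed
  qed
  show thesis
  proof (rule that)
    show "(change i b j c has_derivative (\<lambda>v. vector [?T * v $ 1 + 0 * v $ 2, r1 * v $ 1 + r2 * v $ 2])) (at x)"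
      unfolding change_def[abs_def] by (rule has_derivative_vector_2[OF T F])
  qed (auto simp: vec_eq_iff forall_2 algebra_simps)
qed

lemma holomorphic_change:
  "i \<in> idx S \<Longrightarrow> j \<in> idx S \<Longrightarrow> holomorphic_map_on (overlap i b j c) (change i b j c)"
  unfolding holomorphic_map_on_def using change_derivative by metis

lemma continuous_change:
  "i \<in> idx S \<Longrightarrow> j \<in> idx S \<Longrightarrow> continuous_on (overlap i b j c) (change i b j c)"
  by (rule continuous_at_imp_continuous_on)
    (metis change_derivative has_derivative_continuous)

end

context calabi_surface
begin

section \<open>Restricted charts as holomorphic coordinates\<close>

lemma inv_crd:
  assumes "i \<in> idx S" "q \<in> dom X (i, b)"
  shows "inv_into (dom X (i, b)) (crd X (i, b)) (crd X (i, b) q) = q"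
  by (rule inv_into_f_f[OF inj_crd[OF assms(1)] assms(2)])

lemma crd_inv_crd:
  assumes ij: "i \<in> idx S" "j \<in> idx S" and x: "x \<in> overlap i b j c"
  shows "(crd X (j, c) \<circ> inv_into (dom X (i, b)) (crd X (i, b))) x = change i b j c x"
proof -
  obtain q where q: "q \<in> dom X (i, b)" "q \<in> dom X (j, c)" "x = crd X (i, b) q"
    using x crd_image_overlap[OF ij, of b c] by blast
  then show ?thesis using change_crd(2)[OF ij q(1,2)] inv_crd[OF ij(1) q(1)] by simp
qed

text \<open>Cone conditions are to be checked in small product neighbourhoods, that is, in a chart
  cut down to an open set \<open>B\<close>. Its image in any other chart is a preimage of
  \<open>B\<close> under \<open>change\<close>, which gives openness and holomorphy
  together.\<close>

lemma holomorphic_coordinates_chart: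
  assumes i: "i \<in> idx S" and B: "open B" "\<And>x. x \<in> B \<Longrightarrow> x $ 1 \<in> chart_set i"
  shows "holomorphic_coordinates X {q \<in> dom X (i, b). crd X (i, b) q \<in> B} (crd X (i, b))"
    (is "holomorphic_coordinates X ?V ?\<Psi>")
proof -
  have img: "crd X (j, c) ` (?V \<inter> dom X (j, c)) = {x \<in> overlap j c i b. change j c i b x \<in> B}"
    if j: "j \<in> idx S" for j c
  proof -
    have "crd X (j, c) ` (?V \<inter> dom X (j, c))
        = {x \<in> crd X (j, c) ` (dom X (j, c) \<inter> dom X (i, b)). change j c i b x \<in> B}"
      using change_crd(2)[OF j i] by auto
    then show ?thesis by (simp add: crd_image_overlap[OF j i])
  qed
  have op: "open (crd X (j, c) ` (?V \<inter> dom X (j, c)))" if j: "j \<in> idx S" for j c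
  proof -
    have "open (overlap j c i b \<inter> change j c i b -` B)"
      by (rule continuous_open_preimage[OF continuous_change[OF j i] open_overlap[OF j i] B(1)])
    then show ?thesis unfolding img[OF j] by (simp add: Int_def vimage_def)
  qed
  have "?V \<subseteq> points X"
    using i by (auto simp: points_def charts_eq intro!: bexI[of _ "(i, b)"])
  then have ao: "atlas_open X ?V" using op by (auto simp: atlas_open_def charts_eq)
  have inj: "inj_on ?\<Psi> ?V" by (rule inj_on_subset[OF inj_crd[OF i, of b]]) simp
  have VB: "?\<Psi> ` ?V = B"
  proof -
    have "?\<Psi> ` ?V = ?\<Psi> ` dom X (i, b) \<inter> B" by auto
    then show ?thesis using B(2) unfolding crd_image[OF i] by auto
  qed
  have h1: "holomorphic_map_on (crd X (j, c) ` (?V \<inter> dom X (j, c)))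
      (?\<Psi> \<circ> inv_into (dom X (j, c)) (crd X (j, c)))" if j: "j \<in> idx S" for j c
  proof (rule holomorphic_map_on_cong[where F="change j c i b", OF op[OF j]])
    show "holomorphic_map_on (crd X (j, c) ` (?V \<inter> dom X (j, c))) (change j c i b)"
      using holomorphic_change[OF j i] unfolding img[OF j] holomorphic_map_on_def by blast
    show "(?\<Psi> \<circ> inv_into (dom X (j, c)) (crd X (j, c))) x = change j c i b x"
      if "x \<in> crd X (j, c) ` (?V \<inter> dom X (j, c))" for x
      using crd_inv_crd[OF j i] that unfolding img[OF j] by blast
  qed
  have h2: "holomorphic_map_on (?\<Psi> ` (?V \<inter> dom X (j, c))) (crd X (j, c) \<circ> inv_into ?V ?\<Psi>)"
    if j: "j \<in> idx S" for j c
  proof -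
    have im: "?\<Psi> ` (?V \<inter> dom X (j, c)) = overlap i b j c \<inter> B"
      unfolding crd_image_overlap[OF i j, symmetric] by auto
    show ?thesis
    proof (rule holomorphic_map_on_cong[where F="change i b j c"])
      show "open (?\<Psi> ` (?V \<inter> dom X (j, c)))"
        unfolding im using open_overlap[OF i j] B(1) by blast
      show "holomorphic_map_on (?\<Psi> ` (?V \<inter> dom X (j, c))) (change i b j c)"
        using holomorphic_change[OF i j] unfolding im holomorphic_map_on_def by blast
      fix x assume "x \<in> ?\<Psi> ` (?V \<inter> dom X (j, c))"
      then obtain q where q: "q \<in> ?V" "q \<in> dom X (j, c)" "x = ?\<Psi> q" by blast
      then show "(crd X (j, c) \<circ> inv_into ?V ?\<Psi>) x = change i b j c x"
        using inv_into_f_f[OF inj q(1)] change_crd(2)[OF i j _ q(2)] by simp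
    qed
  qed
  show ?thesis
    unfolding holomorphic_coordinates_def
  proof (intro conjI ballI ao inj)
    show "open (?\<Psi> ` ?V)" unfolding VB by (rule B(1))
    fix k assume "k \<in> charts X"
    then obtain j c where k: "k = (j, c)" "j \<in> idx S" by (auto simp: charts_eq)
    show "holomorphic_map_on (crd X k ` (?V \<inter> dom X k)) (?\<Psi> \<circ> inv_into (dom X k) (crd X k))"
      "holomorphic_map_on (?\<Psi> ` (?V \<inter> dom X k)) (crd X k \<circ> inv_into ?V ?\<Psi>)"
      unfolding k(1) by (rule h1[OF k(2)], rule h2[OF k(2)])
  qed
qed

section \<open>The metric on the ruled surface\<close>

abbreviation "eps b \<equiv> (if b then - 1 else 1 :: real)"

lemma chart:
  assumes "i \<in> idx S" "smooth_on UNIV f"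
  shows "calabi_chart (chart_set i) (h i) (\<rho> i) (eps b) f"
proof
  note i = assms(1)
  show "open (chart_set i)" by (rule open_chart_set[OF i])
  show "smooth_on (chart_set i) (h i)" "smooth_on (chart_set i) (\<rho> i)"
    using base_parts(2,4) i unfolding hermitian_metric_def kahler_form_def by blast+
  fix z assume z: "z \<in> chart_set i"
  show "h i z > 0" "\<rho> i z > 0"
    using base_parts(2,4) i z unfolding hermitian_metric_def kahler_form_def by blast+
  show "curvature_density (h i) z = - \<rho> i z" "curvature_density (\<rho> i) z = - 2 * \<rho> i z"
    by (rule base_parts(6,5)[OF i z])+
qed (use assms(2) in auto)

text \<open>The function s is globally defined: evaluating both local norms on a vector with
  coordinate 1 in chart \<open>i\<close> gives h i = |g|^2 h j, which compensates the change of the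
  fibre coordinate.\<close>

lemma log_norm_change:
  assumes ij: "i \<in> idx S" "j \<in> idx S" and x: "x \<in> overlap i b j c" "x $ 2 \<noteq> 0"
  shows "log_norm h (j, c) (change i b j c x) = log_norm h (i, b) x"
proof -
  obtain p where p: "p \<in> nbh S i" "p \<in> nbh S j" "x $ 1 = zc S i p"
    using x(1) by (auto simp: overlap_def ov_def)
  obtain v where v: "v \<in> tot L" "prj L v = p" "triv L i v = 1" using vector_over[OF ij(1) p(1)] .
  define g H where "g = cmod (glue i j (x $ 1))" and "H = h j (transition S i j (x $ 1))"
  have "(cmod (triv L i v))\<^sup>2 * h i (zc S i p) = (cmod (triv L j v))\<^sup>2 * h j (zc S j p)"
    using base_parts(4) ij v p unfolding hermitian_metric_def by blast
  then have hi: "h i (x $ 1) = g\<^sup>2 * H"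
    using glue(2)[OF ij v(1)] v p transition_zc[OF ij(1) p(1), of j] by (simp add: g_def H_def)
  have g: "g > 0" using glue_nz[OF ij] x(1) by (simp add: g_def overlap_def)
  have H: "H > 0"
    using base_parts(4) ij(2) p transition_zc[OF ij(1) p(1), of j]
    by (auto simp: H_def hermitian_metric_def)
  have w: "cmod (x $ 2) > 0" using x(2) by simp
  show ?thesis
    using g H w hi unfolding log_norm_def change_def fibre_change_def
    by (auto simp: g_def[symmetric] H_def[symmetric] norm_mult norm_divide ln_mult ln_div ln_realpow
        power_mult_distrib power_divide algebra_simps)
qed

text \<open>By \<open>hform_gmat\<close> only \<rho> |dz|^2 and \<partial>s matter. The first is
  invariant because \<rho> is the density of a form on the base. The second is found by
  differentiating the invariance of s, which yields equality of real parts.\<close>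

lemma hform_change:
  assumes f: "smooth_on UNIV f" and ij: "i \<in> idx S" "j \<in> idx S"
    and x: "x \<in> overlap i b j c" "x $ 2 \<noteq> 0" and D: "(change i b j c has_derivative D) (at x)"
  shows "hform (calabi_metric \<rho> h f (i, b) x) v
    = hform (calabi_metric \<rho> h f (j, c) (change i b j c x)) (D v)"
proof -
  interpret C: calabi_chart "chart_set i" "h i" "\<rho> i" "eps b" f by (rule chart[OF ij(1) f])
  interpret E: calabi_chart "chart_set j" "h j" "\<rho> j" "eps c" f by (rule chart[OF ij(2) f])
  let ?F = "change i b j c"
  have Cs: "C.\<sigma> = log_norm h (i, b)" and Es: "E.\<sigma> = log_norm h (j, c)"
    by (auto simp: fun_eq_iff log_norm_def C.\<sigma>_def E.\<sigma>_def)
  have Cm: "calabi_metric \<rho> h f (i, b) = C.gmat" and Em: "calabi_metric \<rho> h f (j, c) = E.gmat"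
    by (simp_all add: fun_eq_iff calabi_metric_def C.gmat_def E.gmat_def Cs Es)
  obtain p where p: "p \<in> nbh S i" "p \<in> nbh S j" "x $ 1 = zc S i p"
    using x(1) by (auto simp: overlap_def ov_def)
  have F1: "?F x $ 1 = zc S j p" using transition_zc[OF ij(1) p(1), of j] p by (simp add: change_def)
  have xU: "x \<in> C.U" using p x by (auto simp: C.U_def)
  have F2: "?F x $ 2 \<noteq> 0"
    using x glue_nz[OF ij] by (auto simp: change_def fibre_change_def overlap_def)
  have FU: "?F x \<in> E.U" using F1 F2 p by (auto simp: E.U_def)
  obtain D' where D': "(?F has_derivative D') (at x)" "\<And>k v. D' (k *s v) = k *s D' v"
    "\<And>v. D' v $ 1 = deriv (transition S i j) (x $ 1) * v $ 1"
    using change_derivative[OF ij x(1)] by metis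
  have DD: "D = D'" using has_derivative_unique[OF D D'(1)] .
  define N where "N = overlap i b j c \<inter> {x. x $ 2 \<noteq> 0}"
  have N: "open N" "x \<in> N"
  proof -
    have "open {x::complex^2. x $ 2 \<noteq> 0}"
      by (intro open_Collect_neq continuous_intros)
    then show "open N" using open_overlap[OF ij] by (auto simp: N_def)
  qed (use x in \<open>simp add: N_def\<close>)
  have s: "E.\<sigma> (?F y) = C.\<sigma> y" if "y \<in> N" for y
    using log_norm_change[OF ij, of y b c] that by (simp add: Cs Es N_def)
  have "((\<lambda>y. E.\<sigma> (?F y)) has_derivative
      (\<lambda>v. 2 * Re (E.th1 (?F x) * D v $ 1 + E.th2 (?F x) * D v $ 2))) (at x)"
    by (rule has_derivative_compose[OF D E.deriv_\<sigma>[OF FU]])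
  then have "(C.\<sigma> has_derivative (\<lambda>v. 2 * Re (E.th1 (?F x) * D v $ 1 + E.th2 (?F x) * D v $ 2))) (at x)"
    by (rule has_derivative_transform_within_open[OF _ N s])
  from has_derivative_unique[OF this C.deriv_\<sigma>[OF xU]]
  have re: "Re (E.th1 (?F x) * D v $ 1 + E.th2 (?F x) * D v $ 2) = Re (C.th1 x * v $ 1 + C.th2 x * v $ 2)" for v
    by (auto simp only: fun_eq_iff mult_left_cancel)
  have "E.th1 (?F x) * D v $ 1 + E.th2 (?F x) * D v $ 2 = C.th1 x * v $ 1 + C.th2 x * v $ 2"
    (is "?l = ?r")
  proof (rule complex_eqI[OF re])
    \<comment> \<open>Complex linearity: the real part identity at \<i> v is the imaginary part
      identity at v.\<close>
    have "D (\<i> *s v) = \<i> *s D v" unfolding DD by (rule D'(2))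
    then have "Re (\<i> * ?l) = Re (\<i> * ?r)" using re[of "\<i> *s v"] by (simp add: algebra_simps)
    then show "Im ?l = Im ?r" by simp
  qed
  moreover have "\<rho> i (x $ 1) = (cmod (deriv (transition S i j) (x $ 1)))\<^sup>2 * \<rho> j (?F x $ 1)"
  proof -
    have "\<forall>q \<in> nbh S i \<inter> nbh S j.
        \<rho> i (zc S i q) = (cmod (deriv (transition S i j) (zc S i q)))\<^sup>2 * \<rho> j (zc S j q)"
      using base_parts(2) ij unfolding kahler_form_def by blast
    then show ?thesis using p F1 by simp
  qed
  then have "\<rho> i (x $ 1) * (cmod (v $ 1))\<^sup>2 = \<rho> j (?F x $ 1) * (cmod (D v $ 1))\<^sup>2"
    unfolding DD D'(3) by (simp add: norm_mult power_mult_distrib mult_ac)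
  ultimately show ?thesis
    unfolding Cm Em C.hform_gmat[OF xU] E.hform_gmat[OF FU] s[OF N(2)] by (simp add: mult.assoc)
qed

lemma kahler_off_calabi:
  assumes f: "smooth_on UNIV f" and pos: "\<And>t. deriv (deriv f) t > 0" "\<And>t. 1 + deriv f t > 0"
  shows "kahler_off X (D0 \<union> Dinf) (calabi_metric \<rho> h f)"
  unfolding kahler_off_def charts_eq
proof safe
  fix i b assume i: "i \<in> idx S"
  interpret C: calabi_chart "chart_set i" "h i" "\<rho> i" "eps b" f by (rule chart[OF i f])
  have Cs: "C.\<sigma> = log_norm h (i, b)" by (auto simp: fun_eq_iff log_norm_def C.\<sigma>_def)
  have "calabi_metric \<rho> h f (i, b) = C.gmat"
    by (simp add: fun_eq_iff calabi_metric_def C.gmat_def Cs)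
  moreover have "C.U = punctured i" by (simp add: C.U_def punctured_def)
  ultimately show "kahler_on (crd X (i, b) ` (dom X (i, b) - (D0 \<union> Dinf))) (calabi_metric \<rho> h f (i, b))"
    using C.kahler_on_gmat[OF pos] by (simp add: crd_image_off[OF i])
qed

text \<open>Near a point of the divisor the chart in which it is the zero set of the second
  coordinate serves as holomorphic coordinates, restricted to a ball times the unit disc. The bounds
  there come from \<open>conical_bounds\<close>, and \<open>hform_change\<close> transports them to
  all other charts.\<close>

lemma conical_along_calabi:
  assumes f: "smooth_on UNIV f" and kahler: "kahler_off X (D0 \<union> Dinf) (calabi_metric \<rho> h f)"
    and \<beta>: "\<beta> > 0" and \<gamma>: "\<And>t. 1 \<le> 1 + deriv f t" "\<And>t. 1 + deriv f t \<le> M"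
    and decay: "\<And>s1. \<exists>c1>0. \<exists>c2>0. \<forall>s. eps b * s \<le> s1 \<longrightarrow>
      c1 * exp (\<beta> * (eps b * s)) \<le> deriv (deriv f) s \<and> deriv (deriv f) s \<le> c2 * exp (\<beta> * (eps b * s))"
  shows "conical_along X (D0 \<union> Dinf) (calabi_metric \<rho> h f) 2 (if b then Dinf else D0) \<beta>"
    (is "conical_along _ _ _ _ ?D _")
  unfolding conical_along_def
proof (intro conjI kahler ballI)
  fix p assume p: "p \<in> ?D"
  have pl: "p \<in> lines S L" using p by (auto simp: zero_divisor_def infinity_divisor_def split: if_splits)
  obtain i where i: "i \<in> idx S" "pr p \<in> nbh S i" using prj_in_chart[OF linesE(1)[OF pl]] .
  have pd: "p \<in> dom X (i, b)"
    using p linesE(3)[OF pl i] is_zero_iff[OF linesE(1)[OF pl] i] pl i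
    by (auto simp: dom_iff zero_divisor_def infinity_divisor_def split: if_splits)
  interpret C: calabi_chart "chart_set i" "h i" "\<rho> i" "eps b" f by (rule chart[OF i(1) f])
  have Cs: "C.\<sigma> = log_norm h (i, b)" by (auto simp: fun_eq_iff log_norm_def C.\<sigma>_def)
  have Cm: "calabi_metric \<rho> h f (i, b) = C.gmat"
    by (simp add: fun_eq_iff calabi_metric_def C.gmat_def Cs)
  define z0 where "z0 = zc S i (pr p)"
  have z0: "z0 \<in> chart_set i" using i by (simp add: z0_def)
  obtain r C1 C2 where r: "r > 0" "C1 > 0" "C2 > 0" "ball z0 r \<subseteq> chart_set i"
    and bound: "\<And>x v. x \<in> C.U \<Longrightarrow> x $ 1 \<in> ball z0 r \<Longrightarrow> cmod (x $ 2) < 1 \<Longrightarrow>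
      C1 * hform (model_edge_metric 2 \<beta> x) v \<le> hform (C.gmat x) v \<and>
      hform (C.gmat x) v \<le> C2 * hform (model_edge_metric 2 \<beta> x) v"
    using C.conical_bounds[OF z0 \<beta> \<gamma> decay] by metis
  define B where "B = {x::complex^2. x $ 1 \<in> ball z0 r \<and> cmod (x $ 2) < 1}"
  have B: "open B" "\<And>x. x \<in> B \<Longrightarrow> x $ 1 \<in> chart_set i"
  proof -
    have "B = (\<lambda>x. x $ 1) -` ball z0 r \<inter> (\<lambda>x. x $ 2) -` ball 0 1" by (auto simp: B_def)
    then show "open B" by (auto intro!: open_Int open_vimage continuous_intros)
  qed (use r in \<open>auto simp: B_def\<close>)
  define V where "V = {q \<in> dom X (i, b). crd X (i, b) q \<in> B}"
  let ?\<Psi> = "crd X (i, b)"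
  show "\<exists>V \<Psi> C1 C2. p \<in> V \<and> holomorphic_coordinates X V \<Psi> \<and> V \<inter> (D0 \<union> Dinf) \<subseteq> ?D \<and>
        V \<inter> ?D = {q\<in>V. \<Psi> q $ 2 = 0} \<and> C1 > 0 \<and> C2 > 0 \<and>
        (\<forall>k\<in>charts X. \<forall>q \<in> (V \<inter> dom X k) - ?D. \<forall>v.
           (let d = frechet_derivative (\<Psi> \<circ> inv_into (dom X k) (crd X k)) (at (crd X k q));
                e = hform (model_edge_metric 2 \<beta> (\<Psi> q)) (d v)
            in C1 * e \<le> hform (calabi_metric \<rho> h f k (crd X k q)) v \<and>
               hform (calabi_metric \<rho> h f k (crd X k q)) v \<le> C2 * e))"
  proof (rule exI[of _ V], rule exI[of _ ?\<Psi>], rule exI[of _ C1], rule exI[of _ C2],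
      intro conjI r(2,3) ballI allI)
    show "holomorphic_coordinates X V ?\<Psi>"
      unfolding V_def by (rule holomorphic_coordinates_chart[OF i(1) B])
    have "?\<Psi> p $ 2 = 0" using divisor_iff(1)[OF i(1) pd] p by simp
    moreover have "?\<Psi> p $ 1 = z0" by (simp add: crd_eq z0_def)
    ultimately show "p \<in> V" using pd r(1) by (simp add: V_def B_def)
    show "V \<inter> (D0 \<union> Dinf) \<subseteq> ?D" "V \<inter> ?D = {q \<in> V. ?\<Psi> q $ 2 = 0}"
    proof -
      have Vd: "q \<in> dom X (i, b)" if "q \<in> V" for q using that by (simp add: V_def)
      show "V \<inter> (D0 \<union> Dinf) \<subseteq> ?D" using divisor_iff(2)[OF i(1) Vd] by (cases b) auto
      show "V \<inter> ?D = {q \<in> V. ?\<Psi> q $ 2 = 0}" using divisor_iff(1)[OF i(1) Vd] by blast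
    qed
    fix k q and v :: "complex^2" assume k: "k \<in> charts X" and q: "q \<in> V \<inter> dom X k - ?D"
    obtain j c where jc: "k = (j, c)" "j \<in> idx S" using k by (auto simp: charts_eq)
    have qi: "q \<in> dom X (i, b)" "?\<Psi> q \<in> B" and qj: "q \<in> dom X (j, c)"
      using q jc by (auto simp: V_def)
    define x where "x = crd X (j, c) q"
    have xo: "x \<in> overlap j c i b" and y: "?\<Psi> q = change j c i b x"
      using change_crd[OF jc(2) i(1) qj qi(1)] by (auto simp: x_def)
    have y2: "?\<Psi> q $ 2 \<noteq> 0" using divisor_iff(1)[OF i(1) qi(1)] q by blast
    then have x2: "x $ 2 \<noteq> 0"
      using divisors_iff[OF i(1) qi(1)] divisors_iff[OF jc(2) qj] by (simp add: x_def)
    obtain D where D: "(change j c i b has_derivative D) (at x)"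
      using change_derivative[OF jc(2) i(1) xo] by metis
    have "frechet_derivative (?\<Psi> \<circ> inv_into (dom X k) (crd X k)) (at x)
        = frechet_derivative (change j c i b) (at x)"
      unfolding jc
      by (rule frechet_derivative_cong_open[OF open_overlap[OF jc(2) i(1)] xo crd_inv_crd[OF jc(2) i(1)]])
    then have d: "frechet_derivative (?\<Psi> \<circ> inv_into (dom X k) (crd X k)) (at (crd X k q)) = D"
      using frechet_derivative_at[OF D] by (simp add: jc x_def)
    have "?\<Psi> q \<in> C.U" using qi B(2) y2 by (auto simp: C.U_def)
    moreover have "hform (calabi_metric \<rho> h f k (crd X k q)) v = hform (C.gmat (?\<Psi> q)) (D v)"
      using hform_change[OF f jc(2) i(1) xo x2 D, of v] by (simp add: jc x_def[symmetric] y[symmetric] Cm)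
    ultimately show "let d = frechet_derivative (?\<Psi> \<circ> inv_into (dom X k) (crd X k)) (at (crd X k q));
                e = hform (model_edge_metric 2 \<beta> (?\<Psi> q)) (d v)
            in C1 * e \<le> hform (calabi_metric \<rho> h f k (crd X k q)) v \<and>
               hform (calabi_metric \<rho> h f k (crd X k q)) v \<le> C2 * e"
      using bound[of "?\<Psi> q" "D v"] qi(2) by (simp add: Let_def d B_def)
  qed
qed

end

section \<open>Existence and uniqueness\<close>

text \<open>Passing from s to the momentum y: f'' = g(y) and f''' = g'(y) g(y), so Q = g' and dQ =
  g'' g, while dP = (g / y) (g' - g / y). Every term then contains the positive factor g / y, which
  is cancelled.\<close>

lemma (in calabi_chart) curvature_profile:
  assumes x: "x \<in> U" and pos: "\<And>t. f2 t > 0" "\<And>t. 1 + f1 t > 0"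
    and profile: "\<And>t. g (1 + f1 t) = f2 t"
    and g: "\<And>t. (g has_real_derivative g1 (1 + f1 t)) (at (1 + f1 t))"
      "\<And>t. (g1 has_real_derivative g2 (1 + f1 t)) (at (1 + f1 t))"
  defines "y \<equiv> 1 + f1 (\<sigma> x)"
  shows "is_higher_scalar_curvature gmat x c \<longleftrightarrow> c * y\<^sup>2 / 2 = (y + g y) * g2 y + (g1 y - g y / y)\<^sup>2"
proof -
  let ?s = "\<sigma> x"
  have d: "((\<lambda>t. 1 + f1 t) has_real_derivative f2 t) (at t)" for t
    using derivs_f(2) by (auto intro!: derivative_eq_intros)
  have f3: "f3 t = g1 (1 + f1 t) * f2 t" for t
  proof -
    have "((\<lambda>t. g (1 + f1 t)) has_real_derivative g1 (1 + f1 t) * f2 t) (at t)"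
      by (rule DERIV_chain2[OF g(1) d])
    then have "(f2 has_real_derivative g1 (1 + f1 t) * f2 t) (at t)" by (simp add: profile)
    then show ?thesis using DERIV_unique derivs_f(3) by blast
  qed
  have Q: "Q t = g1 (1 + f1 t)" for t using f3[of t] pos(1)[of t] by (simp add: Q_def)
  have "((\<lambda>t. g1 (1 + f1 t)) has_real_derivative g2 (1 + f1 t) * f2 t) (at t)" for t
    by (rule DERIV_chain2[OF g(2) d])
  then have "(Q has_real_derivative g2 y * f2 ?s) (at ?s)" by (simp add: Q[abs_def] y_def)
  moreover have "f2 ?s \<noteq> 0" "y > 0" using pos(1)[of ?s] pos(2)[of ?s] by (auto simp: y_def)
  ultimately have dQ: "dQ ?s = g2 y * f2 ?s" using DERIV_unique deriv_Q by blast
  define w where "w = f2 ?s"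
  have w: "w > 0" "g y = w" using pos(1) profile by (auto simp: w_def y_def)
  have dP: "dP ?s = w / y * (g1 y - w / y)"
    using \<open>y > 0\<close> unfolding dP_def f3 y_def[symmetric] w_def[symmetric]
    by (simp add: field_simps power2_eq_square)
  have "is_higher_scalar_curvature gmat x c \<longleftrightarrow>
      c * y * w / 2 = (1 + w / y) * (g2 y * w) + w / y * (g1 y - w / y) * (g1 y - w / y)"
    using is_higher_scalar_curvature_gmat[OF x pos, of c]
    unfolding dQ dP Q P_def y_def[symmetric] w_def[symmetric] .
  also have "\<dots> \<longleftrightarrow> (w / y) * (c * y\<^sup>2 / 2) = (w / y) * ((y + w) * g2 y + (g1 y - w / y)\<^sup>2)"
  proof -
    have "(w / y) * (c * y\<^sup>2 / 2) = c * y * w / 2"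
      using \<open>y > 0\<close> by (simp add: power2_eq_square)
    moreover have "(1 + w / y) * (g2 y * w) = w / y * ((y + w) * g2 y)"
      using \<open>y > 0\<close> by (simp add: field_simps)
    ultimately show ?thesis by (simp add: distrib_left power2_eq_square mult.assoc)
  qed
  also have "\<dots> \<longleftrightarrow> c * y\<^sup>2 / 2 = (y + w) * g2 y + (g1 y - w / y)\<^sup>2"
    by (rule mult_left_cancel) (use w \<open>y > 0\<close> in simp)
  finally show ?thesis by (simp add: w(2))
qed

lemma strictly_convexI:
  assumes f: "\<And>x. (f has_real_derivative f' x) (at x)" and mono: "\<And>x y. x < y \<Longrightarrow> f' x < f' y"
  shows "strictly_convex f"
  unfolding strictly_convex_def
proof (intro allI impI)
  have less: "f ((1 - t) * x + t * y) < (1 - t) * f x + t * f y" if "x < y" "0 < t" "t < 1" for x y t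
  proof -
    define z where "z = (1 - t) * x + t * y"
    have zx: "z - x = t * (y - x)" and yz: "y - z = (1 - t) * (y - x)" by (simp_all add: z_def algebra_simps)
    have "0 < z - x" "0 < y - z" unfolding zx yz using that by auto
    then have z: "x < z" "z < y" by auto
    obtain u where u: "u < z" "f z - f x = (z - x) * f' u" using MVT2[OF z(1) f] by blast
    obtain v where v: "z < v" "f y - f z = (y - z) * f' v" using MVT2[OF z(2) f] by blast
    have "f' u < f' v" using mono u v by simp
    then have "0 < (t * (1 - t) * (y - x)) * (f' v - f' u)" using that by simp
    also have "\<dots> = t * (f y - f z) - (1 - t) * (f z - f x)"
      unfolding u(2) v(2) zx yz by (simp add: algebra_simps)
    finally show ?thesis unfolding z_def[symmetric] by (simp add: algebra_simps)
  qed
  fix x y t :: real assume a: "x \<noteq> y \<and> 0 < t \<and> t < 1"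
  show "f ((1 - t) * x + t * y) < (1 - t) * f x + t * f y"
  proof (cases "x < y")
    case True
    then show ?thesis using less a by simp
  next
    case False
    then show ?thesis using less[of y x "1 - t"] a by (simp add: add.commute)
  qed
qed

context calabi_surface
begin

text \<open>One chart suffices, since s takes every real value on it. As 1 + f' maps onto (1, M),
  constancy of the higher scalar curvature becomes the ordinary differential equation on the whole
  interval, and \<open>conical_profile_unique\<close> applies.\<close>

lemma profile_unique:
  assumes m: "m > 0" and profile: "conical_higher_cscK_profile S \<rho> L h m \<beta> \<beta>' \<phi>"
  shows "\<beta>' = \<beta> * (2 * (m + 1) + 1) / (m + 1 + 2)"
    and "\<phi> = restrict (conical_profile \<beta> (m + 1)) {1..m + 1}"
proof -
  define M where "M = m + 1"
  have M: "M > 1" using m by (simp add: M_def)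
  obtain f where cs: "calabi_symmetry S \<rho> L h f" and cl: "in_kahler_class m f"
    and mp: "momentum_profile m f \<phi>" and cb: "cone_boundary_conditions m \<beta> \<beta>' \<phi>"
    and csc: "higher_cscK_off X (D0 \<union> Dinf) (calabi_metric \<rho> h f)"
    using profile unfolding conical_higher_cscK_profile_def Let_def by blast
  have f: "smooth_on UNIV f" and k: "kahler_off X (D0 \<union> Dinf) (calabi_metric \<rho> h f)"
    using cs by (auto simp: calabi_symmetry_def)
  obtain i q where i: "i \<in> idx S" "q \<in> nbh S i" using nonempty .
  interpret C: calabi_chart "chart_set i" "h i" "\<rho> i" "eps False" f by (rule chart[OF i(1) f])
  have Cs: "C.\<sigma> = log_norm h (i, False)"
    by (rule ext) (unfold C.\<sigma>_def log_norm_def, simp)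
  have Cm: "calabi_metric \<rho> h f (i, False) = C.gmat"
    by (rule ext) (unfold C.gmat_def calabi_metric_def Cs, simp)
  have CU: "crd X (i, False) ` (dom X (i, False) - (D0 \<union> Dinf)) = C.U"
    unfolding crd_image_off[OF i(1)] by (simp add: C.U_def punctured_def)
  have ch: "(i, False) \<in> charts X" using i by (simp add: charts_eq)
  have ka: "kahler_on C.U C.gmat" using k ch unfolding kahler_off_def by (metis CU Cm)
  obtain c where c: "\<And>x. x \<in> C.U \<Longrightarrow> is_higher_scalar_curvature C.gmat x c"
    using csc ch unfolding higher_cscK_off_def by (metis CU Cm)
  have point: "\<exists>x\<in>C.U. C.\<sigma> x = s" for s
  proof -
    \<comment> \<open>The fibre coordinate e^w contributes 2 w to s, so this \<open>w\<close> solves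
      2 w + ln h = s.\<close>
    define z w where "z = zc S i q" and "w = (s - ln (h i z)) / 2"
    have "(vector [z, of_real (exp w)] :: complex^2) \<in> C.U" using i by (simp add: C.U_def z_def)
    moreover have "C.\<sigma> (vector [z, of_real (exp w)] :: complex^2) = s"
      unfolding C.\<sigma>_def by (simp add: ln_realpow w_def field_simps)
    ultimately show ?thesis by blast
  qed
  \<comment> \<open>Strict convexity alone would permit zeros of the second derivative; the
    positivity of the metric in the fibre direction excludes them.\<close>
  have pos: "deriv (deriv f) s > 0" for s
  proof -
    obtain x where x: "x \<in> C.U" "C.\<sigma> x = s" using point by blast
    have "(axis 2 1 :: complex^2) \<noteq> 0" by (simp add: axis_eq_0_iff)
    then have "hform (C.gmat x) (axis 2 1) > 0" using ka x(1) unfolding kahler_on_def by blast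
    then have "0 < deriv (deriv f) s * (cmod (C.th2 x))\<^sup>2"
      unfolding C.hform_gmat[OF x(1)] x(2) by (simp add: axis_def)
    then show ?thesis by (simp add: zero_less_mult_iff)
  qed
  have bnd: "0 \<le> deriv f s" "deriv f s \<le> m" for s using cl by (auto simp: in_kahler_class_def)
  have pos1: "1 + deriv f s > 0" for s using bnd(1)[of s] by simp
  have inc: "deriv f s < deriv f t" if "s < t" for s t
    by (rule DERIV_pos_imp_increasing[OF that]) (use C.derivs_f(2) pos in blast)
  have rng: "1 < 1 + deriv f s" "1 + deriv f s < M" for s
    using inc[of "s - 1" s] inc[of s "s + 1"] bnd(1)[of "s - 1"] bnd(2)[of "s + 1"] by (auto simp: M_def)
  \<comment> \<open>A smooth extension of the profile past the ends, so that two-sided derivatives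
    are available on all of [1, M].\<close>
  obtain W g where W: "open W" "{1..M} \<subseteq> W" "smooth_on W g" "\<And>x. x \<in> {1..M} \<Longrightarrow> g x = \<phi> x"
    using cb unfolding cone_boundary_conditions_def smooth_up_to_boundary_def M_def by blast
  have g: "(g has_real_derivative deriv g x) (at x)"
    "(deriv g has_real_derivative deriv (deriv g) x) (at x)" if "x \<in> {1..M}" for x
    using that W smooth_on_DERIV smooth_on_deriv by blast+
  have gp: "g (1 + deriv f t) = deriv (deriv f) t" for t
    using mp rng[of t] W(4)[of "1 + deriv f t"] by (simp add: momentum_profile_def)
  have gd: "(g has_real_derivative deriv g (1 + deriv f t)) (at (1 + deriv f t))"
    "(deriv g has_real_derivative deriv (deriv g) (1 + deriv f t)) (at (1 + deriv f t))" for t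
    using g rng[of t] by auto
  have surj: "\<exists>s. 1 + deriv f s = y" if y: "1 < y" "y < M" for y
  proof -
    have l: "(deriv f \<longlongrightarrow> 0) at_bot" "(deriv f \<longlongrightarrow> m) at_top" using cl by (auto simp: in_kahler_class_def)
    have "eventually (\<lambda>s. deriv f s < y - 1) at_bot" using order_tendstoD(2)[OF l(1)] y by simp
    then obtain s1 where s1: "deriv f s1 < y - 1" by (auto simp: eventually_at_bot_linorder)
    have "eventually (\<lambda>s. y - 1 < deriv f s) at_top" using order_tendstoD(1)[OF l(2)] y by (simp add: M_def)
    then obtain s2 where s2: "y - 1 < deriv f s2" by (auto simp: eventually_at_top_linorder)
    have "s1 \<le> s2" using inc[of s2 s1] s1 s2 by (cases "s1 \<le> s2") auto
    then obtain s where "deriv f s = y - 1"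
      using IVT[of "deriv f" s1 "y - 1" s2] s1 s2 DERIV_isCont[OF C.derivs_f(2)] by auto
    then show ?thesis by (intro exI[of _ s]) simp
  qed
  have ode: "c * y\<^sup>2 / 2 = (y + g y) * deriv (deriv g) y + (deriv g y - g y / y)\<^sup>2"
    if y: "1 < y" "y < M" for y
  proof -
    obtain s where s: "1 + deriv f s = y" using surj[OF y] by blast
    obtain x where x: "x \<in> C.U" "C.\<sigma> x = s" using point by blast
    show ?thesis
      using C.curvature_profile[OF x(1) pos pos1 gp gd, of c] c[OF x(1)] unfolding x(2) s by simp
  qed
  have cbs: "\<phi> 1 = 0" "\<phi> M = 0" "(\<phi> has_real_derivative \<beta>) (at 1 within {1..M})"
    "(\<phi> has_real_derivative - \<beta>') (at M within {1..M})" "\<And>x. 1 < x \<Longrightarrow> x < M \<Longrightarrow> \<phi> x > 0"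
    using cb by (auto simp: cone_boundary_conditions_def M_def)
  have ends: "deriv g x = d" if d: "(\<phi> has_real_derivative d) (at x within {1..M})" and x: "x \<in> {1..M}" for x d
  proof -
    have "(g has_real_derivative d) (at x within {1..M})"
      by (rule has_field_derivative_transform_within[OF d zero_less_one x]) (simp add: W(4))
    moreover have "(g has_real_derivative deriv g x) (at x within {1..M})"
      using g(1)[OF x] by (rule has_field_derivative_at_within)
    \<comment> \<open>The boundary slopes are given as one-sided derivatives; these are unique on a
      nondegenerate interval and hence agree with \<open>deriv g\<close>.\<close>
    ultimately show ?thesis
      unfolding has_real_derivative_iff_has_vector_derivative
      using vector_derivative_unique_within_closed_interval[of 1 M x g] M x by simp
  qed
  have one: "1 \<in> {1..M}" and Min: "M \<in> {1..M}" using M by auto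
  have g0: "g 1 = 0" "g M = 0" using W(4)[OF one] W(4)[OF Min] cbs by auto
  have gpos: "g x > 0" if "1 < x" "x < M" for x using W(4)[of x] cbs(5)[OF that] that by simp
  note un = conical_profile_unique[OF M g(1) g(2) ode g0 ends[OF cbs(3) one] ends[OF cbs(4) Min] gpos]
  show "\<beta>' = \<beta> * (2 * (m + 1) + 1) / (m + 1 + 2)" using un(1) by (simp add: M_def)
  \<comment> \<open>Off the interval both functions have the default value of
    \<open>extensional\<close>, which upgrades agreement on [1, M] to equality.\<close>
  have "\<phi> \<in> extensional {1..M}" using mp by (simp add: momentum_profile_def M_def)
  then have "\<phi> = restrict (conical_profile \<beta> M) {1..M}"
    by (rule extensionalityI) (use un(2) W(4) in auto)
  then show "\<phi> = restrict (conical_profile \<beta> (m + 1)) {1..m + 1}" by (simp add: M_def)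
qed

text \<open>The potential is an antiderivative of \<gamma> - 1. Then 1 + f' = \<gamma> and f'' =
  \<phi>(\<gamma>), so the class condition is given by the limits of the flow and the cone
  conditions by its exponential rates.\<close>

lemma profile_exists:
  assumes m: "m > 0" and \<beta>: "\<beta> > 0"
  shows "conical_higher_cscK_profile S \<rho> L h m \<beta> (\<beta> * (2 * (m + 1) + 1) / (m + 1 + 2))
    (restrict (conical_profile \<beta> (m + 1)) {1..m + 1})"
proof -
  define M where "M = m + 1"
  interpret p: profile_data \<beta> M by unfold_locales (use m \<beta> in \<open>auto simp: M_def\<close>)
  have "continuous_on UNIV (\<lambda>s. p.\<gamma> s - 1)"
    by (intro continuous_intros smooth_on_continuous p.smooth_\<gamma>)
  then obtain f where f: "\<And>s. (f has_real_derivative p.\<gamma> s - 1) (at s)"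
    using antiderivative_on_reals by metis
  have f1: "deriv f = (\<lambda>s. p.\<gamma> s - 1)" using DERIV_imp_deriv[OF f] by auto
  have "((\<lambda>s. p.\<gamma> s - 1) has_real_derivative p.\<phi> (p.\<gamma> s)) (at s)" for s
    using p.deriv_\<gamma>[of s] by (auto intro!: derivative_eq_intros)
  then have f2: "deriv (deriv f) s = p.\<phi> (p.\<gamma> s)" for s unfolding f1 by (rule DERIV_imp_deriv)
  have sf: "smooth_on UNIV f"
    unfolding smooth_on_def
  proof
    fix k
    have "Ck_on k UNIV (\<lambda>s. p.\<gamma> s + (- 1))"
      using p.smooth_\<gamma> by (intro Ck_on_add Ck_on_const) (auto simp: smooth_on_def)
    then have "Ck_on (Suc k) UNIV f" by (intro Ck_on_real_SucI[OF _ f]) auto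
    then show "Ck_on k UNIV f" by (rule Ck_on_Suc_imp)
  qed
  have pos: "deriv (deriv f) s > 0" "1 + deriv f s > 0" for s
    unfolding f2 using p.\<phi>_pos[OF p.\<gamma>(1,2)] p.\<gamma>(1)[of s] by (auto simp: f1)
  have bounds: "1 \<le> 1 + deriv f s" "1 + deriv f s \<le> M" for s
    using p.\<gamma>(1,2)[of s] by (auto simp: f1)
  have kah: "kahler_off X (D0 \<union> Dinf) (calabi_metric \<rho> h f)"
    by (rule kahler_off_calabi[OF sf pos])
  have "calabi_symmetry S \<rho> L h f"
    unfolding calabi_symmetry_def
  proof (intro conjI sf kah)
    show "strictly_convex f"
      by (rule strictly_convexI[OF f]) (simp add: p.\<gamma>_strict_mono)
    show "strict_mono (\<lambda>s. s + f s)"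
    proof (rule strict_monoI)
      fix s t :: real assume "s < t"
      then show "s + f s < t + f t"
      proof (rule DERIV_pos_imp_increasing)
        show "\<exists>d. ((\<lambda>s. s + f s) has_real_derivative d) (at u) \<and> d > 0" for u
          using DERIV_add[OF DERIV_ident f[of u]] p.\<gamma>(1)[of u] by (intro exI[of _ "1 + (p.\<gamma> u - 1)"]) auto
      qed
    qed
  qed
  moreover have "in_kahler_class m f"
    unfolding in_kahler_class_def f1
  proof (intro conjI allI)
    show "((\<lambda>s. p.\<gamma> s - 1) \<longlongrightarrow> 0) at_bot" using tendsto_diff[OF p.\<gamma>_at_bot tendsto_const[of 1]] by simp
    show "((\<lambda>s. p.\<gamma> s - 1) \<longlongrightarrow> m) at_top"
      using tendsto_diff[OF p.\<gamma>_at_top tendsto_const[of 1]] by (simp add: M_def)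
    show "0 \<le> p.\<gamma> s - 1" "p.\<gamma> s - 1 \<le> m" for s using p.\<gamma>(1,2)[of s] by (auto simp: M_def)
  qed
  moreover have "momentum_profile m f (restrict p.\<phi> {1..M})"
    unfolding momentum_profile_def f2 unfolding f1 M_def[symmetric]
    using p.\<gamma>(1,2) by (auto simp: less_imp_le)
  moreover have "cone_boundary_conditions m \<beta> p.\<beta>' (restrict p.\<phi> {1..M})"
    unfolding cone_boundary_conditions_def M_def[symmetric]
  proof (intro conjI ballI)
    show "smooth_up_to_boundary {1..M} (restrict p.\<phi> {1..M})"
      unfolding smooth_up_to_boundary_def
      using p.open_T p.subset_T p.smooth_\<phi> by (intro exI[of _ p.T] exI[of _ p.\<phi>]) auto
    have d: "(restrict p.\<phi> {1..M} has_real_derivative deriv p.\<phi> x) (at x within {1..M})"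
      if "x \<in> {1..M}" for x
      by (rule has_field_derivative_transform_within[OF
            has_field_derivative_at_within[OF p.deriv_\<phi>(1)] zero_less_one that])
        (use p.subset_T that in auto)
    show "(restrict p.\<phi> {1..M} has_real_derivative \<beta>) (at 1 within {1..M})"
      "(restrict p.\<phi> {1..M} has_real_derivative - p.\<beta>') (at M within {1..M})"
      using d[of 1] d[of M] p.deriv_\<phi>_ends p.M by auto
  qed (use p.\<phi>_ends p.M p.\<phi>_pos in auto)
  moreover have "conical_along X (D0 \<union> Dinf) (calabi_metric \<rho> h f) 2 D0 \<beta>"
  proof -
    have "\<exists>c1>0. \<exists>c2>0. \<forall>s. eps False * s \<le> s1 \<longrightarrow>
      c1 * exp (\<beta> * (eps False * s)) \<le> deriv (deriv f) s \<and> deriv (deriv f) s \<le> c2 * exp (\<beta> * (eps False * s))"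
      for s1 using p.\<phi>_\<gamma>_at_bot[of s1] by (simp add: f2)
    from conical_along_calabi[OF sf kah \<beta> bounds this] show ?thesis by simp
  qed
  moreover have "conical_along X (D0 \<union> Dinf) (calabi_metric \<rho> h f) 2 Dinf p.\<beta>'"
  proof -
    have "\<exists>c1>0. \<exists>c2>0. \<forall>s. eps True * s \<le> s1 \<longrightarrow>
      c1 * exp (p.\<beta>' * (eps True * s)) \<le> deriv (deriv f) s \<and>
      deriv (deriv f) s \<le> c2 * exp (p.\<beta>' * (eps True * s))"
      for s1
    proof -
      \<comment> \<open>In the inverted charts \<epsilon> = -1, so \<epsilon> s \<le> s1 is the
        half-line s \<ge> - s1.\<close>
      obtain c1 c2 where "c1 > 0" "c2 > 0"
        "\<forall>s\<ge>- s1. c1 * exp (- p.\<beta>' * s) \<le> p.\<phi> (p.\<gamma> s) \<and> p.\<phi> (p.\<gamma> s) \<le> c2 * exp (- p.\<beta>' * s)"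
        using p.\<phi>_\<gamma>_at_top[of "- s1"] by blast
      then show ?thesis by (intro exI[of _ c1] exI[of _ c2] conjI) (auto simp: f2)
    qed
    from conical_along_calabi[OF sf kah p.\<beta>'_gt(2) bounds this] show ?thesis by simp
  qed
  moreover have "higher_cscK_off X (D0 \<union> Dinf) (calabi_metric \<rho> h f)"
    unfolding higher_cscK_off_def charts_eq
  \<comment> \<open>The value of the constant is the one found in
    \<open>conical_profile_unique\<close>.\<close>
  proof (intro exI[of _ "- 12 * p.k"] ballI)
    fix l x assume l: "l \<in> idx S \<times> UNIV" and x: "x \<in> crd X l ` (dom X l - (D0 \<union> Dinf))"
    obtain i b where i: "l = (i, b)" "i \<in> idx S" using l by auto
    interpret C: calabi_chart "chart_set i" "h i" "\<rho> i" "eps b" f by (rule chart[OF i(2) sf])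
    have Cs: "C.\<sigma> = log_norm h (i, b)" by (auto simp: fun_eq_iff log_norm_def C.\<sigma>_def)
    have Cm: "calabi_metric \<rho> h f l = C.gmat"
      by (simp add: fun_eq_iff calabi_metric_def C.gmat_def Cs i(1))
    have xU: "x \<in> C.U" using x unfolding i(1) crd_image_off[OF i(2)] by (simp add: C.U_def punctured_def)
    have T: "1 + deriv f t \<in> p.T" for t
      using p.\<gamma>(1,2)[of t] p.subset_T by (auto simp: f1)
    have prof: "p.\<phi> (1 + deriv f t) = deriv (deriv f) t" for t by (simp add: f2) (simp add: f1)
    show "is_higher_scalar_curvature (calabi_metric \<rho> h f l) x (- 12 * p.k)"
      unfolding Cm C.curvature_profile[OF xU pos prof p.deriv_\<phi>(1)[OF T] p.deriv_\<phi>(2)[OF T]]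
      by (rule p.\<phi>_ode[OF T])
  qed
  ultimately have "conical_higher_cscK_profile S \<rho> L h m \<beta> p.\<beta>' (restrict p.\<phi> {1..M})"
    unfolding conical_higher_cscK_profile_def Let_def by blast
  then show ?thesis unfolding p.\<beta>'_def unfolding M_def .
qed

end

theorem corollary3p2p1:
  fixes S :: "('a, 'i) surface" and L :: "('a, 'i, 'e) line_bundle"
    and \<rho> h :: "'i \<Rightarrow> complex \<Rightarrow> real" and m \<beta>\<^sub>0 :: real
  assumes "calabi_base S \<rho> L h" and "m > 0" and "\<beta>\<^sub>0 > 0"
  shows "\<exists>!\<beta>inf::real. \<beta>inf > 0 \<and> \<beta>inf > \<beta>\<^sub>0 \<and>
           (\<exists>!\<phi>::real \<Rightarrow> real. conical_higher_cscK_profile S \<rho> L h m \<beta>\<^sub>0 \<beta>inf \<phi>)"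
proof -
  interpret calabi_surface S L \<rho> h by unfold_locales (rule assms(1))
  interpret p: profile_data "\<beta>\<^sub>0" "m + 1" by unfold_locales (use assms in auto)
  show ?thesis
  proof (rule ex1I[of _ p.\<beta>'])
    have "conical_higher_cscK_profile S \<rho> L h m \<beta>\<^sub>0 p.\<beta>' (restrict (conical_profile \<beta>\<^sub>0 (m + 1)) {1..m + 1})"
      using profile_exists[OF assms(2,3)] by (simp add: p.\<beta>'_def)
    then have "\<exists>!\<phi>. conical_higher_cscK_profile S \<rho> L h m \<beta>\<^sub>0 p.\<beta>' \<phi>"
      using profile_unique(2)[OF assms(2)] by blast
    then show "p.\<beta>' > 0 \<and> p.\<beta>' > \<beta>\<^sub>0 \<and> (\<exists>!\<phi>. conical_higher_cscK_profile S \<rho> L h m \<beta>\<^sub>0 p.\<beta>' \<phi>)"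
      using p.\<beta>'_gt by blast
  next
    \<comment> \<open>The existence of a single profile with this angle already forces its
      value.\<close>
    fix \<beta>inf
    assume "\<beta>inf > 0 \<and> \<beta>inf > \<beta>\<^sub>0 \<and> (\<exists>!\<phi>. conical_higher_cscK_profile S \<rho> L h m \<beta>\<^sub>0 \<beta>inf \<phi>)"
    then show "\<beta>inf = p.\<beta>'" using profile_unique(1)[OF assms(2)] by (auto simp: p.\<beta>'_def)
  qed
qed

end
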